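(* $f_{\mathcal{UDG}}(n) = 2^{2^{\Theta(n)}}$; that is, there exist constants $c_1, c_2 > 0$ and $n_0$ such that for all $n \geq n_0$, \[ 2^{2^{c_1 n}} \leq f_{\mathcal{UDG}}(n) \leq 2^{2^{c_2 n}}. \]
   Context: The intersection graph of a tuple of sets $(A(v) : v \in V)$ is the graph with vertex set $V$ in which distinct $u,v$ are adjacent iff $A(u)\cap A(v) \neq \emptyset$; the tuple is then said to realize the graph. A unit disk graph is a graph that is (isomorphic to) the intersection graph of finitely many open disks in $\mathbb{R}^2$ all having the same (positive) radius. Let $\mathcal{UDG}(n)$ be the set of unit disk graphs with $n$ vertices. An integer $\mathcal{UDG}$-realization of a unit disk graph $G$ is a realization of $G$ by open disks whose centers lie in $\mathbb{Z}^2$ and which all have the same radius, this radius being a positive integer; every unit disk graph has one. For a finite collection $\mathcal{A}$ of bounded sets in the plane let $k(\mathcal{A}) := \min\{k \in \mathbb{N} : A \subseteq [-k,k]^2 \text{ for all } A \in \mathcal{A}\}$. Define $f_{\mathcal{UDG}}(G) := \min k(\mathcal{A})$, the minimum being over all integer $\mathcal{UDG}$-realizations $\mathcal{A}$ of $G$, and $f_{\mathcal{UDG}}(n) := \max_{G \in \mathcal{UDG}(n)} f_{\mathcal{UDG}}(G)$. *)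

theory Defs
  imports "HOL-Analysis.Analysis"
begin

text \<open>A simple graph is a pair of a vertex set and a set of two-element edges. The plane is
  \<^typ>\<open>real \<times> real\<close>, whose library metric is the Euclidean one.\<close>

type_synonym 'a graph = "'a set \<times> 'a set set"
type_synonym plane = "real \<times> real"

definition intersection_graph :: "'a set \<Rightarrow> ('a \<Rightarrow> 'p set) \<Rightarrow> 'a graph" where
  "intersection_graph V A =
     (V, {{u, v} | u v. u \<in> V \<and> v \<in> V \<and> u \<noteq> v \<and> A u \<inter> A v \<noteq> {}})"

definition realizes :: "('a \<Rightarrow> 'p set) \<Rightarrow> 'a graph \<Rightarrow> bool" where
  "realizes A G \<longleftrightarrow> intersection_graph (fst G) A = G"

text \<open>Realizations are indexed by the vertices of the graph itself, so the class of unit disk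
  graphs is closed under isomorphism, see \<open>unit_disk_graph_relabel\<close> below.\<close>

definition unit_disk_graph :: "'a graph \<Rightarrow> bool" where
  "unit_disk_graph G \<longleftrightarrow> finite (fst G) \<and>
     (\<exists>A (c :: 'a \<Rightarrow> plane) r. r > 0 \<and> (\<forall>v \<in> fst G. A v = ball (c v) r) \<and> realizes A G)"

definition integer_realization :: "('a \<Rightarrow> plane set) \<Rightarrow> 'a graph \<Rightarrow> bool" where
  "integer_realization A G \<longleftrightarrow>
     (\<exists>c r. r > 0 \<and> r \<in> \<int> \<and> (\<forall>v \<in> fst G. c v \<in> \<int> \<times> \<int> \<and> A v = ball (c v) r) \<and> realizes A G)"

definition grid_size :: "plane set set \<Rightarrow> nat" where
  "grid_size \<A> = (LEAST k. \<forall>A \<in> \<A>. A \<subseteq> {- real k .. real k} \<times> {- real k .. real k})"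

definition f_graph :: "'a graph \<Rightarrow> nat" where
  "f_graph G = (LEAST k. \<exists>A. integer_realization A G \<and> k = grid_size (A ` fst G))"

text \<open>Graphs on \<open>n\<close> vertices are represented on the vertex set \<open>{..<n}\<close>; every graph with
  \<open>n\<close> vertices is isomorphic to one of these, and \<^const>\<open>f_graph\<close> is invariant under
  isomorphism, see \<open>f_graph_relabel\<close> below.\<close>

definition UDG :: "nat \<Rightarrow> nat graph set" where
  "UDG n = {G. fst G = {..<n} \<and> unit_disk_graph G}"

definition f_UDG :: "nat \<Rightarrow> nat" where
  "f_UDG n = Max (f_graph ` UDG n)"

definition relabel :: "('a \<Rightarrow> 'b) \<Rightarrow> 'a graph \<Rightarrow> 'b graph" where
  "relabel h G = (h ` fst G, (`) h ` snd G)"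

lemma realizes_iff:
  "realizes A G \<longleftrightarrow>
     snd G = {{u, v} | u v. u \<in> fst G \<and> v \<in> fst G \<and> u \<noteq> v \<and> A u \<inter> A v \<noteq> {}}"
  unfolding realizes_def intersection_graph_def by (cases G) auto

lemma realizes_relabel:
  assumes "inj_on h (fst G)" and "realizes A G"
    and AB: "\<And>v. v \<in> fst G \<Longrightarrow> B (h v) = A v"
  shows "realizes B (relabel h G)"
proof -
  let ?V = "fst G"
  have E: "snd G = {{u, v} | u v. u \<in> ?V \<and> v \<in> ?V \<and> u \<noteq> v \<and> A u \<inter> A v \<noteq> {}}"
    using assms(2) by (simp only: realizes_iff)
  have "{{x, y} | x y. x \<in> h ` ?V \<and> y \<in> h ` ?V \<and> x \<noteq> y \<and> B x \<inter> B y \<noteq> {}} =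
      (`) h ` {{u, v} | u v. u \<in> ?V \<and> v \<in> ?V \<and> u \<noteq> v \<and> A u \<inter> A v \<noteq> {}}" (is "?L = ?R")
  proof
    show "?L \<subseteq> ?R"
    proof
      fix e assume "e \<in> ?L"
      then obtain u v where uv: "e = {h u, h v}" "u \<in> ?V" "v \<in> ?V" "h u \<noteq> h v"
        "B (h u) \<inter> B (h v) \<noteq> {}" by blast
      then have "e = h ` {u, v}" "u \<noteq> v" "A u \<inter> A v \<noteq> {}" using AB by auto
      with uv show "e \<in> ?R" by blast
    qed
    show "?R \<subseteq> ?L"
    proof
      fix e assume "e \<in> ?R"
      then obtain u v where uv: "e = h ` {u, v}" "u \<in> ?V" "v \<in> ?V" "u \<noteq> v"
        "A u \<inter> A v \<noteq> {}" by blast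
      then have "e = {h u, h v}" "h u \<noteq> h v" "B (h u) \<inter> B (h v) \<noteq> {}"
        using AB inj_onD[OF assms(1)] by auto
      with uv show "e \<in> ?L" by blast
    qed
  qed
  then show ?thesis
    unfolding realizes_iff relabel_def fst_conv snd_conv E by (rule sym)
qed

lemma relabel_inverse:
  assumes "inj_on h (fst G)" and "realizes A G"
  shows "relabel (inv_into (fst G) h) (relabel h G) = G"
proof -
  let ?g = "inv_into (fst G) h"
  have "e \<subseteq> fst G" if "e \<in> snd G" for e
    using that assms(2)[unfolded realizes_iff] by auto
  then have cancel: "?g ` h ` e = e" if "e \<in> snd G" for e
    using that assms(1) by (simp add: inv_into_image_cancel)
  have "(`) ?g ` (`) h ` snd G = (\<lambda>e. e) ` snd G"
    unfolding image_image[of "(`) ?g"] by (rule image_cong[OF refl]) (rule cancel)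
  moreover have "?g ` h ` fst G = fst G"
    using assms(1) by (simp add: inv_into_image_cancel)
  ultimately show ?thesis
    unfolding relabel_def fst_conv snd_conv by (metis image_ident prod.collapse)
qed

lemma unit_disk_graph_relabel:
  assumes inj: "inj_on h (fst G)" and "unit_disk_graph G"
  shows "unit_disk_graph (relabel h G)"
proof -
  let ?g = "inv_into (fst G) h"
  obtain A :: "'a \<Rightarrow> plane set" and c r where *: "finite (fst G)" "r > 0"
    "\<forall>v \<in> fst G. A v = ball (c v) r" "realizes A G"
    using assms(2) unfolding unit_disk_graph_def by blast
  have "realizes (A \<circ> ?g) (relabel h G)"
    by (rule realizes_relabel[OF inj *(4)]) (simp add: inj)
  moreover have "\<forall>v \<in> h ` fst G. (A \<circ> ?g) v = ball ((c \<circ> ?g) v) r"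
    using * inj by auto
  moreover have "fst (relabel h G) = h ` fst G" by (simp add: relabel_def)
  ultimately show ?thesis
    using *(1,2) unfolding unit_disk_graph_def by (metis finite_imageI)
qed

lemma integer_realization_relabel:
  assumes inj: "inj_on h (fst G)" and "integer_realization A G"
  shows "\<exists>B. integer_realization B (relabel h G) \<and> B ` fst (relabel h G) = A ` fst G"
proof -
  let ?g = "inv_into (fst G) h"
  obtain c r where *: "r > 0" "r \<in> \<int>"
    "\<forall>v \<in> fst G. c v \<in> \<int> \<times> \<int> \<and> A v = ball (c v) r" "realizes A G"
    using assms(2) unfolding integer_realization_def by blast
  have "realizes (A \<circ> ?g) (relabel h G)"
    by (rule realizes_relabel[OF inj *(4)]) (simp add: inj)
  moreover have "\<forall>v \<in> h ` fst G. (c \<circ> ?g) v \<in> \<int> \<times> \<int> \<and> (A \<circ> ?g) v = ball ((c \<circ> ?g) v) r"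
    using *(3) inj by simp
  moreover have "fst (relabel h G) = h ` fst G" by (simp add: relabel_def)
  ultimately have "integer_realization (A \<circ> ?g) (relabel h G)"
    using *(1,2) unfolding integer_realization_def by metis
  moreover have "(A \<circ> ?g) ` fst (relabel h G) = A ` fst G"
    using inj by (auto simp: relabel_def image_iff)
  ultimately show ?thesis by blast
qed

lemma f_graph_relabel:
  assumes inj: "inj_on h (fst G)" and "unit_disk_graph G"
  shows "f_graph (relabel h G) = f_graph G"
proof -
  let ?g = "inv_into (fst G) h"
  obtain D :: "'a \<Rightarrow> plane set" where "realizes D G"
    using assms(2) unfolding unit_disk_graph_def by blast
  then have inverse: "relabel ?g (relabel h G) = G" by (rule relabel_inverse[OF inj])
  have injg: "inj_on ?g (fst (relabel h G))" by (simp add: relabel_def inj_on_inv_into)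
  have "(\<exists>A. integer_realization A (relabel h G) \<and> k = grid_size (A ` fst (relabel h G))) \<longleftrightarrow>
      (\<exists>A. integer_realization A G \<and> k = grid_size (A ` fst G))" for k
    using integer_realization_relabel[OF inj] integer_realization_relabel[OF injg]
    unfolding inverse by metis
  then show ?thesis by (simp add: f_graph_def)
qed

end

theory Submission imports Defs begin

text \<open>Upper bound. A unit disk graph is described by a system of quadratic inequalities with small
  integer coefficients in \<open>2 n + 1\<close> variables (the centres and the radius). A solvable system
  \<open>F k \<ge> 0\<close> has a solution that is a limit, for \<open>\<epsilon> \<rightarrow> 0\<close>, of critical points of
  \<open>\<epsilon> (\<Sum>j. x\<^sub>j\<^sup>6) + (\<Sum>k\<in>A. (F k)\<^sup>2)\<close>, where \<open>A\<close> is a set of active constraints. The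
  critical equations rewrite \<open>6 \<epsilon> x\<^sub>j\<^sup>5\<close> into polynomials of degree 3, so every monomial
  reduces to one of the \<open>5\<^sup>2\<^sup>n\<^sup>+\<^sup>1\<close> monomials with exponents below 5. Siegel's lemma then yields an
  integer relation between \<open>\<epsilon>\<close> and each coordinate; its lowest order part in \<open>\<epsilon>\<close> is a nonzero
  integer polynomial vanishing at the limit, whose roots are at most doubly exponential.

  Lower bound. If two disks \<open>a\<close>, \<open>b\<close> meet in a lens that contains a point \<open>p\<close> and points \<open>\<delta>\<close>-close to
  \<open>p\<close> lie outside both disks on either side of the line \<open>a b\<close>, then the lens has height at most
  \<open>2 \<delta>\<close>, hence width \<open>O(\<delta>\<^sup>2)\<close> by the curvature of the disks. Two transversal lenses confine the next points to
  distance \<open>3 \<delta>\<^sup>2\<close> from \<open>p\<close>. A bounded number of disks per step therefore squares the distance,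
  while distinct integer centres have distance at least 1, so the radius is doubly exponential.\<close>

text \<open>Adjacency is a strict inequality, while compactness arguments need closed conditions.
  Hence the margin: after scaling, edges have length at most \<sigma> - 1 and non-edges at least
  \<sigma> + 1. The same gap later pays for rounding the centres to the grid. The gradient of the
  penalty alone has no leading term that could be solved for; the sixth powers supply one in each
  variable. Siegel's lemma is used because it bounds the coefficients of the relation, by a power
  with exponent 4 * 5^m, which is why the bound is doubly exponential. The relation has to hold for
  all \<epsilon> at once, since it is one fixed relation that passes to the limit. In the lower
  bound, adjacency says nothing directly about sides of a line. Which side a point is on has to be
  forced by further disks, through Radon's theorem and perpendicular bisectors. Moreover \<delta> ->
  3 \<delta>^2 contracts only below 1/3, and the first lens has no predecessor that bounds it;
  overlapping copies of the gadget take the place of a predecessor.\<close>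

section \<open>Siegel's lemma\<close>

text \<open>Pigeonhole on vectors with entries in {0..2C}: each image coordinate takes at most 4C^2
  + 1 values, and 4C^2 + 1 < (2C + 1)^2, so twice as many unknowns as equations force a collision.
  The solution is the difference of two colliding vectors.\<close>

lemma siegel:
  fixes A :: "'e \<Rightarrow> 'u \<Rightarrow> int" and C :: nat
  assumes "finite E" "finite U" "U \<noteq> {}" "2 * card E \<le> card U"
    and C: "\<And>e. e \<in> E \<Longrightarrow> (\<Sum>u\<in>U. \<bar>A e u\<bar>) \<le> int C" and "C \<ge> 1"
  shows "\<exists>a :: 'u \<Rightarrow> int. (\<exists>u\<in>U. a u \<noteq> 0) \<and> (\<forall>u\<in>U. \<bar>a u\<bar> \<le> 2 * int C) \<and>
    (\<forall>e\<in>E. (\<Sum>u\<in>U. a u * A e u) = 0)"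
proof -
  define D where "D = PiE U (\<lambda>_. {0..2 * int C})"
  define Y where "Y = PiE E (\<lambda>_. {- (2 * int C * int C)..2 * int C * int C})"
  define \<phi> where "\<phi> f = restrict (\<lambda>e. \<Sum>u\<in>U. f u * A e u) E" for f
  have cardD: "card D = (2 * C + 1) ^ card U"
    unfolding D_def using assms by (simp add: card_PiE nat_add_distrib nat_mult_distrib)
  have "nat (2 * int C * int C - - (2 * int C * int C) + 1) = 4 * C * C + 1"
    by (simp add: nat_eq_iff)
  then have cardY: "card Y = (4 * C * C + 1) ^ card E"
    unfolding Y_def using assms by (simp add: card_PiE)
  have "finite Y" unfolding Y_def using assms by (intro finite_PiE) auto
  have img: "\<phi> ` D \<subseteq> Y"
  proof
    fix y assume "y \<in> \<phi> ` D"
    then obtain f where f: "f \<in> D" "y = \<phi> f" by auto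
    have "\<bar>\<Sum>u\<in>U. f u * A e u\<bar> \<le> 2 * int C * int C" if "e \<in> E" for e
    proof -
      have "\<bar>\<Sum>u\<in>U. f u * A e u\<bar> \<le> (\<Sum>u\<in>U. \<bar>f u * A e u\<bar>)" by (rule sum_abs)
      also have "\<dots> \<le> (\<Sum>u\<in>U. 2 * int C * \<bar>A e u\<bar>)"
      proof (rule sum_mono)
        fix u assume "u \<in> U"
        then have "f u \<in> {0..2 * int C}" using f(1) unfolding D_def by (auto dest: PiE_mem)
        then show "\<bar>f u * A e u\<bar> \<le> 2 * int C * \<bar>A e u\<bar>"
          by (simp add: abs_mult mult_right_mono)
      qed
      also have "\<dots> \<le> 2 * int C * int C"
        using C[OF that] by (simp add: sum_distrib_left[symmetric] mult_left_mono)
      finally show ?thesis .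
    qed
    then show "y \<in> Y" unfolding f(2) \<phi>_def Y_def by (auto simp: abs_le_iff) (smt (verit))+
  qed
  have "card Y < card D"
  proof -
    have "(4 * C * C + 1) ^ card E \<le> ((2 * C + 1)\<^sup>2) ^ card E"
      by (intro power_mono) (auto simp: power2_eq_square)
    moreover have "((2 * C + 1)\<^sup>2) ^ card E \<le> (2 * C + 1) ^ card U"
      using assms(4) by (metis One_nat_def power_increasing power_mult le_add2)
    moreover have "(4 * C * C + 1) ^ card E < (2 * C + 1) ^ card U"
    proof (cases "card E = 0")
      case True
      have "card U > 0" using assms by (simp add: card_gt_0_iff)
      then show ?thesis using True \<open>C \<ge> 1\<close> one_less_power[of "2 * C + 1" "card U"] by simp
    next
      case False
      then have "(4 * C * C + 1) ^ card E < ((2 * C + 1)\<^sup>2) ^ card E"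
        using \<open>C \<ge> 1\<close> by (intro power_strict_mono) (auto simp: power2_eq_square)
      then show ?thesis using calculation(2) by linarith
    qed
    ultimately show ?thesis using cardD cardY by simp
  qed
  then have "\<not> inj_on \<phi> D"
    using card_inj_on_le[OF _ img \<open>finite Y\<close>] by fastforce
  then obtain f g where fg: "f \<in> D" "g \<in> D" "f \<noteq> g" "\<phi> f = \<phi> g" unfolding inj_on_def by blast
  show ?thesis
  proof (intro exI conjI ballI)
    show "\<exists>u\<in>U. f u - g u \<noteq> 0"
      using fg(1-3) PiE_ext[of f U _ g] unfolding D_def by (metis eq_iff_diff_eq_0)
    show "\<bar>f u - g u\<bar> \<le> 2 * int C" if "u \<in> U" for u
    proof -
      have "f u \<in> {0..2 * int C}" "g u \<in> {0..2 * int C}"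
        using fg(1,2) that unfolding D_def by (auto dest: PiE_mem)
      then show ?thesis by auto
    qed
    show "(\<Sum>u\<in>U. (f u - g u) * A e u) = 0" if "e \<in> E" for e
      using fun_cong[OF fg(4), of e] that unfolding \<phi>_def
      by (simp add: left_diff_distrib sum_subtractf)
  qed
qed

section \<open>Reduction of monomials modulo critical equations\<close>

definition mon :: "nat \<Rightarrow> (nat \<Rightarrow> nat) \<Rightarrow> (nat \<Rightarrow> real) \<Rightarrow> real" where
  "mon m q x = (\<Prod>i<m. x i ^ q i)"

definition mdeg :: "nat \<Rightarrow> (nat \<Rightarrow> nat) \<Rightarrow> nat" where
  "mdeg m q = (\<Sum>i<m. q i)"

lemma mon_add: "mon m (\<lambda>i. p i + q i) = (\<lambda>x. mon m p x * mon m q x)"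
  by (simp add: mon_def[abs_def] power_add prod.distrib)

lemma mdeg_add: "mdeg m (\<lambda>i. p i + q i) = mdeg m p + mdeg m q"
  by (simp add: mdeg_def sum.distrib)

lemma mon_single: "i < m \<Longrightarrow> mon m (\<lambda>j. if j = i then k else 0) = (\<lambda>x. x i ^ k)"
proof (rule ext)
  fix x :: "nat \<Rightarrow> real"
  assume "i < m"
  have "mon m (\<lambda>j. if j = i then k else 0) x = (\<Prod>j<m. if j = i then x i ^ k else 1)"
    unfolding mon_def by (rule prod.cong) auto
  then show "mon m (\<lambda>j. if j = i then k else 0) x = x i ^ k" using \<open>i < m\<close> by simp
qed

lemma mdeg_single: "i < m \<Longrightarrow> mdeg m (\<lambda>j. if j = i then k else 0) = k"
  by (simp add: mdeg_def)

lemma mon_zero: "mon m (\<lambda>_. 0) x = 1" and mdeg_zero: "mdeg m (\<lambda>_. 0) = 0"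
  by (simp_all add: mon_def mdeg_def)

text \<open>Integer polynomial functions of \<open>x 0, \<dots>, x (m - 1)\<close>; \<open>d\<close> bounds the degree and \<open>L\<close> the sum of the
  absolute values of the coefficients.\<close>

inductive ipoly :: "nat \<Rightarrow> nat \<Rightarrow> nat \<Rightarrow> ((nat \<Rightarrow> real) \<Rightarrow> real) \<Rightarrow> bool" for m where
  ipoly_zero: "ipoly m d L (\<lambda>x. 0)"
| ipoly_mon: "mdeg m q \<le> d \<Longrightarrow> 1 \<le> L \<Longrightarrow> ipoly m d L (mon m q)"
| ipoly_neg: "ipoly m d L f \<Longrightarrow> ipoly m d L (\<lambda>x. - f x)"
| ipoly_add: "ipoly m d K f \<Longrightarrow> ipoly m d L g \<Longrightarrow> K + L \<le> M \<Longrightarrow> ipoly m d M (\<lambda>x. f x + g x)"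

lemma ipoly_weaken: "ipoly m d L f \<Longrightarrow> d \<le> d' \<Longrightarrow> L \<le> L' \<Longrightarrow> ipoly m d' L' f"
proof (induction arbitrary: L' rule: ipoly.induct)
  case (ipoly_add d K f L g M)
  then show ?case using ipoly.ipoly_add[OF ipoly_add.IH(1)[of K] ipoly_add.IH(2)[of L]] by simp
qed (auto intro: ipoly.intros)

lemma ipoly_const1: "ipoly m d 1 (\<lambda>x. 1)"
  using ipoly_mon[of m "\<lambda>_. 0" d 1] by (simp add: mdeg_zero mon_zero[abs_def])

lemma ipoly_var: "i < m \<Longrightarrow> 1 \<le> d \<Longrightarrow> ipoly m d 1 (\<lambda>x. x i)"
  using ipoly_mon[of m "\<lambda>j. if j = i then 1 else 0" d 1] mon_single[of i m 1]
  by (simp add: mdeg_single)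

lemma ipoly_diff:
  "ipoly m d K f \<Longrightarrow> ipoly m d L g \<Longrightarrow> K + L \<le> M \<Longrightarrow> ipoly m d M (\<lambda>x. f x - g x)"
  using ipoly_add[OF _ ipoly_neg, of m d K f L g M] by simp

lemma ipoly_mult_mon: "ipoly m d L f \<Longrightarrow> ipoly m (mdeg m q + d) L (\<lambda>x. mon m q x * f x)"
proof (induction rule: ipoly.induct)
  case (ipoly_zero d L)
  then show ?case by (simp add: ipoly.ipoly_zero)
next
  case (ipoly_mon p d L)
  then show ?case
    using ipoly.ipoly_mon[of m "\<lambda>i. q i + p i" "mdeg m q + d" L] by (simp add: mdeg_add mon_add)
next
  case (ipoly_neg d L f)
  then show ?case using ipoly.ipoly_neg[OF ipoly_neg.IH] by simp
next
  case (ipoly_add d K f L g M)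
  then show ?case
    using ipoly.ipoly_add[OF ipoly_add.IH ipoly_add.hyps(3)] by (simp add: distrib_left)
qed

lemma ipoly_mult:
  "ipoly m d L f \<Longrightarrow> ipoly m e K g \<Longrightarrow> d + e \<le> k \<Longrightarrow> L * K \<le> M \<Longrightarrow> ipoly m k M (\<lambda>x. f x * g x)"
proof (induction arbitrary: M rule: ipoly.induct)
  case (ipoly_zero d L)
  then show ?case by (simp add: ipoly.ipoly_zero)
next
  case (ipoly_mon q d L)
  have "ipoly m (mdeg m q + e) K (\<lambda>x. mon m q x * g x)" by (rule ipoly_mult_mon[OF ipoly_mon(3)])
  moreover have "K \<le> M" using ipoly_mon(2,5) by (metis le_trans mult_1 mult_le_mono1)
  ultimately show ?case using ipoly_mon by (auto elim: ipoly_weaken)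
next
  case (ipoly_neg d L f)
  then show ?case using ipoly.ipoly_neg[of m k M "\<lambda>x. f x * g x"] by simp
next
  case (ipoly_add d L f L' h N)
  have "(L + L') * K \<le> N * K" using ipoly_add.hyps(3) by (rule mult_le_mono1)
  then have "L * K + L' * K \<le> M" using ipoly_add.prems(3) by (simp add: distrib_right)
  then show ?case
    using ipoly.ipoly_add[OF ipoly_add.IH(1)[of "L * K"] ipoly_add.IH(2)[of "L' * K"]] ipoly_add.prems
    by (simp add: distrib_right)
qed

lemma ipoly_sum:
  assumes "finite A" "\<And>k. k \<in> A \<Longrightarrow> ipoly m d L (f k)" "card A * L \<le> M"
  shows "ipoly m d M (\<lambda>x. \<Sum>k\<in>A. f k x)"
proof -
  have "ipoly m d (card A * L) (\<lambda>x. \<Sum>k\<in>A. f k x)"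
    using assms(1,2)
  proof (induction A)
    case (insert k A)
    then show ?case using ipoly_add[of m d L "f k" "card A * L"] by simp
  qed (simp add: ipoly_zero)
  then show ?thesis using assms(3) by (auto elim: ipoly_weaken)
qed

lemma continuous_on_mon: "continuous_on S (mon m q)"
  unfolding mon_def[abs_def]
  by (intro continuous_intros continuous_on_product_then_coordinatewise continuous_on_id)

lemma continuous_on_ipoly: "ipoly m d L f \<Longrightarrow> continuous_on S f"
  by (induction rule: ipoly.induct) (auto intro!: continuous_intros continuous_on_mon)

definition basis :: "nat \<Rightarrow> (nat \<Rightarrow> nat) set" where
  "basis m = PiE {..<m} (\<lambda>_. {..<5})"

lemma finite_basis: "finite (basis m)" and card_basis: "card (basis m) = 5 ^ m"
  by (auto simp: basis_def card_PiE intro: finite_PiE)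

text \<open>\<open>Sol\<close> stands for the pairs of a parameter \<open>\<eta>\<close> and a solution of the critical equations.\<close>

definition red :: "nat \<Rightarrow> (real \<times> (nat \<Rightarrow> real)) set \<Rightarrow> nat \<Rightarrow> nat \<Rightarrow> ((nat \<Rightarrow> real) \<Rightarrow> real) \<Rightarrow> bool" where
  "red m Sol T C f \<longleftrightarrow> (\<exists>c :: (nat \<Rightarrow> nat) \<Rightarrow> nat \<Rightarrow> int.
     (\<forall>(\<eta>, x) \<in> Sol. \<eta> ^ T * f x = (\<Sum>\<gamma>\<in>basis m. \<Sum>e\<le>T. of_int (c \<gamma> e) * \<eta> ^ e * mon m \<gamma> x)) \<and>
     (\<Sum>\<gamma>\<in>basis m. \<Sum>e\<le>T. \<bar>c \<gamma> e\<bar>) \<le> int C)"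

lemma red_zero: "red m Sol T C (\<lambda>x. 0)"
  unfolding red_def by (rule exI[of _ "\<lambda>_ _. 0"]) auto

lemma red_neg: "red m Sol T C f \<Longrightarrow> red m Sol T C (\<lambda>x. - f x)"
  unfolding red_def
proof (elim exE conjE)
  fix c :: "(nat \<Rightarrow> nat) \<Rightarrow> nat \<Rightarrow> int"
  assume "\<forall>(\<eta>, x) \<in> Sol. \<eta> ^ T * f x = (\<Sum>\<gamma>\<in>basis m. \<Sum>e\<le>T. of_int (c \<gamma> e) * \<eta> ^ e * mon m \<gamma> x)"
    "(\<Sum>\<gamma>\<in>basis m. \<Sum>e\<le>T. \<bar>c \<gamma> e\<bar>) \<le> int C"
  then show "\<exists>c :: (nat \<Rightarrow> nat) \<Rightarrow> nat \<Rightarrow> int.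
     (\<forall>(\<eta>, x) \<in> Sol. \<eta> ^ T * - f x = (\<Sum>\<gamma>\<in>basis m. \<Sum>e\<le>T. of_int (c \<gamma> e) * \<eta> ^ e * mon m \<gamma> x)) \<and>
     (\<Sum>\<gamma>\<in>basis m. \<Sum>e\<le>T. \<bar>c \<gamma> e\<bar>) \<le> int C"
    by (intro exI[of _ "\<lambda>\<gamma> e. - c \<gamma> e"]) (auto simp: sum_negf)
qed

lemma red_add:
  assumes "red m Sol T C f" "red m Sol T D g" "C + D \<le> E"
  shows "red m Sol T E (\<lambda>x. f x + g x)"
proof -
  obtain c where c: "\<forall>(\<eta>, x) \<in> Sol. \<eta> ^ T * f x = (\<Sum>\<gamma>\<in>basis m. \<Sum>e\<le>T. of_int (c \<gamma> e) * \<eta> ^ e * mon m \<gamma> x)"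
    "(\<Sum>\<gamma>\<in>basis m. \<Sum>e\<le>T. \<bar>c \<gamma> e\<bar>) \<le> int C" using assms(1) unfolding red_def by blast
  obtain d where d: "\<forall>(\<eta>, x) \<in> Sol. \<eta> ^ T * g x = (\<Sum>\<gamma>\<in>basis m. \<Sum>e\<le>T. of_int (d \<gamma> e) * \<eta> ^ e * mon m \<gamma> x)"
    "(\<Sum>\<gamma>\<in>basis m. \<Sum>e\<le>T. \<bar>d \<gamma> e\<bar>) \<le> int D" using assms(2) unfolding red_def by blast
  have "(\<Sum>\<gamma>\<in>basis m. \<Sum>e\<le>T. \<bar>c \<gamma> e + d \<gamma> e\<bar>) \<le> (\<Sum>\<gamma>\<in>basis m. \<Sum>e\<le>T. \<bar>c \<gamma> e\<bar> + \<bar>d \<gamma> e\<bar>)"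
    by (intro sum_mono abs_triangle_ineq)
  also have "\<dots> \<le> int E" using c(2) d(2) assms(3) by (simp add: sum.distrib)
  finally show ?thesis unfolding red_def using c(1) d(1)
    by (intro exI[of _ "\<lambda>\<gamma> e. c \<gamma> e + d \<gamma> e"])
      (simp add: case_prod_unfold sum.distrib distrib_right distrib_left)
qed

lemma red_mono: "red m Sol T C f \<Longrightarrow> C \<le> D \<Longrightarrow> red m Sol T D f"
  using red_add[OF _ red_zero[of m Sol T 0], of C f D] by simp

text \<open>This is where a critical equation enters: one factor \<eta> is spent and the
  coefficients are reused unchanged.\<close>

lemma red_eta:
  assumes "red m Sol T C g" "\<And>\<eta> x. (\<eta>, x) \<in> Sol \<Longrightarrow> \<eta> * f x = g x"
  shows "red m Sol (Suc T) C f"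
proof -
  obtain c where c: "\<forall>(\<eta>, x) \<in> Sol. \<eta> ^ T * g x = (\<Sum>\<gamma>\<in>basis m. \<Sum>e\<le>T. of_int (c \<gamma> e) * \<eta> ^ e * mon m \<gamma> x)"
    "(\<Sum>\<gamma>\<in>basis m. \<Sum>e\<le>T. \<bar>c \<gamma> e\<bar>) \<le> int C" using assms(1) unfolding red_def by blast
  have "\<eta> ^ Suc T * f x = \<eta> ^ T * g x" if "(\<eta>, x) \<in> Sol" for \<eta> x
    using assms(2)[OF that, symmetric] by simp
  \<comment> \<open>In \<open>red\<close> the index e now runs up to Suc T, where nothing is known
    about c; the coefficient there is set to 0.\<close>
  then show ?thesis unfolding red_def using c
    by (intro exI[of _ "\<lambda>\<gamma> e. if e = Suc T then 0 else c \<gamma> e"])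
      (simp add: case_prod_unfold del: power_Suc)
qed

text \<open>A reduced monomial needs no critical equation, but \<open>red\<close> speaks of its
  multiple by \<eta>^T; the single coefficient 1 therefore sits at e = T.\<close>

lemma red_basis:
  assumes "\<And>i. i < m \<Longrightarrow> q i < 5"
  shows "red m Sol T 1 (mon m q)"
proof -
  \<comment> \<open>\<open>mon\<close> ignores exponents from m on, whereas members of
    \<open>basis m\<close> are extensional; the restriction picks the representative.\<close>
  let ?b = "restrict q {..<m}"
  have b: "?b \<in> basis m" using assms by (auto simp: basis_def)
  have mon: "mon m ?b x = mon m q x" for x by (simp add: mon_def)
  have sgl: "(\<Sum>\<gamma>\<in>basis m. \<Sum>e\<le>T. F \<gamma> e) = F ?b T"
    if "\<And>\<gamma> e. \<gamma> \<noteq> ?b \<or> e \<noteq> T \<Longrightarrow> F \<gamma> e = 0" for F :: "(nat \<Rightarrow> nat) \<Rightarrow> nat \<Rightarrow> 'a :: comm_monoid_add"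
  proof -
    have "(\<Sum>e\<le>T. F \<gamma> e) = (if \<gamma> = ?b then F ?b T else 0)" for \<gamma>
    proof (cases "\<gamma> = ?b")
      case True
      have "(\<Sum>e\<le>T. F ?b e) = (\<Sum>e\<le>T. if e = T then F ?b T else 0)"
        by (intro sum.cong) (use that in auto)
      then show ?thesis using True by simp
    qed (use that in auto)
    then show ?thesis using b finite_basis by simp
  qed
  have 1: "(\<Sum>\<gamma>\<in>basis m. \<Sum>e\<le>T. of_int (if \<gamma> = ?b \<and> e = T then 1 else 0) * \<eta> ^ e * mon m \<gamma> x)
     = \<eta> ^ T * mon m q x" for \<eta> x
    by (subst sgl) (auto simp: mon)
  have 2: "(\<Sum>\<gamma>\<in>basis m. \<Sum>e\<le>T. \<bar>if \<gamma> = ?b \<and> e = T then 1 else 0 :: int\<bar>) = 1"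
    by (subst sgl) auto
  show ?thesis unfolding red_def
    by (rule exI[of _ "\<lambda>\<gamma> e. if \<gamma> = ?b \<and> e = T then 1 else 0"]) (simp only: 1 2, simp)
qed

lemma red_ipoly:
  assumes "ipoly m d L f" and "\<And>q. mdeg m q \<le> k \<Longrightarrow> red m Sol T C (mon m q)"
    and "mdeg m p + d \<le> k"
  shows "red m Sol T (L * C) (\<lambda>x. mon m p x * f x)"
  using assms
proof (induction rule: ipoly.induct)
  case (ipoly_zero d L)
  then show ?case by (simp add: red_zero)
next
  case (ipoly_mon q d L)
  then have "red m Sol T C (mon m (\<lambda>i. p i + q i))" by (intro ipoly_mon) (simp add: mdeg_add)
  then have "red m Sol T (L * C) (mon m (\<lambda>i. p i + q i))"
    by (rule red_mono) (use ipoly_mon(2) in simp)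
  then show ?case by (simp only: mon_add)
next
  case (ipoly_neg d L f)
  then show ?case using red_neg[of m Sol T "L * C" "\<lambda>x. mon m p x * f x"] by simp
next
  case (ipoly_add d L f L' g M)
  have "L * C + L' * C \<le> M * C" using ipoly_add.hyps(3) by (metis add_mult_distrib mult_le_mono1)
  then show ?case
    using red_add[of m Sol T "L * C" "\<lambda>x. mon m p x * f x" "L' * C" "\<lambda>x. mon m p x * g x" "M * C"]
      ipoly_add by (simp add: distrib_left)
qed

text \<open>Replacing \<open>x\<^sub>j\<^sup>5\<close> by G j lowers the degree by at least 2 and
  multiplies the coefficient sum by at most L, so T steps are more than enough for degree T. Using
  the same exponent T for all monomials is what allows their reductions to be added.\<close>

lemma red_mon:
  assumes "\<And>j. j < m \<Longrightarrow> ipoly m 3 L (G j)" "L \<ge> 1"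
    and Sol: "\<And>\<eta> x j. (\<eta>, x) \<in> Sol \<Longrightarrow> j < m \<Longrightarrow> \<eta> * x j ^ 5 = G j x"
  shows "mdeg m q \<le> T \<Longrightarrow> red m Sol T (L ^ T) (mon m q)"
proof (induction T arbitrary: q)
  case 0
  then have "q i < 5" if "i < m" for i using that by (simp add: mdeg_def)
  then show ?case using red_basis[of m q Sol 0] by simp
next
  case (Suc T)
  show ?case
  proof (cases "\<forall>i<m. q i < 5")
    case True
    then have "red m Sol (Suc T) 1 (mon m q)" by (intro red_basis) auto
    then show ?thesis by (rule red_mono) (use \<open>L \<ge> 1\<close> in simp)
  next
    case False
    then obtain j where j: "j < m" "q j \<ge> 5" by auto
    define p where "p = q(j := q j - 5)"
    have q: "q = (\<lambda>i. p i + (if i = j then 5 else 0))" using j by (auto simp: p_def)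
    have deg: "mdeg m q = mdeg m p + 5"
      using mdeg_add[of m p "\<lambda>i. if i = j then 5 else 0"] mdeg_single[OF j(1), of 5] q by simp
    have mon: "mon m q x = mon m p x * x j ^ 5" for x
      using fun_cong[OF mon_add[of m p "\<lambda>i. if i = j then 5 else 0"], of x]
        fun_cong[OF mon_single[OF j(1), of 5], of x] arg_cong[OF q, of "\<lambda>q. mon m q x"] by simp
    have "red m Sol T (L * L ^ T) (\<lambda>x. mon m p x * G j x)"
    proof (rule red_ipoly)
      show "ipoly m 3 L (G j)" by (rule assms(1)[OF j(1)])
      show "red m Sol T (L ^ T) (mon m q')" if "mdeg m q' \<le> T" for q' by (rule Suc.IH[OF that])
      show "mdeg m p + 3 \<le> T" using Suc.prems deg by simp
    qed
    moreover have "\<eta> * mon m q x = mon m p x * G j x" if "(\<eta>, x) \<in> Sol" for \<eta> x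
      using Sol[OF that j(1)] mon by (simp add: algebra_simps)
    ultimately show ?thesis by (simp only: power_Suc) (rule red_eta)
  qed
qed

text \<open>After multiplication by \<eta>^J, each power of x i up to the J-th reduces to the 5^m
  basis monomials times powers of \<eta>. A relation then amounts to 5^m (2J + 1) linear equations
  in (J + 1)^2 unknowns, and J = 4 * 5^m leaves the factor two that \<open>siegel\<close> asks for.
  The equations do not involve the pair (\<eta>, x), so one relation serves all of Sol.\<close>

lemma integer_relation:
  fixes L m :: nat
  defines "J \<equiv> 4 * 5 ^ m"
  defines "C \<equiv> (J + 1) * L ^ J"
  assumes G: "\<And>j. j < m \<Longrightarrow> ipoly m 3 L (G j)" and L: "L \<ge> 1"
    and Sol: "\<And>\<eta> x j. (\<eta>, x) \<in> Sol \<Longrightarrow> j < m \<Longrightarrow> \<eta> * x j ^ 5 = G j x"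
    and nz: "\<And>\<eta> x. (\<eta>, x) \<in> Sol \<Longrightarrow> \<eta> \<noteq> 0" and i: "i < m"
  shows "\<exists>a :: nat \<Rightarrow> nat \<Rightarrow> int. (\<exists>j\<le>J. \<exists>k\<le>J. a j k \<noteq> 0) \<and>
    (\<forall>j\<le>J. \<forall>k\<le>J. \<bar>a j k\<bar> \<le> 2 * int C) \<and>
    (\<forall>(\<eta>, x) \<in> Sol. (\<Sum>j\<le>J. \<Sum>k\<le>J. of_int (a j k) * \<eta> ^ j * x i ^ k) = 0)"
proof -
  have "red m Sol J (L ^ J) (\<lambda>x. x i ^ k)" if "k \<le> J" for k
    using red_mon[of m L G Sol "\<lambda>j. if j = i then k else 0" J, OF G L Sol] that
    by (simp add: mdeg_single[OF i] mon_single[OF i])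
  moreover define P where "P k c \<longleftrightarrow>
     (\<forall>(\<eta>, x) \<in> Sol. \<eta> ^ J * x i ^ k = (\<Sum>\<gamma>\<in>basis m. \<Sum>e\<le>J. of_int (c \<gamma> e) * \<eta> ^ e * mon m \<gamma> x)) \<and>
     (\<Sum>\<gamma>\<in>basis m. \<Sum>e\<le>J. \<bar>c \<gamma> e\<bar>) \<le> int (L ^ J)" for k and c :: "(nat \<Rightarrow> nat) \<Rightarrow> nat \<Rightarrow> int"
  ultimately have "\<forall>k\<in>{..J}. \<exists>c. P k c" by (simp add: red_def)
  from bchoice[OF this] obtain c where "\<forall>k\<in>{..J}. P k (c k)" by (rule exE)
  then have P: "P k (c k)" if "k \<le> J" for k using that by simp
  have c: "\<eta> ^ J * x i ^ k = (\<Sum>\<gamma>\<in>basis m. \<Sum>e\<le>J. of_int (c k \<gamma> e) * \<eta> ^ e * mon m \<gamma> x)"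
    if "k \<le> J" "(\<eta>, x) \<in> Sol" for k \<eta> x using P[OF that(1)] that(2) unfolding P_def by fast
  have c_le: "(\<Sum>\<gamma>\<in>basis m. \<Sum>e\<le>J. \<bar>c k \<gamma> e\<bar>) \<le> int (L ^ J)" if "k \<le> J" for k
    using P[OF that] unfolding P_def by (rule conjunct2)
  define U where "U = {..J} \<times> {..J}"
  define E where "E = basis m \<times> {..2 * J}"
  \<comment> \<open>\<open>A (\<gamma>, f) (j, k)\<close> is the coefficient of
    \<open>\<eta> ^ f * mon m \<gamma> x\<close> in
    \<open>\<eta> ^ j * (\<eta> ^ J * x i ^ k)\<close>.\<close>
  define A where "A = (\<lambda>(\<gamma>, e) (j, k). \<Sum>d\<le>J. if j + d = e then c k \<gamma> d else 0)"
  have row: "(\<Sum>u\<in>U. \<bar>A e u\<bar>) \<le> int C" if "e \<in> E" for e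
  proof -
    obtain \<gamma> f where e: "e = (\<gamma>, f)" "\<gamma> \<in> basis m" using \<open>e \<in> E\<close> unfolding E_def by auto
    have "(\<Sum>u\<in>U. \<bar>A e u\<bar>) \<le> (\<Sum>(j, k)\<in>U. \<Sum>d\<le>J. if j + d = f then \<bar>c k \<gamma> d\<bar> else 0)"
    proof (rule sum_mono)
      fix u assume "u \<in> U"
      obtain j k where u: "u = (j, k)" by (cases u)
      have "\<bar>A e u\<bar> \<le> (\<Sum>d\<le>J. \<bar>if j + d = f then c k \<gamma> d else 0\<bar>)"
        unfolding A_def e u prod.case by (rule sum_abs)
      then show "\<bar>A e u\<bar> \<le> (case u of (j, k) \<Rightarrow> \<Sum>d\<le>J. if j + d = f then \<bar>c k \<gamma> d\<bar> else 0)"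
        unfolding u prod.case by (simp add: if_distrib cong: if_cong)
    qed
    also have "\<dots> = (\<Sum>j\<le>J. \<Sum>k\<le>J. \<Sum>d\<le>J. if j + d = f then \<bar>c k \<gamma> d\<bar> else 0)"
      unfolding U_def by (rule sum.cartesian_product[symmetric])
    also have "\<dots> = (\<Sum>k\<le>J. \<Sum>j\<le>J. \<Sum>d\<le>J. if j + d = f then \<bar>c k \<gamma> d\<bar> else 0)"
      by (rule sum.swap)
    also have "\<dots> = (\<Sum>k\<le>J. \<Sum>d\<le>J. \<Sum>j\<le>J. if j + d = f then \<bar>c k \<gamma> d\<bar> else 0)"
      by (rule sum.cong[OF refl]) (rule sum.swap)
    also have "\<dots> \<le> (\<Sum>k\<le>J. \<Sum>d\<le>J. \<bar>c k \<gamma> d\<bar>)"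
    proof (intro sum_mono)
      fix k d
      \<comment> \<open>For fixed d at most one j satisfies j + d = f. Under truncated subtraction
        the condition j = f - d is weaker when d > f, hence only an inequality.\<close>
      have "(\<Sum>j\<le>J. if j + d = f then \<bar>c k \<gamma> d\<bar> else 0) \<le> (\<Sum>j\<le>J. if j = f - d then \<bar>c k \<gamma> d\<bar> else 0)"
        by (intro sum_mono) auto
      also have "\<dots> \<le> \<bar>c k \<gamma> d\<bar>" by simp
      finally show "(\<Sum>j\<le>J. if j + d = f then \<bar>c k \<gamma> d\<bar> else 0) \<le> \<bar>c k \<gamma> d\<bar>" .
    qed
    also have "\<dots> \<le> (\<Sum>k\<le>J. int (L ^ J))"
    proof (rule sum_mono)
      fix k assume "k \<in> {..J}"
      have "(\<Sum>d\<le>J. \<bar>c k \<gamma> d\<bar>) \<le> (\<Sum>\<gamma>\<in>basis m. \<Sum>e\<le>J. \<bar>c k \<gamma> e\<bar>)"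
        by (rule member_le_sum[OF e(2)]) (auto simp: finite_basis intro: sum_nonneg)
      then show "(\<Sum>d\<le>J. \<bar>c k \<gamma> d\<bar>) \<le> int (L ^ J)" using c_le[of k] \<open>k \<in> {..J}\<close> by simp
    qed
    also have "\<dots> = int C" by (simp add: C_def distrib_right)
    finally show ?thesis .
  qed
  have cards: "2 * card E \<le> card U"
  proof -
    have "card E = 5 ^ m * (2 * J + 1)" by (simp add: E_def card_cartesian_product card_basis)
    moreover have "card U = (J + 1) * (J + 1)" by (simp add: U_def card_cartesian_product)
    moreover have "4 * 5 ^ m * (2 * J + 1) \<le> 2 * ((J + 1) * (J + 1))"
      unfolding J_def[symmetric] by (simp add: algebra_simps)
    ultimately show ?thesis by simp
  qed
  have fin: "finite E" "finite U" "U \<noteq> {}" by (auto simp: E_def U_def finite_basis)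
  have "C \<ge> 1" using L by (simp add: C_def trans_le_add1 one_le_power)
  obtain a :: "nat \<times> nat \<Rightarrow> int" where a: "\<exists>u\<in>U. a u \<noteq> 0" "\<And>u. u \<in> U \<Longrightarrow> \<bar>a u\<bar> \<le> 2 * int C"
    "\<And>e. e \<in> E \<Longrightarrow> (\<Sum>u\<in>U. a u * A e u) = 0"
    using siegel[of E U A C, OF fin cards row \<open>C \<ge> 1\<close>] by blast
  show ?thesis
  proof (rule exI[of _ "\<lambda>j k. a (j, k)"], safe)
    show "\<exists>j\<le>J. \<exists>k\<le>J. a (j, k) \<noteq> 0" using a(1) by (auto simp: U_def)
    show "\<bar>a (j, k)\<bar> \<le> 2 * int C" if "j \<le> J" "k \<le> J" for j k using a(2)[of "(j, k)"] that by (simp add: U_def)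
  next
    fix \<eta> x assume S: "(\<eta>, x) \<in> Sol"
    have shift: "\<eta> ^ j * (\<Sum>d\<le>J. of_int (c k \<gamma> d) * \<eta> ^ d) = (\<Sum>f\<le>2*J. of_int (A (\<gamma>, f) (j, k)) * \<eta> ^ f)"
      if "j \<le> J" for j k \<gamma>
    proof -
      have "(\<Sum>f\<le>2*J. of_int (A (\<gamma>, f) (j, k)) * \<eta> ^ f)
        = (\<Sum>f\<le>2*J. \<Sum>d\<le>J. if f = j + d then of_int (c k \<gamma> d) * \<eta> ^ (j + d) else 0)"
        unfolding A_def prod.case of_int_sum sum_distrib_right
        by (intro sum.cong refl) auto
      also have "\<dots> = (\<Sum>d\<le>J. \<Sum>f\<le>2*J. if f = j + d then of_int (c k \<gamma> d) * \<eta> ^ (j + d) else 0)"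
        by (rule sum.swap)
      also have "\<dots> = (\<Sum>d\<le>J. of_int (c k \<gamma> d) * \<eta> ^ (j + d))"
        by (rule sum.cong) (use that in auto)
      finally show ?thesis by (simp add: sum_distrib_left power_add algebra_simps)
    qed
    have "\<eta> ^ J * (\<Sum>j\<le>J. \<Sum>k\<le>J. of_int (a (j, k)) * \<eta> ^ j * x i ^ k)
      = (\<Sum>j\<le>J. \<Sum>k\<le>J. of_int (a (j, k)) * \<eta> ^ j * (\<eta> ^ J * x i ^ k))"
      by (simp add: sum_distrib_left algebra_simps)
    also have "\<dots> = (\<Sum>j\<le>J. \<Sum>k\<le>J. \<Sum>\<gamma>\<in>basis m. \<Sum>f\<le>2*J. of_int (a (j, k) * A (\<gamma>, f) (j, k)) * (\<eta> ^ f * mon m \<gamma> x))"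
    proof (intro sum.cong refl)
      fix j k assume "j \<in> {..J}" "k \<in> {..J}"
      then have "\<eta> ^ J * x i ^ k = (\<Sum>\<gamma>\<in>basis m. (\<Sum>d\<le>J. of_int (c k \<gamma> d) * \<eta> ^ d) * mon m \<gamma> x)"
        using c[OF _ S, of k] by (simp add: sum_distrib_right)
      then have "of_int (a (j, k)) * \<eta> ^ j * (\<eta> ^ J * x i ^ k)
        = (\<Sum>\<gamma>\<in>basis m. of_int (a (j, k)) * (\<eta> ^ j * (\<Sum>d\<le>J. of_int (c k \<gamma> d) * \<eta> ^ d)) * mon m \<gamma> x)"
        by (simp only: sum_distrib_left[where A = "basis m"] mult.assoc)
      also have "\<dots> = (\<Sum>\<gamma>\<in>basis m. \<Sum>f\<le>2*J. of_int (a (j, k) * A (\<gamma>, f) (j, k)) * (\<eta> ^ f * mon m \<gamma> x))"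
        using shift[of j k] \<open>j \<in> {..J}\<close>
        by (simp add: sum_distrib_left sum_distrib_right mult.assoc)
      finally show "of_int (a (j, k)) * \<eta> ^ j * (\<eta> ^ J * x i ^ k)
        = (\<Sum>\<gamma>\<in>basis m. \<Sum>f\<le>2*J. of_int (a (j, k) * A (\<gamma>, f) (j, k)) * (\<eta> ^ f * mon m \<gamma> x))" .
    qed
    also have "\<dots> = (\<Sum>u\<in>U. \<Sum>e\<in>E. of_int (a u * A e u) * (\<eta> ^ snd e * mon m (fst e) x))"
      by (simp only: U_def E_def sum.cartesian_product' fst_conv snd_conv)
    also have "\<dots> = (\<Sum>e\<in>E. \<Sum>u\<in>U. of_int (a u * A e u) * (\<eta> ^ snd e * mon m (fst e) x))"
      by (rule sum.swap)
    also have "\<dots> = (\<Sum>e\<in>E. of_int (\<Sum>u\<in>U. a u * A e u) * (\<eta> ^ snd e * mon m (fst e) x))"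
      by (simp add: sum_distrib_right)
    also have "\<dots> = 0" using a(3) by (simp del: of_int_sum)
    finally show "(\<Sum>j\<le>J. \<Sum>k\<le>J. of_int (a (j, k)) * \<eta> ^ j * x i ^ k) = 0"
      using nz[OF S] by simp
  qed
qed

text \<open>Cauchy's root bound. Integrality makes the leading coefficient at least 1 in absolute
  value, so beyond 1 + H its term dominates the geometric sum of the others.\<close>

lemma integer_root_bound:
  fixes c :: "nat \<Rightarrow> int" and t H :: real
  assumes "\<exists>k\<le>J. c k \<noteq> 0" "\<And>k. k \<le> J \<Longrightarrow> \<bar>of_int (c k)\<bar> \<le> H" "(\<Sum>k\<le>J. of_int (c k) * t ^ k) = 0"
  shows "\<bar>t\<bar> \<le> 1 + H"
proof (rule ccontr)
  assume "\<not> ?thesis"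
  then have t: "\<bar>t\<bar> > 1 + H" by simp
  have "H \<ge> 0" using assms(2)[of 0] by simp
  define K where "K = (GREATEST k. k \<le> J \<and> c k \<noteq> 0)"
  have K: "K \<le> J" "c K \<noteq> 0"
    using GreatestI_ex_nat[of "\<lambda>k. k \<le> J \<and> c k \<noteq> 0" J] assms(1) unfolding K_def by auto
  have gt: "c k = 0" if "k > K" "k \<le> J" for k
    using Greatest_le_nat[of "\<lambda>k. k \<le> J \<and> c k \<noteq> 0" k J] that unfolding K_def by fastforce
  have "(\<Sum>k\<le>J. of_int (c k) * t ^ k) = (\<Sum>k\<le>K. of_int (c k) * t ^ k)"
    by (rule sum.mono_neutral_right) (use K gt in auto)
  also have "\<dots> = (\<Sum>k<K. of_int (c k) * t ^ k) + of_int (c K) * t ^ K"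
    by (simp add: lessThan_Suc_atMost[symmetric])
  finally have "\<bar>of_int (c K) * t ^ K\<bar> = \<bar>\<Sum>k<K. of_int (c k) * t ^ k\<bar>" using assms(3) by simp
  also have "\<dots> \<le> (\<Sum>k<K. \<bar>of_int (c k) * t ^ k\<bar>)" by (rule sum_abs)
  also have "\<dots> \<le> (\<Sum>k<K. H * \<bar>t\<bar> ^ k)"
    by (rule sum_mono) (use assms(2) K in \<open>simp add: abs_mult power_abs mult_right_mono\<close>)
  also have "\<dots> \<le> (\<bar>t\<bar> - 1) * (\<Sum>k<K. \<bar>t\<bar> ^ k)"
    unfolding sum_distrib_left[symmetric] by (rule mult_right_mono) (use t in \<open>auto intro: sum_nonneg\<close>)
  also have "\<dots> = \<bar>t\<bar> ^ K - 1" by (rule power_diff_1_eq[symmetric])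
  finally have "\<bar>of_int (c K)\<bar> * \<bar>t\<bar> ^ K \<le> \<bar>t\<bar> ^ K - 1" by (simp add: abs_mult power_abs)
  moreover have "1 * \<bar>t\<bar> ^ K \<le> \<bar>of_int (c K)\<bar> * \<bar>t\<bar> ^ K"
    by (rule mult_right_mono) (use K in auto)
  ultimately show False by linarith
qed

text \<open>Let s be the first index with a nonzero row. Dividing by \<eta>^s leaves row s as the
  only part that survives \<eta> -> 0; without the division the limit could be the trivial
  equation.\<close>

lemma limit_root_bound:
  fixes a :: "nat \<Rightarrow> nat \<Rightarrow> int" and H t :: real
  assumes "\<exists>j\<le>J. \<exists>k\<le>J. a j k \<noteq> 0" "\<And>j k. j \<le> J \<Longrightarrow> k \<le> J \<Longrightarrow> \<bar>of_int (a j k)\<bar> \<le> H"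
    and rel: "\<And>n. (\<Sum>j\<le>J. \<Sum>k\<le>J. of_int (a j k) * \<eta> n ^ j * y n ^ k) = 0"
    and \<eta>: "\<And>n. \<eta> n \<noteq> 0" "\<eta> \<longlonglongrightarrow> 0" and y: "y \<longlonglongrightarrow> t"
  shows "\<bar>t\<bar> \<le> 1 + H"
proof -
  define s where "s = (LEAST j. j \<le> J \<and> (\<exists>k\<le>J. a j k \<noteq> 0))"
  have s: "s \<le> J" "\<exists>k\<le>J. a s k \<noteq> 0"
    using LeastI_ex[of "\<lambda>j. j \<le> J \<and> (\<exists>k\<le>J. a j k \<noteq> 0)"] assms(1) unfolding s_def by auto
  have lt: "a j k = 0" if "j < s" "k \<le> J" for j k
    using not_less_Least[of j "\<lambda>j. j \<le> J \<and> (\<exists>k\<le>J. a j k \<noteq> 0)"] that s(1) unfolding s_def[symmetric] by auto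
  have "(\<Sum>j\<in>{s..J}. \<eta> n ^ (j - s) * (\<Sum>k\<le>J. of_int (a j k) * y n ^ k)) = 0" for n
  proof -
    have "\<eta> n ^ s * (\<Sum>j\<in>{s..J}. \<eta> n ^ (j - s) * (\<Sum>k\<le>J. of_int (a j k) * y n ^ k))
      = (\<Sum>j\<in>{s..J}. \<Sum>k\<le>J. of_int (a j k) * \<eta> n ^ j * y n ^ k)"
      unfolding sum_distrib_left
    proof (intro sum.cong refl)
      fix j k assume "j \<in> {s..J}"
      then have "\<eta> n ^ j = \<eta> n ^ s * \<eta> n ^ (j - s)" by (simp add: power_add[symmetric])
      then show "\<eta> n ^ s * (\<eta> n ^ (j - s) * (of_int (a j k) * y n ^ k)) = of_int (a j k) * \<eta> n ^ j * y n ^ k"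
        by simp
    qed
    also have "\<dots> = (\<Sum>j\<le>J. \<Sum>k\<le>J. of_int (a j k) * \<eta> n ^ j * y n ^ k)"
      by (rule sum.mono_neutral_left) (auto simp: lt)
    finally show ?thesis using rel \<eta>(1) by simp
  qed
  then have "(\<lambda>n. \<Sum>j\<in>{s..J}. \<eta> n ^ (j - s) * (\<Sum>k\<le>J. of_int (a j k) * y n ^ k)) \<longlonglongrightarrow> 0" by simp
  moreover have "(\<lambda>n. \<Sum>j\<in>{s..J}. \<eta> n ^ (j - s) * (\<Sum>k\<le>J. of_int (a j k) * y n ^ k))
    \<longlonglongrightarrow> (\<Sum>j\<in>{s..J}. 0 ^ (j - s) * (\<Sum>k\<le>J. of_int (a j k) * t ^ k))"
    by (intro tendsto_intros \<eta> y)
  ultimately have "(\<Sum>j\<in>{s..J}. 0 ^ (j - s) * (\<Sum>k\<le>J. of_int (a j k) * t ^ k)) = 0"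
    using LIMSEQ_unique by blast
  moreover have "(\<Sum>j\<in>{s..J}. 0 ^ (j - s) * (\<Sum>k\<le>J. of_int (a j k) * t ^ k))
    = (\<Sum>j\<in>{s..J}. if j = s then (\<Sum>k\<le>J. of_int (a s k) * t ^ k) else 0)"
    by (rule sum.cong) (auto simp: power_0_left)
  ultimately have "(\<Sum>k\<le>J. of_int (a s k) * t ^ k) = 0" using s(1) by simp
  then show ?thesis using integer_root_bound[of J "a s" H t] s assms(2) by blast
qed

section \<open>Small solutions of systems of polynomial inequalities\<close>

text \<open>Points are functions on all of nat. Pinning the coordinates from m on to 0 makes the box
  a product of compact sets, to which Tychonoff's theorem applies.\<close>

lemma compact_coordinate_box:
  fixes R :: real
  shows "compact {x :: nat \<Rightarrow> real. (\<forall>j<m. \<bar>x j\<bar> \<le> R) \<and> (\<forall>j\<ge>m. x j = 0)}"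
proof -
  define B where "B j = (if j < m then {-R..R} else {0})" for j :: nat
  have "compactin (product_topology (\<lambda>_. euclidean) UNIV) (PiE UNIV B)"
    unfolding compactin_PiE by (auto simp: B_def)
  then have "compact (PiE UNIV B)" by (simp add: euclidean_product_topology)
  moreover have "PiE UNIV B = {x. (\<forall>j<m. \<bar>x j\<bar> \<le> R) \<and> (\<forall>j\<ge>m. x j = 0)}"
    by (auto simp: B_def PiE_UNIV_domain Pi_iff abs_le_iff split: if_splits) (metis neg_le_iff_le minus_minus linorder_not_le)+
  ultimately show ?thesis by simp
qed

text \<open>Six is the least even exponent whose derivative, of degree 5, exceeds the degree 3 of
  the derivative of a squared quadratic. Evenness makes the sublevel sets bounded.\<close>

definition hexic :: "nat \<Rightarrow> (nat \<Rightarrow> real) \<Rightarrow> real" where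
  "hexic m x = (\<Sum>j<m. x j ^ 6)"

lemma continuous_on_hexic: "continuous_on S (hexic m)"
  unfolding hexic_def[abs_def]
  by (intro continuous_intros continuous_on_product_then_coordinatewise continuous_on_id)

lemma compact_hexic_sublevel:
  assumes "\<And>k. k \<in> I \<Longrightarrow> continuous_on UNIV (F k :: (nat \<Rightarrow> real) \<Rightarrow> real)"
  shows "compact {x. (\<forall>j\<ge>m. x j = 0) \<and> hexic m x \<le> r \<and> (\<forall>k\<in>I. F k x \<ge> b)}"
proof -
  let ?B = "{x :: nat \<Rightarrow> real. (\<forall>j<m. \<bar>x j\<bar> \<le> 1 + \<bar>r\<bar>) \<and> (\<forall>j\<ge>m. x j = 0)}"
  have bound: "\<bar>x j\<bar> \<le> 1 + \<bar>r\<bar>" if "hexic m x \<le> r" "j < m" for x j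
  proof (rule ccontr)
    assume "\<not> ?thesis"
    then have 1: "\<bar>x j\<bar> > 1 + \<bar>r\<bar>" by simp
    \<comment> \<open>The summand 1 in the bound is there to ensure that \<open>x j\<close> exceeds
      1 in absolute value, so that its sixth power is no smaller.\<close>
    have "\<bar>x j\<bar> \<le> \<bar>x j\<bar> ^ 6" by (rule self_le_power) (use 1 in auto)
    also have "\<dots> = x j ^ 6" by (simp add: power_even_abs)
    also have "\<dots> \<le> hexic m x" unfolding hexic_def
      by (rule member_le_sum) (use that in auto)
    finally show False using 1 that(1) by linarith
  qed
  have "closed ({x. hexic m x \<le> r} \<inter> (\<Inter>k\<in>I. {x. F k x \<ge> b}))"
    by (intro closed_Int closed_INT ballI closed_Collect_le assms continuous_on_hexic continuous_on_const)
  then have "compact (?B \<inter> ({x. hexic m x \<le> r} \<inter> (\<Inter>k\<in>I. {x. F k x \<ge> b})))"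
    by (rule compact_Int_closed[OF compact_coordinate_box])
  moreover have "?B \<inter> ({x. hexic m x \<le> r} \<inter> (\<Inter>k\<in>I. {x. F k x \<ge> b}))
    = {x. (\<forall>j\<ge>m. x j = 0) \<and> hexic m x \<le> r \<and> (\<forall>k\<in>I. F k x \<ge> b)}"
    using bound by auto
  ultimately show ?thesis by simp
qed

lemma continuous_on_fun_upd_coordinate:
  "continuous_on UNIV (\<lambda>t :: real. (x :: nat \<Rightarrow> real)(j := t))"
proof (rule continuous_on_coordinatewise_then_product)
  show "continuous_on UNIV (\<lambda>t. (x(j := t)) i)" for i by (cases "i = j") auto
qed

text \<open>Among the points of the feasible set that minimise \<^const>\<open>hexic\<close> take one with a maximal set
  \<open>A\<close> of active constraints. Near the minimisers that are active on \<open>A\<close>, a common zero of the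
  \<open>F k\<close> with \<open>k \<in> A\<close> is feasible, so the minimisers of \<open>\<epsilon> hexic + (\<Sum>k\<in>A. (F k)\<^sup>2)\<close>
  on a neighbourhood converge to feasible points and are eventually interior, hence critical.\<close>

lemma critical_sequence:
  fixes F :: "'k \<Rightarrow> (nat \<Rightarrow> real) \<Rightarrow> real"
  assumes "finite I"
    and cont: "\<And>k. k \<in> I \<Longrightarrow> continuous_on UNIV (F k)"
    and x0: "\<And>j. j \<ge> m \<Longrightarrow> x0 j = 0" "\<And>k. k \<in> I \<Longrightarrow> F k x0 \<ge> 0"
    and der: "\<And>k j x. k \<in> I \<Longrightarrow> j < m \<Longrightarrow> ((\<lambda>t. F k (x(j := t))) has_real_derivative F' k j x) (at (x j))"
  shows "\<exists>A x \<epsilon> X. A \<subseteq> I \<and> (\<forall>k\<in>I. F k x \<ge> 0) \<and>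
    (\<forall>n :: nat. \<epsilon> n > (0 :: real)) \<and> \<epsilon> \<longlonglongrightarrow> 0 \<and> (\<forall>j. (\<lambda>n. X n j) \<longlonglongrightarrow> x j) \<and>
    (\<forall>n. \<forall>j<m. 6 * \<epsilon> n * X n j ^ 5 = - (\<Sum>k\<in>A. 2 * (F k (X n) * F' k j (X n))))"
proof -
  define E where "E = {x :: nat \<Rightarrow> real. \<forall>j\<ge>m. x j = 0}"
  define S where "S = {x \<in> E. \<forall>k\<in>I. F k x \<ge> 0}"
  have x0S: "x0 \<in> S" using x0 by (auto simp: S_def E_def)
  have "compact {x. (\<forall>j\<ge>m. x j = 0) \<and> hexic m x \<le> hexic m x0 \<and> (\<forall>k\<in>I. F k x \<ge> 0)}"
    by (rule compact_hexic_sublevel[OF cont])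
  moreover have "x0 \<in> {x. (\<forall>j\<ge>m. x j = 0) \<and> hexic m x \<le> hexic m x0 \<and> (\<forall>k\<in>I. F k x \<ge> 0)}"
    using x0 by simp
  ultimately obtain x1 where x1: "x1 \<in> S" and "\<forall>y \<in> S. hexic m y \<le> hexic m x0 \<longrightarrow> hexic m x1 \<le> hexic m y"
      "hexic m x1 \<le> hexic m x0"
    using continuous_attains_inf[OF _ _ continuous_on_hexic, of _ m] unfolding S_def E_def
    by (smt (verit) empty_iff mem_Collect_eq)
  \<comment> \<open>Points of S outside the sublevel set of x0 exceed the value at x0, so the
    minimum is global on S.\<close>
  then have min: "hexic m x1 \<le> hexic m y" if "y \<in> S" for y using that by force
  define h where "h = hexic m x1"
  define H where "H = {x \<in> S. hexic m x = h}"
  define act where "act x = {k \<in> I. F k x = 0}" for x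
  have "finite (card ` act ` H)"
    by (rule finite_surj[of "Pow I" _ card]) (use \<open>finite I\<close> in \<open>auto simp: act_def\<close>)
  moreover have "card ` act ` H \<noteq> {}" using x1 by (auto simp: H_def h_def)
  ultimately obtain x2 where x2: "x2 \<in> H" "\<And>y. y \<in> H \<Longrightarrow> card (act y) \<le> card (act x2)"
    using Max_in[of "card ` act ` H"] Max_ge[of "card ` act ` H"] by (smt (verit) image_iff)
  define A where "A = act x2"
  have "A \<subseteq> I" by (auto simp: A_def act_def)
  define HA where "HA = {x \<in> H. A \<subseteq> act x}"
  \<comment> \<open>x2 has the most active constraints among all minimisers, so a point of HA cannot
    have further ones.\<close>
  have actA: "act x = A" if "x \<in> HA" for x
    using that x2(2)[of x] \<open>finite I\<close> card_seteq[of "act x" A] unfolding HA_def A_def act_def by auto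
  have compHA: "compact HA"
  proof -
    have "closed (\<Inter>k\<in>A. {x. F k x = 0})"
      by (intro closed_INT ballI closed_Collect_eq cont continuous_on_const) (use \<open>A \<subseteq> I\<close> in auto)
    then have "compact ({x. (\<forall>j\<ge>m. x j = 0) \<and> hexic m x \<le> h \<and> (\<forall>k\<in>I. F k x \<ge> 0)} \<inter> (\<Inter>k\<in>A. {x. F k x = 0}))"
      by (intro compact_Int_closed compact_hexic_sublevel cont)
    moreover have "{x. (\<forall>j\<ge>m. x j = 0) \<and> hexic m x \<le> h \<and> (\<forall>k\<in>I. F k x \<ge> 0)} \<inter> (\<Inter>k\<in>A. {x. F k x = 0}) = HA"
      using min \<open>A \<subseteq> I\<close> unfolding HA_def H_def S_def E_def act_def h_def by (auto intro: antisym)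
    ultimately show ?thesis by simp
  qed
  have x2HA: "x2 \<in> HA" using x2(1) by (simp add: HA_def A_def)
  \<comment> \<open>By \<open>actA\<close> the constraints outside A are strictly positive on HA;
    compactness makes this uniform.\<close>
  have "\<exists>c>0. \<forall>x\<in>HA. F k x \<ge> 2 * c" if k: "k \<in> I - A" for k
  proof -
    obtain y where y: "y \<in> HA" "\<forall>x\<in>HA. F k y \<le> F k x"
      using continuous_attains_inf[OF compHA, of "F k"] x2HA cont[of k] k continuous_on_subset by blast
    have "F k y > 0" using y(1) actA[OF y(1)] k unfolding HA_def H_def S_def act_def by force
    then show ?thesis using y(2) by (intro exI[of _ "F k y / 2"]) auto
  qed
  then obtain c where c: "\<And>k. k \<in> I - A \<Longrightarrow> c k > 0" "\<And>k x. k \<in> I - A \<Longrightarrow> x \<in> HA \<Longrightarrow> F k x \<ge> 2 * c k"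
    by metis
  \<comment> \<open>The inserted 1 covers the case I = A.\<close>
  define \<delta> where "\<delta> = Min (insert 1 (c ` (I - A)))"
  have \<delta>: "\<delta> > 0" "\<And>k. k \<in> I - A \<Longrightarrow> \<delta> \<le> c k"
    using \<open>finite I\<close> c(1) by (auto simp: \<delta>_def)
  \<comment> \<open>The constraints in A are dropped, as Q penalises them instead. The slack of h +
    1 over h, and of 2 * c k over \<delta>, keeps HA away from the remaining boundary of W.\<close>
  define W where "W = {x. (\<forall>j\<ge>m. x j = 0) \<and> hexic m x \<le> h + 1 \<and> (\<forall>k\<in>I - A. F k x \<ge> \<delta>)}"
  have compW: "compact W" unfolding W_def by (rule compact_hexic_sublevel) (use cont in auto)
  have HAW: "HA \<subseteq> W"
  proof
    fix y assume y: "y \<in> HA"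
    have "F k y \<ge> \<delta>" if "k \<in> I - A" for k
      using c(2)[OF that y] c(1)[OF that] \<delta>(2)[OF that] by linarith
    then show "y \<in> W" using y by (simp add: W_def HA_def H_def S_def E_def)
  qed
  define Q where "Q x = (\<Sum>k\<in>A. (F k x)\<^sup>2)" for x
  have contQ: "continuous_on T Q" for T
    unfolding Q_def[abs_def] by (intro continuous_intros continuous_on_subset[OF cont]) (use \<open>A \<subseteq> I\<close> in auto)
  have Q0: "Q x \<ge> 0" for x by (simp add: Q_def sum_nonneg)
  have QHA: "Q x = 0" if "x \<in> HA" for x using that unfolding Q_def HA_def act_def
    by (auto intro!: sum.neutral)
  define e where "e n = 1 / real (Suc n)" for n
  have e: "e n > 0" for n by (simp add: e_def)
  have elim: "e \<longlonglongrightarrow> 0" unfolding e_def[abs_def] by (rule LIMSEQ_Suc[OF lim_1_over_n])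
  have "\<exists>y\<in>W. \<forall>z\<in>W. e n * hexic m y + Q y \<le> e n * hexic m z + Q z" for n
    by (rule continuous_attains_inf[OF compW])
      (use x2HA HAW in \<open>auto intro!: continuous_intros continuous_on_hexic contQ\<close>)
  then obtain Y where Y: "\<And>n. Y n \<in> W" "\<And>n z. z \<in> W \<Longrightarrow> e n * hexic m (Y n) + Q (Y n) \<le> e n * hexic m z + Q z"
    by metis
  \<comment> \<open>The competitor x2 lies in HA, where Q vanishes and hexic equals h; comparing
    with it gives both this bound and \<open>YQ\<close>.\<close>
  have Yh: "hexic m (Y n) \<le> h" for n
  proof -
    have "e n * hexic m (Y n) \<le> e n * h"
      using Y(2)[of x2 n] HAW x2HA QHA[OF x2HA] Q0[of "Y n"] by (auto simp: HA_def H_def)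
    then show ?thesis using e[of n] by simp
  qed
  have hex0: "hexic m x \<ge> 0" for x by (simp add: hexic_def sum_nonneg)
  have YQ: "Q (Y n) \<le> e n * h" for n
  proof -
    have "e n * hexic m (Y n) + Q (Y n) \<le> e n * h"
      using Y(2)[of x2 n] HAW x2HA QHA[OF x2HA] by (auto simp: HA_def H_def)
    moreover have "0 \<le> e n * hexic m (Y n)" using e[of n] hex0 by simp
    ultimately show ?thesis by linarith
  qed
  obtain x r where x: "x \<in> W" "strict_mono r" "(Y \<circ> r) \<longlonglongrightarrow> x"
    using compW Y(1) unfolding compact_eq_seq_compact_metric seq_compact_def by blast
  have lim: "(\<lambda>n. f (Y (r n))) \<longlonglongrightarrow> f x" if "continuous_on UNIV f" for f :: "(nat \<Rightarrow> real) \<Rightarrow> real"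
    using continuous_on_tendsto_compose[OF that x(3)] by (simp add: o_def)
  have er: "(\<lambda>n. e (r n)) \<longlonglongrightarrow> 0" using LIMSEQ_subseq_LIMSEQ[OF elim x(2)] by (simp add: o_def)
  have "Q x \<le> 0"
  proof (rule LIMSEQ_le[OF lim[OF contQ]])
    show "(\<lambda>n. e (r n) * h) \<longlonglongrightarrow> 0" using tendsto_mult_left_zero[OF er] .
    show "\<exists>N. \<forall>n\<ge>N. Q (Y (r n)) \<le> e (r n) * h" using YQ by blast
  qed
  then have FA: "F k x = 0" if "k \<in> A" for k
    using that Q0[of x] \<open>A \<subseteq> I\<close> \<open>finite I\<close> finite_subset
      sum_nonneg_eq_0_iff[of A "\<lambda>k. (F k x)\<^sup>2"] unfolding Q_def by auto
  have "hexic m x \<le> h"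
    by (rule LIMSEQ_le_const2[OF lim[OF continuous_on_hexic]]) (use Yh in auto)
  have FI: "F k x \<ge> 0" if "k \<in> I" for k
  proof (cases "k \<in> A")
    case False
    then have "\<delta> \<le> F k x" using x(1) that unfolding W_def by blast
    then show ?thesis using \<delta>(1) by linarith
  qed (simp add: FA)
  \<comment> \<open>The limit is feasible, active on A and has hexic at most h, so it is a point of
    HA again; there the other constraints exceed \<delta>.\<close>
  have "x \<in> S" using x(1) FI by (auto simp: S_def E_def W_def)
  then have xHA: "x \<in> HA"
    using \<open>hexic m x \<le> h\<close> min[of x] FA \<open>A \<subseteq> I\<close> by (auto simp: HA_def H_def h_def act_def)
  have ev1: "\<forall>\<^sub>F n in sequentially. \<forall>k\<in>I - A. F k (Y (r n)) > \<delta>"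
  proof (rule eventually_ball_finite)
    show "finite (I - A)" using \<open>finite I\<close> by simp
    show "\<forall>k\<in>I - A. \<forall>\<^sub>F n in sequentially. F k (Y (r n)) > \<delta>"
    proof
      fix k assume k: "k \<in> I - A"
      have "F k x > \<delta>" using c(2)[OF k xHA] \<delta>(2)[OF k] \<delta>(1) by linarith
      then show "\<forall>\<^sub>F n in sequentially. F k (Y (r n)) > \<delta>"
        using order_tendstoD(1)[OF lim[OF cont[of k]]] k by auto
    qed
  qed
  then obtain N where N: "\<And>n k. n \<ge> N \<Longrightarrow> k \<in> I - A \<Longrightarrow> F k (Y (r n)) > \<delta>"
    unfolding eventually_sequentially by blast
  \<comment> \<open>Dropping N terms makes the constraints outside A strict for every n. Since also
    hexic \<le> h < h + 1, varying one coordinate slightly stays in W, so each X n is a local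
    minimum in each coordinate.\<close>
  define X where "X n = Y (r (n + N))" for n
  define \<epsilon> where "\<epsilon> n = e (r (n + N))" for n
  have crit: "6 * \<epsilon> n * X n j ^ 5 = - (\<Sum>k\<in>A. 2 * (F k (X n) * F' k j (X n)))" if j: "j < m" for n j
  proof -
    let ?g = "\<lambda>t. (X n)(j := t)"
    let ?f = "\<lambda>t. \<epsilon> n * hexic m (?g t) + Q (?g t)"
    have g: "?g (X n j) = X n" by simp
    have "hexic m (?g t) = t ^ 6 + (\<Sum>i\<in>{..<m} - {j}. X n i ^ 6)" for t
      unfolding hexic_def using j by (subst sum.remove[of _ j]) auto
    then have d1: "((\<lambda>t. hexic m (?g t)) has_real_derivative 6 * X n j ^ 5) (at (X n j))"
      by (auto intro!: derivative_eq_intros)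
    have d2: "((\<lambda>t. Q (?g t)) has_real_derivative (\<Sum>k\<in>A. 2 * (F k (X n) * F' k j (X n)))) (at (X n j))"
      unfolding Q_def
    proof (rule DERIV_sum)
      fix k assume "k \<in> A"
      then have "((\<lambda>t. F k (?g t)) has_real_derivative F' k j (X n)) (at (X n j))" using der j \<open>A \<subseteq> I\<close> by auto
      from DERIV_power[OF this, of 2]
      show "((\<lambda>t. (F k (?g t))\<^sup>2) has_real_derivative 2 * (F k (X n) * F' k j (X n))) (at (X n j))"
        by (simp add: mult_ac)
    qed
    have d: "(?f has_real_derivative (\<epsilon> n * (6 * X n j ^ 5) + (\<Sum>k\<in>A. 2 * (F k (X n) * F' k j (X n))))) (at (X n j))"
      by (rule DERIV_add[OF DERIV_cmult[OF d1] d2])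
    have evW: "\<forall>\<^sub>F t in at (X n j). ?g t \<in> W"
    proof -
      have tend: "((\<lambda>t. f (?g t)) \<longlongrightarrow> f (X n)) (at (X n j))" if "continuous_on UNIV f" for f :: "(nat \<Rightarrow> real) \<Rightarrow> real"
      proof -
        have "continuous_on UNIV (\<lambda>t. f (?g t))"
          by (rule continuous_on_compose2[OF that continuous_on_fun_upd_coordinate]) auto
        then have "isCont (\<lambda>t. f (?g t)) (X n j)" by (simp add: continuous_on_eq_continuous_at)
        then show ?thesis unfolding isCont_def by simp
      qed
      have "hexic m (X n) < h + 1" using Yh[of "r (n + N)"] by (simp add: X_def)
      then have "\<forall>\<^sub>F t in at (X n j). hexic m (?g t) < h + 1"
        by (rule order_tendstoD(2)[OF tend[OF continuous_on_hexic]])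
      moreover have "\<forall>\<^sub>F t in at (X n j). \<forall>k\<in>I - A. F k (?g t) > \<delta>"
      proof (rule eventually_ball_finite)
        show "finite (I - A)" using \<open>finite I\<close> by simp
        show "\<forall>k\<in>I - A. \<forall>\<^sub>F t in at (X n j). F k (?g t) > \<delta>"
        proof
          fix k assume k: "k \<in> I - A"
          then have "F k (X n) > \<delta>" using N[of "n + N" k] by (simp add: X_def)
          then show "\<forall>\<^sub>F t in at (X n j). F k (?g t) > \<delta>"
            using order_tendstoD(1)[OF tend[OF cont[of k]]] k by auto
        qed
      qed
      ultimately show ?thesis
      proof eventually_elim
        case (elim t)
        have "\<forall>i\<ge>m. X n i = 0" using Y(1)[of "r (n + N)"] by (simp add: X_def W_def)
        then show ?case using elim j by (auto simp: W_def less_imp_le)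
      qed
    qed
    then have "\<forall>\<^sub>F t in at (X n j). ?f (X n j) \<le> ?f t"
      by (rule eventually_mono) (unfold g, unfold X_def \<epsilon>_def, rule Y(2))
    then obtain d where "d > 0" "\<And>t. \<lbrakk>t \<noteq> X n j; dist t (X n j) < d\<rbrakk> \<Longrightarrow> ?f (X n j) \<le> ?f t"
      unfolding eventually_at by auto
    then have "\<forall>t. \<bar>X n j - t\<bar> < d \<longrightarrow> ?f (X n j) \<le> ?f t"
      by (metis dist_commute dist_real_def order_refl)
    from DERIV_local_min[OF d \<open>d > 0\<close> this] show ?thesis by simp
  qed
  show ?thesis
  proof (intro exI conjI allI ballI impI)
    show "A \<subseteq> I" by fact
    show "F k x \<ge> 0" if "k \<in> I" for k by (rule FI[OF that])
    show "\<epsilon> n > 0" for n by (simp add: \<epsilon>_def e)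
    show "\<epsilon> \<longlonglongrightarrow> 0" unfolding \<epsilon>_def[abs_def] by (rule LIMSEQ_ignore_initial_segment[OF er])
    show "(\<lambda>n. X n j) \<longlonglongrightarrow> x j" for j
      unfolding X_def by (rule LIMSEQ_ignore_initial_segment[OF lim[OF continuous_on_product_coordinates]])
  qed (rule crit)
qed

text \<open>The coordinates of one limit point are bounded separately: each i has its own integer
  relation, along the same sequence of critical points. The bound is 1 + H with H the coefficient
  bound of \<open>integer_relation\<close>.\<close>

lemma bounded_solution:
  fixes F :: "'k \<Rightarrow> (nat \<Rightarrow> real) \<Rightarrow> real" and K K' L m :: nat
  defines "J \<equiv> 4 * 5 ^ m"
  assumes "finite I"
    and F: "\<And>k. k \<in> I \<Longrightarrow> ipoly m 2 K (F k)"
    and F': "\<And>k j. k \<in> I \<Longrightarrow> j < m \<Longrightarrow> ipoly m 1 K' (F' k j)"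
    and der: "\<And>k j x. k \<in> I \<Longrightarrow> j < m \<Longrightarrow> ((\<lambda>t. F k (x(j := t))) has_real_derivative F' k j x) (at (x j))"
    and L: "card I * (2 * K * K') \<le> L" "1 \<le> L"
    and x0: "\<And>j. j \<ge> m \<Longrightarrow> x0 j = 0" "\<And>k. k \<in> I \<Longrightarrow> F k x0 \<ge> 0"
  shows "\<exists>x. (\<forall>k\<in>I. F k x \<ge> 0) \<and> (\<forall>i<m. \<bar>x i\<bar> \<le> real (1 + 2 * ((J + 1) * L ^ J)))"
proof -
  have "\<exists>A x \<epsilon> X. A \<subseteq> I \<and> (\<forall>k\<in>I. F k x \<ge> 0) \<and>
    (\<forall>n :: nat. \<epsilon> n > (0 :: real)) \<and> \<epsilon> \<longlonglongrightarrow> 0 \<and> (\<forall>j. (\<lambda>n. X n j) \<longlonglongrightarrow> x j) \<and>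
    (\<forall>n. \<forall>j<m. 6 * \<epsilon> n * X n j ^ 5 = - (\<Sum>k\<in>A. 2 * (F k (X n) * F' k j (X n))))"
    by (rule critical_sequence[OF \<open>finite I\<close> continuous_on_ipoly[OF F] x0 der])
  then obtain A x \<epsilon> X where A: "A \<subseteq> I" and x: "\<And>k. k \<in> I \<Longrightarrow> F k x \<ge> 0"
    and \<epsilon>: "\<And>n :: nat. \<epsilon> n > (0 :: real)" "\<epsilon> \<longlonglongrightarrow> 0" and X: "\<And>j. (\<lambda>n. X n j) \<longlonglongrightarrow> x j"
    and crit: "\<And>n j. j < m \<Longrightarrow> 6 * \<epsilon> n * X n j ^ 5 = - (\<Sum>k\<in>A. 2 * (F k (X n) * F' k j (X n)))"
    by blast
  \<comment> \<open>The factor 2 is written as a repeated summand because \<open>ipoly\<close> is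
    generated by sums; it reappears in \<open>2 * K * K'\<close>.\<close>
  define G where "G j x = - (\<Sum>k\<in>A. F k x * F' k j x + F k x * F' k j x)" for j x
  have G: "ipoly m 3 L (G j)" if "j < m" for j
    unfolding G_def
  proof (intro ipoly_neg ipoly_sum)
    show "finite A" using A \<open>finite I\<close> finite_subset by blast
    show "ipoly m 3 (2 * K * K') (\<lambda>x. F k x * F' k j x + F k x * F' k j x)" if "k \<in> A" for k
    proof (rule ipoly_add)
      show *: "ipoly m 3 (K * K') (\<lambda>x. F k x * F' k j x)"
        by (rule ipoly_mult[OF F F']) (use that A \<open>j < m\<close> in auto)
      show "ipoly m 3 (K * K') (\<lambda>x. F k x * F' k j x)" by (rule *)
    qed simp
    have "card A \<le> card I" by (rule card_mono[OF \<open>finite I\<close> A])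
    then show "card A * (2 * K * K') \<le> L" using L(1) by (meson le_trans mult_le_mono1)
  qed
  \<comment> \<open>The 6 from differentiating \<open>hexic\<close> is absorbed into \<eta>, so that
    the left side is exactly \<open>\<eta> * x j ^ 5\<close>.\<close>
  define Sol where "Sol = range (\<lambda>n. (6 * \<epsilon> n, X n))"
  have "\<bar>x i\<bar> \<le> 1 + real (2 * ((J + 1) * L ^ J))" if "i < m" for i
  proof -
    have Sol: "\<eta> * x j ^ 5 = G j x" if "(\<eta>, x) \<in> Sol" "j < m" for \<eta> x j
    proof -
      obtain n where n: "\<eta> = 6 * \<epsilon> n" "x = X n" using \<open>(\<eta>, x) \<in> Sol\<close> unfolding Sol_def by blast
      show ?thesis unfolding n using crit[OF \<open>j < m\<close>, of n] by (simp only: G_def mult_2)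
    qed
    have nz: "\<eta> \<noteq> 0" if "(\<eta>, x) \<in> Sol" for \<eta> x
    proof -
      obtain n where n: "\<eta> = 6 * \<epsilon> n" using \<open>(\<eta>, x) \<in> Sol\<close> unfolding Sol_def by blast
      show ?thesis using \<epsilon>(1)[of n] n by simp
    qed
    from integer_relation[OF G L(2) Sol nz \<open>i < m\<close>, folded J_def]
    obtain a :: "nat \<Rightarrow> nat \<Rightarrow> int" where a: "(\<exists>j\<le>J. \<exists>k\<le>J. a j k \<noteq> 0) \<and>
      (\<forall>j\<le>J. \<forall>k\<le>J. \<bar>a j k\<bar> \<le> 2 * int ((J + 1) * L ^ J)) \<and>
      (\<forall>(\<eta>, x) \<in> Sol. (\<Sum>j\<le>J. \<Sum>k\<le>J. of_int (a j k) * \<eta> ^ j * x i ^ k) = 0)"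
      by (rule exE)
    have a2: "\<bar>a j k\<bar> \<le> 2 * int ((J + 1) * L ^ J)" if "j \<le> J" "k \<le> J" for j k
      using a that by simp
    have a3: "(\<Sum>j\<le>J. \<Sum>k\<le>J. of_int (a j k) * \<eta> ^ j * x i ^ k) = 0" if "(\<eta>, x) \<in> Sol" for \<eta> x
      using bspec[OF conjunct2[OF conjunct2[OF a]] that] by (simp only: prod.case)
    show ?thesis
    proof (rule limit_root_bound[of J a _ "\<lambda>n. 6 * \<epsilon> n" "\<lambda>n. X n i", OF conjunct1[OF a]])
      show "\<bar>real_of_int (a j k)\<bar> \<le> real (2 * ((J + 1) * L ^ J))" if "j \<le> J" "k \<le> J" for j k
        using a2[OF that] by linarith
      show "(\<Sum>j\<le>J. \<Sum>k\<le>J. of_int (a j k) * (6 * \<epsilon> n) ^ j * X n i ^ k) = 0" for n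
        by (rule a3) (auto simp: Sol_def)
      show "6 * \<epsilon> n \<noteq> 0" for n using \<epsilon>(1)[of n] by simp
      show "(\<lambda>n. 6 * \<epsilon> n) \<longlonglongrightarrow> 0" by (rule tendsto_mult_right_zero[OF \<epsilon>(2)])
    qed (rule X)
  qed
  then have "\<forall>i<m. \<bar>x i\<bar> \<le> real (1 + 2 * ((J + 1) * L ^ J))" by (simp only: of_nat_add of_nat_1) simp
  then show ?thesis using x by blast
qed

section \<open>The upper bound\<close>

lemma balls_meet_iff:
  fixes a b :: "'a :: real_normed_vector"
  assumes "r > 0"
  shows "ball a r \<inter> ball b r \<noteq> {} \<longleftrightarrow> dist a b < 2 * r"
proof
  assume "ball a r \<inter> ball b r \<noteq> {}"
  then obtain z where "dist a z < r" "dist b z < r" by auto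
  then show "dist a b < 2 * r" using dist_triangle2[of a b z] by linarith
next
  assume "dist a b < 2 * r"
  then have "midpoint a b \<in> ball a r \<inter> ball b r" by (simp add: dist_midpoint)
  then show "ball a r \<inter> ball b r \<noteq> {}" by blast
qed

section \<open>Realizations as point configurations with a distance threshold\<close>

definition edge_set :: "'a set \<Rightarrow> 'a set set" where
  "edge_set V = {{u, v} | u v. u \<in> V \<and> v \<in> V \<and> u \<noteq> v}"

text \<open>Equal disks meet iff their centres are closer than the diameter, so s stands for a
  diameter. The first conjunct records what \<open>realizes\<close> says beyond adjacency of
  distinct vertices: \<open>snd G\<close> contains nothing but pairs of vertices.\<close>

definition threshold_rep :: "'a graph \<Rightarrow> ('a \<Rightarrow> plane) \<Rightarrow> real \<Rightarrow> bool" where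
  "threshold_rep G c s \<longleftrightarrow> snd G \<subseteq> edge_set (fst G) \<and>
     (\<forall>u\<in>fst G. \<forall>v\<in>fst G. u \<noteq> v \<longrightarrow> ({u, v} \<in> snd G \<longleftrightarrow> dist (c u) (c v) < s))"

lemma realizes_balls_iff:
  assumes "r > 0" "\<And>v. v \<in> fst G \<Longrightarrow> A v = ball (c v :: plane) r"
  shows "realizes A G \<longleftrightarrow> threshold_rep G c (2 * r)"
proof -
  have meet: "A u \<inter> A v \<noteq> {} \<longleftrightarrow> dist (c u) (c v) < 2 * r" if "u \<in> fst G" "v \<in> fst G" for u v
    using balls_meet_iff[OF assms(1)] assms(2) that by metis
  have "{{u, v} | u v. u \<in> fst G \<and> v \<in> fst G \<and> u \<noteq> v \<and> A u \<inter> A v \<noteq> {}}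
     = {{u, v} | u v. u \<in> fst G \<and> v \<in> fst G \<and> u \<noteq> v \<and> dist (c u) (c v) < 2 * r}" (is "_ = ?R")
    using meet by blast
  moreover have "snd G = ?R \<longleftrightarrow> threshold_rep G c (2 * r)"
  proof
    assume eq: "snd G = ?R"
    have "{u, v} \<in> snd G \<longleftrightarrow> dist (c u) (c v) < 2 * r" if "u \<in> fst G" "v \<in> fst G" "u \<noteq> v" for u v
      unfolding eq using that by (auto simp: doubleton_eq_iff dist_commute)
    moreover have "snd G \<subseteq> edge_set (fst G)" unfolding eq edge_set_def by blast
    ultimately show "threshold_rep G c (2 * r)" unfolding threshold_rep_def by blast
  next
    assume T: "threshold_rep G c (2 * r)"
    show "snd G = ?R"
    proof (intro equalityI subsetI)
      fix e assume e: "e \<in> snd G"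
      then obtain u v where uv: "e = {u, v}" "u \<in> fst G" "v \<in> fst G" "u \<noteq> v"
        using T unfolding threshold_rep_def edge_set_def by blast
      then have "dist (c u) (c v) < 2 * r" using T e unfolding threshold_rep_def by blast
      then show "e \<in> ?R" using uv by blast
    next
      fix e assume "e \<in> ?R"
      then show "e \<in> snd G" using T unfolding threshold_rep_def by blast
    qed
  qed
  ultimately show ?thesis by (simp only: realizes_iff)
qed

lemma integer_realization_threshold_rep:
  assumes "integer_realization A G"
  shows "\<exists>c r. r > 0 \<and> r \<in> \<int> \<and> (\<forall>v\<in>fst G. c v \<in> \<int> \<times> \<int> \<and> A v = ball (c v) r) \<and>
    threshold_rep G c (2 * r)"
proof -
  from assms obtain c r where *: "r > 0" "r \<in> \<int>" "\<forall>v\<in>fst G. c v \<in> \<int> \<times> \<int> \<and> A v = ball (c v) r"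
    "realizes A G"
    unfolding integer_realization_def by blast
  then have "threshold_rep G c (2 * r)" using realizes_balls_iff[of r G A c] by simp
  with * show ?thesis by blast
qed

lemma integer_realizationI:
  assumes "threshold_rep G c (2 * r)" "r > 0" "r \<in> \<int>" "\<And>v. v \<in> fst G \<Longrightarrow> c v \<in> \<int> \<times> \<int>"
  shows "integer_realization (\<lambda>v. ball (c v) r) G"
  using assms realizes_balls_iff[of r G "\<lambda>v. ball (c v) r" c] unfolding integer_realization_def by blast

lemma grid_size_le:
  "(\<And>A. A \<in> \<A> \<Longrightarrow> A \<subseteq> {- real k .. real k} \<times> {- real k .. real k}) \<Longrightarrow> grid_size \<A> \<le> k"
  unfolding grid_size_def by (rule Least_le) blast

lemma f_graph_le: "integer_realization A G \<Longrightarrow> f_graph G \<le> grid_size (A ` fst G)"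
  unfolding f_graph_def by (rule Least_le) blast

lemma f_graph_attained:
  "integer_realization A G \<Longrightarrow> \<exists>B. integer_realization B G \<and> f_graph G = grid_size (B ` fst G)"
  unfolding f_graph_def by (rule LeastI_ex) blast

lemma finite_UDG: "finite (UDG n)"
proof (rule finite_subset)
  show "UDG n \<subseteq> {{..<n}} \<times> Pow (Pow {..<n})"
  proof
    fix G assume "G \<in> UDG n"
    then have G: "fst G = {..<n}" "unit_disk_graph G" by (auto simp: UDG_def)
    then obtain A :: "nat \<Rightarrow> plane set" where "realizes A G" unfolding unit_disk_graph_def by blast
    then have "snd G \<subseteq> Pow {..<n}" using G(1) unfolding realizes_iff by auto
    then show "G \<in> {{..<n}} \<times> Pow (Pow {..<n})" using G(1) by (cases G) auto
  qed
qed simp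

lemma unit_disk_graph_threshold_rep:
  assumes "unit_disk_graph G"
  obtains c s where "s > 0" "threshold_rep G c s"
proof -
  obtain A c r where "r > 0" "\<forall>v\<in>fst G. A v = ball (c v :: plane) r" "realizes A G"
    using assms unfolding unit_disk_graph_def by blast
  then show thesis using realizes_balls_iff[of r G A c] that[of "2 * r" c] by simp
qed

text \<open>Only finitely many distances occur, so there is a gap between s and the largest distance
  e below s. The threshold moves to the middle of the gap, and scaling gives the gap length
  2.\<close>

lemma threshold_rep_margin:
  assumes "threshold_rep G c s" "s > 0" "finite (fst G)"
  obtains c' :: "'a \<Rightarrow> plane" and \<sigma> where "\<sigma> \<ge> 1" "snd G \<subseteq> edge_set (fst G)"
    "\<And>u v. u \<in> fst G \<Longrightarrow> v \<in> fst G \<Longrightarrow> u \<noteq> v \<Longrightarrow> {u, v} \<in> snd G \<Longrightarrow> dist (c' u) (c' v) \<le> \<sigma> - 1"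
    "\<And>u v. u \<in> fst G \<Longrightarrow> v \<in> fst G \<Longrightarrow> u \<noteq> v \<Longrightarrow> {u, v} \<notin> snd G \<Longrightarrow> dist (c' u) (c' v) \<ge> \<sigma> + 1"
proof -
  \<comment> \<open>Inserting 0 keeps \<open>Max D\<close> meaningful even for an empty vertex
    set.\<close>
  define D where "D = insert 0 {d \<in> (\<lambda>(u, v). dist (c u) (c v)) ` (fst G \<times> fst G). d < s}"
  define e where "e = Max D"
  have fin: "finite D" unfolding D_def using assms(3) by auto
  then have "e \<in> D" unfolding e_def by (intro Max_in) (auto simp: D_def)
  then have e: "0 \<le> e" "e < s" using assms(2) by (auto simp: D_def)
  have le: "dist (c u) (c v) \<le> e" if "u \<in> fst G" "v \<in> fst G" "dist (c u) (c v) < s" for u v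
    unfolding e_def by (rule Max_ge[OF fin]) (use that in \<open>auto simp: D_def\<close>)
  define \<delta> where "\<delta> = (s - e) / 2"
  have \<delta>: "\<delta> > 0" using e by (simp add: \<delta>_def)
  define \<sigma> where "\<sigma> = (s + e) / 2 / \<delta>"
  have \<sigma>: "\<sigma> - 1 = e / \<delta>" "\<sigma> + 1 = s / \<delta>"
    using \<delta> by (simp_all add: \<sigma>_def \<delta>_def field_simps)
  have d: "dist (inverse \<delta> *\<^sub>R c u) (inverse \<delta> *\<^sub>R c v) = dist (c u) (c v) / \<delta>" for u v
    using \<delta> by (simp add: dist_norm scaleR_diff_right[symmetric] divide_inverse mult.commute)
  show thesis
  proof (rule that[of \<sigma> "\<lambda>v. inverse \<delta> *\<^sub>R c v"])
    have "e / \<delta> \<ge> 0" using e(1) \<delta> by simp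
    then show "\<sigma> \<ge> 1" using \<sigma>(1) by simp
    show "snd G \<subseteq> edge_set (fst G)" using assms(1) by (simp add: threshold_rep_def)
    show "dist (inverse \<delta> *\<^sub>R c u) (inverse \<delta> *\<^sub>R c v) \<le> \<sigma> - 1"
      if "u \<in> fst G" "v \<in> fst G" "u \<noteq> v" "{u, v} \<in> snd G" for u v
      unfolding d \<sigma> using le[of u v] that assms(1) \<delta> by (simp add: threshold_rep_def divide_right_mono)
    show "dist (inverse \<delta> *\<^sub>R c u) (inverse \<delta> *\<^sub>R c v) \<ge> \<sigma> + 1"
      if "u \<in> fst G" "v \<in> fst G" "u \<noteq> v" "{u, v} \<notin> snd G" for u v
      unfolding d \<sigma> using that assms(1) \<delta> by (simp add: threshold_rep_def divide_right_mono)
  qed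
qed

lemma dist_round_point:
  fixes p :: plane
  shows "dist (of_int (round (fst p)), of_int (round (snd p))) p \<le> 3 / 4"
proof -
  have "\<bar>of_int (round x) - x\<bar> \<le> 1 / 2" for x :: real by (rule of_int_round_abs_le)
  then have "(of_int (round x) - x)\<^sup>2 \<le> (1 / 2)\<^sup>2" for x :: real by (metis abs_ge_zero power2_abs power_mono)
  then have "(of_int (round (fst p)) - fst p)\<^sup>2 + (of_int (round (snd p)) - snd p)\<^sup>2 \<le> (3 / 4)\<^sup>2"
    using add_mono[of "(of_int (round (fst p)) - fst p)\<^sup>2" "(1/2)\<^sup>2" "(of_int (round (snd p)) - snd p)\<^sup>2" "(1/2)\<^sup>2"]
    by (simp add: power2_eq_square)
  then have "sqrt ((of_int (round (fst p)) - fst p)\<^sup>2 + (of_int (round (snd p)) - snd p)\<^sup>2) \<le> 3 / 4"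
    by (intro real_le_lsqrt) auto
  then show ?thesis by (cases p) (simp add: dist_Pair_Pair dist_real_def)
qed

text \<open>Scaling by 4 turns the margin 1 into 4. Rounding two centres changes their distance by
  at most 3/2, and rounding the radius 2 \<sigma> changes the diameter by at most 1, in total less
  than 4. In the box size, a centre contributes 4B + 1/2 and the radius 2B + 1/2.\<close>

lemma integer_realization_of_margin:
  fixes B :: nat
  assumes "\<sigma> \<ge> 1" "snd G \<subseteq> edge_set (fst G)"
    and edge: "\<And>u v. u \<in> fst G \<Longrightarrow> v \<in> fst G \<Longrightarrow> u \<noteq> v \<Longrightarrow> {u, v} \<in> snd G \<Longrightarrow> dist (c u) (c v) \<le> \<sigma> - 1"
    and nonedge: "\<And>u v. u \<in> fst G \<Longrightarrow> v \<in> fst G \<Longrightarrow> u \<noteq> v \<Longrightarrow> {u, v} \<notin> snd G \<Longrightarrow> dist (c u) (c v) \<ge> \<sigma> + 1"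
    and B: "\<sigma> \<le> real B" "\<And>v. v \<in> fst G \<Longrightarrow> \<bar>fst (c v)\<bar> \<le> real B \<and> \<bar>snd (c v)\<bar> \<le> real B"
  shows "\<exists>A. integer_realization A G \<and> grid_size (A ` fst G) \<le> 6 * B + 1"
proof -
  define r :: real where "r = of_int (round (2 * \<sigma>))"
  define a :: "'a \<Rightarrow> plane" where
    "a v = (of_int (round (fst (4 *\<^sub>R c v))), of_int (round (snd (4 *\<^sub>R c v))))" for v
  have r: "\<bar>r - 2 * \<sigma>\<bar> \<le> 1 / 2" unfolding r_def by (rule of_int_round_abs_le)
  have close: "dist (a v) (4 *\<^sub>R c v) \<le> 3 / 4" for v unfolding a_def by (rule dist_round_point)
  have near: "\<bar>dist (a u) (a v) - 4 * dist (c u) (c v)\<bar> \<le> 3 / 2" for u v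
  proof -
    have "dist (4 *\<^sub>R c u) (4 *\<^sub>R c v) = 4 * dist (c u) (c v)"
      by (simp add: dist_norm scaleR_diff_right[symmetric])
    moreover have "dist (a u) (a v) \<le> dist (a u) (4 *\<^sub>R c u) + dist (4 *\<^sub>R c u) (4 *\<^sub>R c v) + dist (a v) (4 *\<^sub>R c v)"
      using dist_triangle[of "a u" "a v" "4 *\<^sub>R c u"] dist_triangle2[of "4 *\<^sub>R c u" "a v" "4 *\<^sub>R c v"] by linarith
    moreover have "dist (4 *\<^sub>R c u) (4 *\<^sub>R c v) \<le> dist (a u) (4 *\<^sub>R c u) + dist (a u) (a v) + dist (a v) (4 *\<^sub>R c v)"
      using dist_triangle[of "4 *\<^sub>R c u" "4 *\<^sub>R c v" "a u"] dist_triangle[of "a u" "4 *\<^sub>R c v" "a v"]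
      by (simp add: dist_commute)
    ultimately show ?thesis using close[of u] close[of v] by linarith
  qed
  have "threshold_rep G a (2 * r)"
    unfolding threshold_rep_def
  proof (intro conjI ballI impI)
    show "{u, v} \<in> snd G \<longleftrightarrow> dist (a u) (a v) < 2 * r" if "u \<in> fst G" "v \<in> fst G" "u \<noteq> v" for u v
    proof (cases "{u, v} \<in> snd G")
      case True
      then have "dist (a u) (a v) < 2 * r" using edge[OF that True] near[of u v] r by linarith
      then show ?thesis using True by simp
    next
      case False
      then have "\<not> dist (a u) (a v) < 2 * r" using nonedge[OF that False] near[of u v] r by linarith
      then show ?thesis using False by simp
    qed
  qed fact
  moreover have "r > 0" using r \<open>\<sigma> \<ge> 1\<close> by linarith
  moreover have "r \<in> \<int>" "a v \<in> \<int> \<times> \<int>" for v by (simp_all add: r_def a_def)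
  ultimately have "integer_realization (\<lambda>v. ball (a v) r) G" by (rule integer_realizationI)
  moreover have "grid_size ((\<lambda>v. ball (a v) r) ` fst G) \<le> 6 * B + 1"
  proof (rule grid_size_le)
    fix D assume "D \<in> (\<lambda>v. ball (a v) r) ` fst G"
    then obtain v where v: "v \<in> fst G" "D = ball (a v) r" by blast
    have coord: "\<bar>of_int (round (4 * x)) :: real\<bar> \<le> 4 * real B + 1 / 2" if "\<bar>x\<bar> \<le> real B" for x :: real
      using of_int_round_abs_le[of "4 * x"] that by linarith
    have a: "\<bar>fst (a v)\<bar> \<le> 4 * real B + 1 / 2" "\<bar>snd (a v)\<bar> \<le> 4 * real B + 1 / 2"
      using coord B(2)[OF v(1)] by (auto simp: a_def)
    show "D \<subseteq> {- real (6 * B + 1)..real (6 * B + 1)} \<times> {- real (6 * B + 1)..real (6 * B + 1)}"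
    proof
      fix y assume "y \<in> D"
      then have "dist (a v) y < r" using v(2) by simp
      then have "\<bar>fst (a v) - fst y\<bar> < r" "\<bar>snd (a v) - snd y\<bar> < r"
        using dist_fst_le[of "a v" y] dist_snd_le[of "a v" y] by (auto simp: dist_real_def)
      then have "\<bar>fst y\<bar> \<le> 6 * real B + 1" "\<bar>snd y\<bar> \<le> 6 * real B + 1" using a r B(1) by linarith+
      then show "y \<in> {- real (6 * B + 1)..real (6 * B + 1)} \<times> {- real (6 * B + 1)..real (6 * B + 1)}"
        by (cases y) (auto simp: abs_le_iff)
    qed
  qed
  ultimately show ?thesis by blast
qed

section \<open>The system of inequalities of a unit disk graph\<close>

lemma ipoly_sign: "ipoly m d L f \<Longrightarrow> c \<in> {-1, 0, 1} \<Longrightarrow> ipoly m d L (\<lambda>x. c * f x)"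
  using ipoly_neg[of m d L f] ipoly_zero[of m d L] by auto

lemma DERIV_fun_upd_coordinate [derivative_intros]:
  "((\<lambda>t :: real. (x(k := t)) a) has_real_derivative (if a = k then 1 else 0)) (at T)"
  by (cases "a = k") (auto intro!: derivative_eq_intros)

lemma bounded_margin:
  fixes n :: nat
  defines "J \<equiv> 4 * 5 ^ (2 * n + 1)" and "L \<equiv> 288 * n\<^sup>2"
  defines "B \<equiv> 1 + 2 * ((J + 1) * L ^ J)"
  assumes G: "G \<in> UDG n" and n: "n \<ge> 1"
  shows "\<exists>A. integer_realization A G \<and> grid_size (A ` fst G) \<le> 6 * B + 1"
proof -
  have V: "fst G = {..<n}" "unit_disk_graph G" using G by (auto simp: UDG_def)
  define m where "m = 2 * n + 1"
  obtain c0 s where "s > 0" "threshold_rep G c0 s" using unit_disk_graph_threshold_rep[OF V(2)] .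
  then obtain c :: "nat \<Rightarrow> plane" and \<sigma> where \<sigma>: "\<sigma> \<ge> 1" and sub: "snd G \<subseteq> edge_set (fst G)"
    and edge: "\<And>u v. u \<in> fst G \<Longrightarrow> v \<in> fst G \<Longrightarrow> u \<noteq> v \<Longrightarrow> {u, v} \<in> snd G \<Longrightarrow> dist (c u) (c v) \<le> \<sigma> - 1"
    and nonedge: "\<And>u v. u \<in> fst G \<Longrightarrow> v \<in> fst G \<Longrightarrow> u \<noteq> v \<Longrightarrow> {u, v} \<notin> snd G \<Longrightarrow> dist (c u) (c v) \<ge> \<sigma> + 1"
    using threshold_rep_margin[of G c0 s] V(1) by (metis finite_lessThan)
  define sg :: "nat \<times> nat \<Rightarrow> real" where "sg = (\<lambda>(u, v). if {u, v} \<in> snd G then 1 else -1)"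
  define dd :: "nat \<times> nat \<Rightarrow> nat \<Rightarrow> (nat \<Rightarrow> real) \<Rightarrow> real" where "dd = (\<lambda>(u, v) i x. x (2 * u + i) - x (2 * v + i))"
  \<comment> \<open>The variables 2v and 2v + 1 are the centre of v, and variable 2n is the
    threshold. The sign treats both cases at once: for an edge the constraint is (\<sigma> - 1)^2
    \<ge> d^2, for a non-edge d^2 \<ge> (\<sigma> + 1)^2. The diagonal pairs carry the constraint
    \<sigma> \<ge> 1.\<close>
  define F where "F e x = (if fst e = snd e then x (2 * n) - 1
    else sg e * ((x (2 * n) - sg e)\<^sup>2 - (dd e 0 x)\<^sup>2 - (dd e 1 x)\<^sup>2))" for e x
  define dl where "dl k a = (if a = k then 1 else 0 :: real)" for k a :: nat
  define D where "D = (\<lambda>(u, v) i k. dl k (2 * u + i) - dl k (2 * v + i))"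
  define F' where "F' e k x = (if fst e = snd e then dl k (2 * n)
    else sg e * (2 * (dl k (2 * n) * (x (2 * n) - sg e)) - 2 * (D e 0 k * dd e 0 x) - 2 * (D e 1 k * dd e 1 x)))"
    for e k x
  define I where "I = {..<n} \<times> {..<n}"
  have sg: "sg e \<in> {-1, 0, 1}" for e by (simp add: sg_def split: prod.split)
  have dl: "dl k a \<in> {-1, 0, 1}" for k a by (simp add: dl_def)
  have D: "D e i k \<in> {-1, 0, 1}" for e i k by (simp add: D_def dl_def split: prod.split)
  have dd: "ipoly m 1 2 (dd e i)" if "e \<in> I" "i \<le> 1" for e i
    using that unfolding dd_def I_def m_def by (auto intro!: ipoly_diff[of _ _ 1 _ 1] ipoly_var)
  have y: "ipoly m 1 2 (\<lambda>x. x (2 * n) - b)" if "b \<in> {-1, 0, 1}" for b :: real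
    using ipoly_sign[OF ipoly_const1 that, of m 1] by (intro ipoly_diff[of _ _ 1 _ 1] ipoly_var) (auto simp: m_def)
  have sq: "ipoly m 2 4 (\<lambda>x. (f x)\<^sup>2)" if "ipoly m 1 2 f" for f
    unfolding power2_eq_square by (rule ipoly_mult[OF that that]) auto
  have dbl: "ipoly m 1 4 (\<lambda>x. 2 * f x)" if "ipoly m 1 2 f" for f
    using ipoly_add[OF that that, of 4] by simp
  have "\<exists>x. (\<forall>e\<in>I. F e x \<ge> 0) \<and> (\<forall>i<m. \<bar>x i\<bar> \<le> real (1 + 2 * ((4 * 5 ^ m + 1) * L ^ (4 * 5 ^ m))))"
  proof (rule bounded_solution)
    show "finite I" by (simp add: I_def)
    \<comment> \<open>12 = 4 + 4 + 4, one 4 for each square of a difference of two terms. The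
      derivatives give 12 as well, and the n^2 ordered pairs yield L = n^2 * 2 * 12 * 12.\<close>
    show "ipoly m 2 12 (F e)" if "e \<in> I" for e
    proof (cases "fst e = snd e")
      case True
      then show ?thesis unfolding F_def using ipoly_weaken[OF y[of 1], of 2 12] by simp
    next
      case False
      have "ipoly m 2 12 (\<lambda>x. sg e * ((x (2 * n) - sg e)\<^sup>2 - (dd e 0 x)\<^sup>2 - (dd e 1 x)\<^sup>2))"
        by (intro ipoly_sign[OF _ sg] ipoly_diff[of _ _ 8 _ 4] ipoly_diff[of _ _ 4 _ 4] sq y sg dd that) auto
      then show ?thesis unfolding F_def using False by simp
    qed
    show "ipoly m 1 12 (F' e k)" if "e \<in> I" for e k
    proof (cases "fst e = snd e")
      case True
      have "ipoly m 1 12 (\<lambda>x. dl k (2 * n) * 1)"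
        by (rule ipoly_sign[OF ipoly_weaken[OF ipoly_const1] dl]) auto
      then show ?thesis unfolding F'_def using True by simp
    next
      case False
      have "ipoly m 1 12 (\<lambda>x. sg e * (2 * (dl k (2 * n) * (x (2 * n) - sg e)) - 2 * (D e 0 k * dd e 0 x) - 2 * (D e 1 k * dd e 1 x)))"
        by (intro ipoly_sign[OF _ sg] ipoly_diff[of _ _ 8 _ 4] ipoly_diff[of _ _ 4 _ 4] dbl
            ipoly_sign[OF _ D] ipoly_sign[OF _ dl] y sg dd that) auto
      then show ?thesis unfolding F'_def using False by simp
    qed
    show "((\<lambda>t. F e (x(k := t))) has_real_derivative F' e k x) (at (x k))" for e k x
    proof (cases "fst e = snd e")
      case True
      then show ?thesis unfolding F_def F'_def dl_def by (auto intro!: derivative_eq_intros)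
    next
      case False
      have "((\<lambda>t. dd e i (x(k := t))) has_real_derivative D e i k) (at (x k))" for i
        unfolding dd_def D_def dl_def by (cases e) (auto intro!: derivative_eq_intros)
      moreover have "dd e i (x(k := x k)) = dd e i x" for i by simp
      ultimately show ?thesis unfolding F_def F'_def using False
        by (auto intro!: derivative_eq_intros simp: dl_def)
    qed
    show "card I * (2 * 12 * 12) \<le> L" by (simp add: I_def L_def card_cartesian_product power2_eq_square)
    show "1 \<le> L" using n by (simp add: L_def)
    define x0 where "x0 i = (if i < 2 * n then if even i then fst (c (i div 2)) else snd (c (i div 2))
      else if i = 2 * n then \<sigma> else 0)" for i
    show "x0 j = 0" if "j \<ge> m" for j using that by (simp add: x0_def m_def)
    show "F e x0 \<ge> 0" if "e \<in> I" for e
    proof -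
      obtain u v where e: "e = (u, v)" "u < n" "v < n" using \<open>e \<in> I\<close> by (auto simp: I_def)
      have x0: "x0 (2 * n) = \<sigma>" "\<And>w. w < n \<Longrightarrow> x0 (2 * w) = fst (c w)" "\<And>w. w < n \<Longrightarrow> x0 (2 * w + 1) = snd (c w)"
        by (auto simp: x0_def)
      have dist: "(dist (c u) (c v))\<^sup>2 = (dd e 0 x0)\<^sup>2 + (dd e 1 x0)\<^sup>2"
        using x0 e by (simp add: dist_prod_def dist_real_def dd_def)
      show ?thesis
      proof (cases "u = v")
        case True
        then show ?thesis using \<sigma> by (simp add: F_def e x0)
      next
        case False
        show ?thesis
        proof (cases "{u, v} \<in> snd G")
          case True
          then have "(dist (c u) (c v))\<^sup>2 \<le> (\<sigma> - 1)\<^sup>2"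
            using edge[of u v] e False V(1) by (intro power_mono) auto
          then show ?thesis using True False dist by (simp add: F_def sg_def e x0)
        next
          case nedge: False
          then have "(\<sigma> + 1)\<^sup>2 \<le> (dist (c u) (c v))\<^sup>2"
            using nonedge[of u v] e False V(1) \<sigma> by (intro power_mono) auto
          then show ?thesis using nedge False dist by (simp add: F_def sg_def e x0)
        qed
      qed
    qed
  qed
  then obtain x where F0: "\<And>e. e \<in> I \<Longrightarrow> F e x \<ge> 0" and xB: "\<And>i. i < m \<Longrightarrow> \<bar>x i\<bar> \<le> real B"
    unfolding B_def J_def m_def by blast
  define p :: "nat \<Rightarrow> plane" where "p v = (x (2 * v), x (2 * v + 1))" for v
  have dist: "(dist (p u) (p v))\<^sup>2 = (dd (u, v) 0 x)\<^sup>2 + (dd (u, v) 1 x)\<^sup>2" for u v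
    by (simp add: dist_Pair_Pair dist_real_def dd_def p_def)
  \<comment> \<open>From the diagonal constraint; with it the squared inequalities can be undone
    below.\<close>
  have \<tau>: "x (2 * n) \<ge> 1" using F0[of "(0, 0)"] n by (simp add: I_def F_def)
  show ?thesis
  proof (rule integer_realization_of_margin[OF \<tau> sub])
    show "dist (p u) (p v) \<le> x (2 * n) - 1" if "u \<in> fst G" "v \<in> fst G" "u \<noteq> v" "{u, v} \<in> snd G" for u v
    proof (rule power2_le_imp_le)
      show "(dist (p u) (p v))\<^sup>2 \<le> (x (2 * n) - 1)\<^sup>2"
        using F0[of "(u, v)"] that V(1) dist[of u v] by (simp add: I_def F_def sg_def)
    qed (use \<tau> in simp)
    show "x (2 * n) + 1 \<le> dist (p u) (p v)" if "u \<in> fst G" "v \<in> fst G" "u \<noteq> v" "{u, v} \<notin> snd G" for u v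
    proof (rule power2_le_imp_le)
      show "(x (2 * n) + 1)\<^sup>2 \<le> (dist (p u) (p v))\<^sup>2"
        using F0[of "(u, v)"] that V(1) dist[of u v] by (simp add: I_def F_def sg_def)
    qed simp
    show "x (2 * n) \<le> real B" using xB[of "2 * n"] by (simp add: m_def)
    show "\<bar>fst (p v)\<bar> \<le> real B \<and> \<bar>snd (p v)\<bar> \<le> real B" if "v \<in> fst G" for v
      using xB[of "2 * v"] xB[of "2 * v + 1"] that V(1) by (simp add: p_def m_def)
  qed
qed

lemma UDG_nonempty: "UDG n \<noteq> {}"
proof -
  define A :: "nat \<Rightarrow> plane set" where "A v = ball 0 1" for v
  define G where "G = intersection_graph {..<n} A"
  have G: "fst G = {..<n}" "realizes A G" by (simp_all add: G_def realizes_def intersection_graph_def)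
  have "unit_disk_graph G"
    unfolding unit_disk_graph_def using G
    by (intro conjI exI[of _ A] exI[of _ "\<lambda>_. 0"] exI[of _ 1]) (auto simp: A_def)
  then have "G \<in> UDG n" using G(1) by (simp add: UDG_def)
  then show ?thesis by blast
qed

lemma f_UDG_upper:
  assumes n: "n \<ge> 1"
  shows "real (f_UDG n) \<le> 2 powr (2 powr (16 * real n))"
proof -
  define J :: nat where "J = 4 * 5 ^ (2 * n + 1)"
  define L where "L = 288 * n\<^sup>2"
  define B where "B = 1 + 2 * ((J + 1) * L ^ J)"
  have lt: "k < 2 ^ k" for k :: nat by (rule less_exp)
  have "f_graph G \<le> 6 * B + 1" if "G \<in> UDG n" for G
    using bounded_margin[OF that n] f_graph_le unfolding B_def J_def L_def by (meson le_trans)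
  then have "f_UDG n \<le> 6 * B + 1"
    unfolding f_UDG_def using finite_UDG UDG_nonempty by (intro Max.boundedI) auto
  also have "\<dots> \<le> 2 ^ 5 * ((J + 1) * L ^ J)"
  proof -
    have "1 \<le> L ^ J" using n by (simp add: L_def)
    then have "1 \<le> (J + 1) * L ^ J" by simp
    then show ?thesis unfolding B_def by simp
  qed
  also have "\<dots> \<le> 2 ^ 5 * (2 ^ J * (2 ^ (9 + 2 * n)) ^ J)"
  proof -
    have "n\<^sup>2 \<le> (2 ^ n)\<^sup>2" using lt[of n] by (intro power_mono) auto
    then have "L \<le> 2 ^ 9 * (2 ^ n)\<^sup>2" unfolding L_def by (intro mult_mono) auto
    also have "\<dots> = 2 ^ (9 + 2 * n)" by (simp add: power_add power_mult[symmetric] mult.commute)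
    finally have "L ^ J \<le> (2 ^ (9 + 2 * n)) ^ J" by (intro power_mono) auto
    moreover have "J + 1 \<le> 2 ^ J" using lt[of J] by linarith
    ultimately show ?thesis by (intro mult_mono) auto
  qed
  also have "\<dots> = 2 ^ (5 + J + (9 + 2 * n) * J)" by (simp add: power_add power_mult)
  \<comment> \<open>J = 20 * 25^n is at most 2^(5 + 5n), and the whole exponent at most 2^(10 + 6n).
    The constant 16 = 10 + 6 covers all n \<ge> 1.\<close>
  also have "\<dots> \<le> 2 ^ (2 ^ (16 * n))"
  proof (rule power_increasing)
    have "J \<ge> 1" by (simp add: J_def)
    have J: "J \<le> 2 ^ (5 + 5 * n)"
    proof -
      have "J = 20 * (5 ^ 2) ^ n" by (simp add: J_def power_mult)
      also have "\<dots> \<le> 2 ^ 5 * (2 ^ 5) ^ n" by (intro mult_mono power_mono) auto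
      finally show ?thesis by (simp add: power_add power_mult)
    qed
    have "5 + J + (9 + 2 * n) * J \<le> (17 * n) * J"
    proof -
      have "5 + J + (9 + 2 * n) * J \<le> 5 * J + J + (9 + 2 * n) * J" using \<open>J \<ge> 1\<close> by simp
      also have "\<dots> = (15 + 2 * n) * J" by (simp add: distrib_right)
      also have "\<dots> \<le> (17 * n) * J" using n by (intro mult_right_mono) auto
      finally show ?thesis .
    qed
    also have "\<dots> \<le> (2 ^ 5 * 2 ^ n) * 2 ^ (5 + 5 * n)"
      using J lt[of n] by (intro mult_mono) auto
    also have "\<dots> = 2 ^ (10 + 6 * n)" by (simp only: power_add[symmetric]) (simp add: algebra_simps)
    also have "\<dots> \<le> 2 ^ (16 * n)" by (rule power_increasing) (use n in auto)
    finally show "5 + J + (9 + 2 * n) * J \<le> 2 ^ (16 * n)" .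
  qed simp
  finally have "real (f_UDG n) \<le> real (2 ^ (2 ^ (16 * n)))" by (simp only: of_nat_le_iff)
  also have "\<dots> = 2 powr (2 powr (16 * real n))"
    by (simp add: powr_realpow[symmetric])
  finally show ?thesis .
qed

section \<open>Geometry of thin lenses\<close>

lemma dist_less_dist_iff_bisector:
  fixes p z a :: "'a :: real_inner"
  shows "dist p a < dist z a \<longleftrightarrow> (p - z) \<bullet> (a - midpoint p z) > 0"
proof -
  have "dist p a < dist z a \<longleftrightarrow> (dist p a)\<^sup>2 < (dist z a)\<^sup>2"
    by (metis pos2 power2_less_imp_less power_strict_mono zero_le_dist)
  moreover have "2 * ((p - z) \<bullet> (a - midpoint p z)) = (dist z a)\<^sup>2 - (dist p a)\<^sup>2"
    by (simp add: dist_norm power2_norm_eq_inner midpoint_def inner_diff_left inner_diff_right inner_add_left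
        inner_add_right inner_commute algebra_simps)
  ultimately show ?thesis by linarith
qed

text \<open>The difference of two squared distances is affine, so a bound for it passes to convex hulls.\<close>

lemma dist_square_le_if_in_convex_hull:
  fixes p x :: "'a :: real_inner"
  assumes "\<And>y. y \<in> S \<Longrightarrow> (dist p y)\<^sup>2 - (dist x y)\<^sup>2 \<le> c" "x \<in> convex hull S"
  shows "(dist p x)\<^sup>2 \<le> c"
proof -
  let ?H = "{y. (2 *\<^sub>R (x - p)) \<bullet> y \<le> c + x \<bullet> x - p \<bullet> p}"
  have H: "y \<in> ?H \<longleftrightarrow> (dist p y)\<^sup>2 - (dist x y)\<^sup>2 \<le> c" for y
    by (simp add: dist_norm power2_norm_eq_inner inner_diff_left inner_diff_right inner_commute algebra_simps)
  have "convex hull S \<subseteq> ?H"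
  proof (rule hull_minimal)
    show "S \<subseteq> ?H" using assms(1) H by blast
  qed (rule convex_halfspace_le)
  then show ?thesis using assms(2) H[of x] by auto
qed

definition cross :: "real \<times> real \<Rightarrow> real \<times> real \<Rightarrow> real" where
  "cross u v = fst u * snd v - snd u * fst v"

lemma cross_zero_imp_parallel:
  assumes "cross u w = 0" "u \<noteq> 0"
  obtains t where "w = t *\<^sub>R u"
proof
  let ?t = "(w \<bullet> u) / (u \<bullet> u)"
  have nz: "u \<bullet> u \<noteq> 0" using assms(2) by simp
  obtain u1 u2 w1 w2 where uw: "u = (u1, u2)" "w = (w1, w2)" by (cases u, cases w)
  have c: "u1 * w2 = u2 * w1" using assms(1) by (simp add: cross_def uw)
  have "w1 * (u1 * u1 + u2 * u2) = (w1 * u1 + w2 * u2) * u1"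
    using c by algebra
  moreover have "w2 * (u1 * u1 + u2 * u2) = (w1 * u1 + w2 * u2) * u2"
    using c by algebra
  moreover have "u1 * u1 + u2 * u2 \<noteq> 0" using nz by (simp add: uw)
  ultimately show "w = ?t *\<^sub>R u" by (simp add: uw eq_divide_eq)
qed

text \<open>Used with q the midpoint of p and z and v = p - z, so that the hypotheses on v say which
  centres are closer to p and which to z. If q and l were on different sides of the line ab, the
  segment ql would meet that line outside the segment ab, and then a or b would lie in the triangle
  q l r.\<close>

lemma side_of_crossing_line:
  fixes a b l r q :: "real \<times> real"
  assumes X: "X \<in> closed_segment a b" "X \<in> closed_segment l r" and ab: "a \<noteq> b"
    and v: "v \<bullet> (a - q) > 0" "v \<bullet> (b - q) > 0" "v \<bullet> (l - q) < 0"
    and hull: "a \<notin> convex hull {q, l, r}" "b \<notin> convex hull {q, l, r}"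
    and l: "cross (b - a) (l - a) \<ge> 0"
  shows "cross (b - a) (q - a) \<ge> 0"
proof (rule ccontr)
  define g where "g x = cross (b - a) (x - a)" for x
  assume "\<not> ?thesis"
  then have gq: "g q < 0" and gl: "g l \<ge> 0" using l by (auto simp: g_def)
  \<comment> \<open>\<tau> is the parameter at which the segment from q to l meets the line ab, in
    the point w.\<close>
  define \<tau> where "\<tau> = - g q / (g l - g q)"
  have \<tau>: "0 < \<tau>" "\<tau> \<le> 1" using gq gl by (auto simp: \<tau>_def divide_simps)
  define w where "w = q + \<tau> *\<^sub>R (l - q)"
  have "g w = g q + \<tau> * (g l - g q)"
    by (simp add: g_def w_def cross_def algebra_simps)
  then have "g w = 0" using gq gl by (simp add: \<tau>_def)
  then obtain s where s: "w - a = s *\<^sub>R (b - a)"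
    using cross_zero_imp_parallel[of "b - a" "w - a"] ab unfolding g_def by auto
  have w: "w = a + s *\<^sub>R (b - a)" using s by (simp add: algebra_simps)
  have w_hull: "w \<in> convex hull {q, l, r}"
  proof -
    have "w \<in> closed_segment q l" unfolding w_def closed_segment_def using \<tau>
      by (auto intro!: exI[of _ \<tau>] simp: algebra_simps)
    then show ?thesis unfolding segment_convex_hull using hull_mono[of "{q, l}" "{q, l, r}" convex] by auto
  qed
  have X_hull: "X \<in> convex hull {q, l, r}"
    using X(2) unfolding segment_convex_hull using hull_mono[of "{l, r}" "{q, l, r}" convex] by auto
  obtain \<beta> where \<beta>: "0 \<le> \<beta>" "\<beta> \<le> 1" "X = (1 - \<beta>) *\<^sub>R a + \<beta> *\<^sub>R b"
    using X(1) unfolding closed_segment_def by auto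
  have conv: "convex (convex hull {q, l, r})" by (rule convex_convex_hull)
  have "w - q = (1 - s) *\<^sub>R (a - q) + s *\<^sub>R (b - q)" using s by (simp add: algebra_simps)
  then have "\<tau> *\<^sub>R (l - q) = (1 - s) *\<^sub>R (a - q) + s *\<^sub>R (b - q)" by (simp add: w_def)
  then have "\<tau> * (v \<bullet> (l - q)) = (1 - s) * (v \<bullet> (a - q)) + s * (v \<bullet> (b - q))"
    by (metis inner_add_right inner_scaleR_right)
  moreover have "\<tau> * (v \<bullet> (l - q)) < 0" using \<tau> v(3) by (simp add: mult_pos_neg)
  ultimately have "(1 - s) * (v \<bullet> (a - q)) + s * (v \<bullet> (b - q)) < 0" by simp
  \<comment> \<open>The perpendicular to v through q has w on one side and the whole segment ab on
    the other.\<close>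
  then have "s < 0 \<or> s > 1"
    using v(1,2) by (smt (verit) mult_nonneg_nonneg)
  then show False
  proof
    assume "s < 0"
    then have pos: "\<beta> - s > 0" using \<beta> by simp
    \<comment> \<open>On the line ab, the point a lies between w and X, which both belong to the
      triangle.\<close>
    have "a = (\<beta> / (\<beta> - s)) *\<^sub>R w + (- s / (\<beta> - s)) *\<^sub>R X"
    proof -
      have "(\<beta> - s) *\<^sub>R a = \<beta> *\<^sub>R w + (- s) *\<^sub>R X"
        unfolding w \<beta>(3) by (simp add: algebra_simps)
      then have "inverse (\<beta> - s) *\<^sub>R ((\<beta> - s) *\<^sub>R a) = inverse (\<beta> - s) *\<^sub>R (\<beta> *\<^sub>R w + (- s) *\<^sub>R X)" by simp
      then show ?thesis using pos by (simp add: scaleR_add_right scaleR_diff_right divide_inverse mult.commute)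
    qed
    moreover have "(\<beta> / (\<beta> - s)) *\<^sub>R w + (- s / (\<beta> - s)) *\<^sub>R X \<in> convex hull {q, l, r}"
      by (rule convexD[OF conv w_hull X_hull]) (use pos \<beta> \<open>s < 0\<close> in \<open>auto simp: divide_simps\<close>)
    ultimately show False using hull(1) by simp
  next
    assume "s > 1"
    then have pos: "s - \<beta> > 0" using \<beta> by simp
    have "b = ((1 - \<beta>) / (s - \<beta>)) *\<^sub>R w + ((s - 1) / (s - \<beta>)) *\<^sub>R X"
    proof -
      have "(s - \<beta>) *\<^sub>R b = (1 - \<beta>) *\<^sub>R w + (s - 1) *\<^sub>R X"
        unfolding w \<beta>(3) by (simp add: algebra_simps)
      then have "inverse (s - \<beta>) *\<^sub>R ((s - \<beta>) *\<^sub>R b) = inverse (s - \<beta>) *\<^sub>R ((1 - \<beta>) *\<^sub>R w + (s - 1) *\<^sub>R X)" by simp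
      then show ?thesis using pos by (simp add: scaleR_add_right scaleR_diff_right divide_inverse mult.commute)
    qed
    moreover have "((1 - \<beta>) / (s - \<beta>)) *\<^sub>R w + ((s - 1) / (s - \<beta>)) *\<^sub>R X \<in> convex hull {q, l, r}"
      by (rule convexD[OF conv w_hull X_hull])
        (use pos \<beta> \<open>s > 1\<close> in \<open>auto simp: divide_simps\<close>)
    ultimately show False using hull(2) by simp
  qed
qed

text \<open>The perpendicular bisector of e and f separates S from T. The hypotheses follow from
  adjacency alone when e meets exactly the disks centred in S and f exactly those in T.\<close>

lemma bisector_separates_hulls:
  fixes e f :: "'a :: real_inner"
  assumes "\<And>x. x \<in> S \<Longrightarrow> dist x e < dist x f" "\<And>x. x \<in> T \<Longrightarrow> dist x f < dist x e"
  shows "convex hull S \<inter> convex hull T = {}"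
proof -
  have iff: "dist x e < dist x f \<longleftrightarrow> (e - f) \<bullet> x > (e - f) \<bullet> midpoint e f" for x e f :: 'a
    using dist_less_dist_iff_bisector[of e x f] by (simp add: dist_commute inner_diff_right)
  have "convex hull S \<subseteq> {x. (e - f) \<bullet> x > (e - f) \<bullet> midpoint e f}"
    by (rule hull_minimal) (use assms(1) iff convex_halfspace_gt in auto)
  moreover have "convex hull T \<subseteq> {x. (f - e) \<bullet> x > (f - e) \<bullet> midpoint f e}"
    by (rule hull_minimal) (use assms(2) iff convex_halfspace_gt in auto)
  ultimately show ?thesis by (force simp: midpoint_sym[of f e] inner_diff_left)
qed

text \<open>Of the seven splittings of four points into two nonempty parts, convex position excludes
  the four of type 1 + 3 and \<open>sep\<close> excludes two of type 2 + 2. Radon's theorem leaves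
  the crossing of ab with lr.\<close>

lemma Radon_four_points:
  fixes a b l r :: "real \<times> real"
  assumes distinct: "distinct [a, b, l, r]"
    and conv: "a \<notin> convex hull {b, l, r}" "b \<notin> convex hull {a, l, r}"
      "l \<notin> convex hull {a, b, r}" "r \<notin> convex hull {a, b, l}"
    and sep: "convex hull {a, l} \<inter> convex hull {b, r} = {}" "convex hull {a, r} \<inter> convex hull {b, l} = {}"
  obtains X where "X \<in> closed_segment a b" "X \<in> closed_segment l r"
proof -
  let ?S = "{a, b, l, r}"
  have "affine_dependent ?S"
    by (rule affine_dependent_biggerset) (use distinct in auto)
  then obtain m p where mp: "m \<subseteq> ?S" "p \<subseteq> ?S" "m \<inter> p = {}" "(convex hull m) \<inter> (convex hull p) \<noteq> {}"
    by (rule Radon)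
  \<comment> \<open>The parts from Radon's theorem need not exhaust the four points and come in no
    fixed order, so only inclusions are required.\<close>
  define T where "T M P \<longleftrightarrow> (m \<subseteq> M \<and> p \<subseteq> P) \<or> (m \<subseteq> P \<and> p \<subseteq> M)" for M P
  have T: "(convex hull M) \<inter> (convex hull P) \<noteq> {}" if "T M P" for M P
    using that mp(4) hull_mono[of m M convex] hull_mono[of p P convex] hull_mono[of m P convex]
      hull_mono[of p M convex] unfolding T_def by blast
  have single: "\<not> T {x} S" if "x \<notin> convex hull S" for x S using T[of "{x}" S] that by auto
  have sub: "y \<subseteq> {a} \<longleftrightarrow> b \<notin> y \<and> l \<notin> y \<and> r \<notin> y" "y \<subseteq> {b} \<longleftrightarrow> a \<notin> y \<and> l \<notin> y \<and> r \<notin> y"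
    "y \<subseteq> {l} \<longleftrightarrow> a \<notin> y \<and> b \<notin> y \<and> r \<notin> y" "y \<subseteq> {r} \<longleftrightarrow> a \<notin> y \<and> b \<notin> y \<and> l \<notin> y"
    "y \<subseteq> {b, l, r} \<longleftrightarrow> a \<notin> y" "y \<subseteq> {a, l, r} \<longleftrightarrow> b \<notin> y"
    "y \<subseteq> {a, b, r} \<longleftrightarrow> l \<notin> y" "y \<subseteq> {a, b, l} \<longleftrightarrow> r \<notin> y"
    "y \<subseteq> {a, b} \<longleftrightarrow> l \<notin> y \<and> r \<notin> y" "y \<subseteq> {l, r} \<longleftrightarrow> a \<notin> y \<and> b \<notin> y"
    "y \<subseteq> {a, l} \<longleftrightarrow> b \<notin> y \<and> r \<notin> y" "y \<subseteq> {b, r} \<longleftrightarrow> a \<notin> y \<and> l \<notin> y"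
    "y \<subseteq> {a, r} \<longleftrightarrow> b \<notin> y \<and> l \<notin> y" "y \<subseteq> {b, l} \<longleftrightarrow> a \<notin> y \<and> r \<notin> y"
    if "y \<subseteq> ?S" for y
    using that distinct by auto
  have "\<not> (a \<in> m \<and> a \<in> p)" "\<not> (b \<in> m \<and> b \<in> p)" "\<not> (l \<in> m \<and> l \<in> p)" "\<not> (r \<in> m \<and> r \<in> p)"
    using mp(3) by auto
  moreover have "m \<noteq> {}" "p \<noteq> {}" using mp(4) by auto
  then have "a \<in> m \<or> b \<in> m \<or> l \<in> m \<or> r \<in> m" "a \<in> p \<or> b \<in> p \<or> l \<in> p \<or> r \<in> p"
    using mp(1,2) by blast+
  ultimately have "T {a} {b, l, r} \<or> T {b} {a, l, r} \<or> T {l} {a, b, r} \<or> T {r} {a, b, l} \<or>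
      T {a, l} {b, r} \<or> T {a, r} {b, l} \<or> T {a, b} {l, r}"
    unfolding T_def sub[OF mp(1)] sub[OF mp(2)] by argo
  moreover have "\<not> T {a, l} {b, r}" "\<not> T {a, r} {b, l}" using T sep by blast+
  ultimately have "T {a, b} {l, r}" using single conv by blast
  from T[OF this] show thesis using that unfolding segment_convex_hull by blast
qed

section \<open>Metric estimates for lenses\<close>

lemma dist_square_midpoint:
  fixes a b x :: "'a :: real_inner"
  shows "(dist x a)\<^sup>2 = (dist x (midpoint a b))\<^sup>2 + (x - midpoint a b) \<bullet> (b - a) + (dist a b)\<^sup>2 / 4"
    and "(dist x b)\<^sup>2 = (dist x (midpoint a b))\<^sup>2 - (x - midpoint a b) \<bullet> (b - a) + (dist a b)\<^sup>2 / 4"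
proof -
  show "(dist x a)\<^sup>2 = (dist x (midpoint a b))\<^sup>2 + (x - midpoint a b) \<bullet> (b - a) + (dist a b)\<^sup>2 / 4"
    by (simp add: dist_norm power2_norm_eq_inner midpoint_def inner_diff_left inner_diff_right inner_add_left
        inner_add_right inner_commute algebra_simps) argo
  show "(dist x b)\<^sup>2 = (dist x (midpoint a b))\<^sup>2 - (x - midpoint a b) \<bullet> (b - a) + (dist a b)\<^sup>2 / 4"
    by (simp add: dist_norm power2_norm_eq_inner midpoint_def inner_diff_left inner_diff_right inner_add_left
        inner_add_right inner_commute algebra_simps) argo
qed

text \<open>The larger of the two squared distances carries the inner product with positive sign.
  Distance to the midpoint enters squared, displacement along ab linearly: a lens of height \<delta>
  has width of order \<delta>^2, which is the source of the squaring.\<close>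

lemma lens_bounds:
  fixes a b x :: "'a :: real_inner"
  assumes "dist x a < 1" "dist x b < 1"
  shows "(dist x (midpoint a b))\<^sup>2 + \<bar>(x - midpoint a b) \<bullet> (b - a)\<bar> < 1 - (dist a b)\<^sup>2 / 4"
proof -
  have "(dist x a)\<^sup>2 < 1" "(dist x b)\<^sup>2 < 1" using assms by (simp_all add: power_less_one_iff abs_square_less_1)
  then show ?thesis using dist_square_midpoint(1)[of x a b] dist_square_midpoint(2)[of x b a] by linarith
qed

lemma lens_radius:
  fixes a b x :: "'a :: real_inner"
  assumes "dist x a < 1" "dist x b < 1"
  shows "(dist x (midpoint a b))\<^sup>2 < 1 - (dist a b)\<^sup>2 / 4"
  using lens_bounds[OF assms] abs_ge_zero[of "(x - midpoint a b) \<bullet> (b - a)"] by linarith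

text \<open>A point outside both disks but beside the segment ab is at least half the lens height
  away from the line ab. Since p lies on the other side of that line, its distance from z is at
  least as large. In coordinates scaled by \<open>dist a b\<close>, s runs along the line and g
  across it.\<close>

lemma lens_height:
  fixes a b p z :: "real \<times> real"
  assumes p: "dist p a < 1" "dist p b < 1" and z: "dist z a \<ge> 1" "dist z b \<ge> 1"
    and ab: "dist a b \<ge> 1" and \<delta>: "dist p z \<le> \<delta>" "\<delta> \<le> 1 / 4"
    and side: "cross (b - a) (p - a) * cross (b - a) (z - a) \<le> 0"
  shows "4 * (1 - \<delta>\<^sup>2) \<le> (dist a b)\<^sup>2"
proof -
  define m where "m = midpoint a b"
  define Q where "Q = (dist a b)\<^sup>2"
  define g where "g x = cross (b - a) (x - a)" for x
  define s where "s x = (x - m) \<bullet> (b - a)" for x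
  have "Q \<ge> 1" using ab by (simp add: Q_def)
  have pyth: "(s x)\<^sup>2 + (g x)\<^sup>2 = Q * (dist x m)\<^sup>2" for x
  proof -
    obtain x1 x2 a1 a2 b1 b2 where "x = (x1, x2)" "a = (a1, a2)" "b = (b1, b2)" by (cases x, cases a, cases b)
    then show ?thesis
      by (simp add: s_def g_def Q_def m_def cross_def dist_norm power2_norm_eq_inner midpoint_def)
        (simp add: field_simps power2_eq_square)
  qed
  have diff: "(g p - g z)\<^sup>2 \<le> Q * (dist p z)\<^sup>2" and sdiff: "(s p - s z)\<^sup>2 \<le> Q * (dist p z)\<^sup>2"
  proof -
    have "(s p - s z)\<^sup>2 + (g p - g z)\<^sup>2 = Q * (dist p z)\<^sup>2"
    proof -
      obtain p1 p2 z1 z2 a1 a2 b1 b2 where "p = (p1, p2)" "z = (z1, z2)" "a = (a1, a2)" "b = (b1, b2)"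
        by (cases p, cases z, cases a, cases b)
      then show ?thesis
        by (simp add: s_def g_def Q_def m_def cross_def dist_norm power2_norm_eq_inner midpoint_def)
          (simp add: field_simps power2_eq_square)
    qed
    then show "(g p - g z)\<^sup>2 \<le> Q * (dist p z)\<^sup>2" "(s p - s z)\<^sup>2 \<le> Q * (dist p z)\<^sup>2"
      by (smt (verit) zero_le_power2)+
  qed
  have sp: "\<bar>s p\<bar> < 1 - Q / 4"
    using lens_bounds[OF p] unfolding s_def m_def Q_def by (smt (verit) zero_le_power2)
  have "\<bar>s p - s z\<bar> \<le> Q / 4"
  proof -
    have "(dist p z)\<^sup>2 \<le> (1 / 4)\<^sup>2" using \<delta> by (intro power_mono) auto
    then have "Q * (dist p z)\<^sup>2 \<le> Q * (1 / 4)\<^sup>2" using \<open>Q \<ge> 1\<close> by (intro mult_left_mono) auto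
    also have "\<dots> \<le> (Q * Q) * (1 / 4)\<^sup>2" using \<open>Q \<ge> 1\<close> by (intro mult_right_mono) auto
    also have "\<dots> = (Q / 4)\<^sup>2" by (simp add: power2_eq_square)
    finally have "(s p - s z)\<^sup>2 \<le> (Q / 4)\<^sup>2" using sdiff by linarith
    then show ?thesis using \<open>Q \<ge> 1\<close> by (simp add: abs_le_square_iff[symmetric])
  qed
  \<comment> \<open>z is not far beyond the lens in the direction of ab; otherwise being outside
    both disks would say nothing about its height.\<close>
  then have sz: "\<bar>s z\<bar> \<le> Q" using sp \<open>Q \<ge> 1\<close> by linarith
  have "1 \<le> (dist z a)\<^sup>2" "1 \<le> (dist z b)\<^sup>2" using z by simp_all
  then have zm: "1 - Q / 4 + \<bar>s z\<bar> \<le> (dist z m)\<^sup>2"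
    using dist_square_midpoint(1)[of z a b] dist_square_midpoint(2)[of z b a] unfolding s_def m_def Q_def by linarith
  have "(s z)\<^sup>2 \<le> Q * \<bar>s z\<bar>"
    using mult_right_mono[OF sz, of "\<bar>s z\<bar>"] by (simp add: power2_eq_square)
  moreover have "Q * (1 - Q / 4 + \<bar>s z\<bar>) \<le> Q * (dist z m)\<^sup>2" using zm \<open>Q \<ge> 1\<close> by (intro mult_left_mono) auto
  ultimately have "Q * (1 - Q / 4) \<le> (g z)\<^sup>2" using pyth[of z] by (simp add: distrib_left)
  also have "\<dots> \<le> (g p - g z)\<^sup>2"
    using side zero_le_power2[of "g p"] unfolding g_def[symmetric] power2_diff by linarith
  also have "\<dots> \<le> Q * (dist p z)\<^sup>2" by (rule diff)
  also have "\<dots> \<le> Q * \<delta>\<^sup>2" using \<delta> \<open>Q \<ge> 1\<close> by (intro mult_left_mono power_mono) auto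
  finally have "1 - Q / 4 \<le> \<delta>\<^sup>2" using \<open>Q \<ge> 1\<close> by simp
  then show ?thesis unfolding Q_def by simp
qed

text \<open>\<open>lens_height\<close> with the side condition replaced by adjacency. The witnesses
  e1 to e4 make ab and lr cross, so l and r are on opposite sides of the line ab; the midpoints of p
  z1 and p z2 follow them. Hence, wherever p is, z1 or z2 is across the line.\<close>

lemma lens_thin:
  fixes a b l r p z1 z2 :: "real \<times> real"
  assumes p: "dist p a < 1" "dist p b < 1" "dist p l \<ge> 1" "dist p r \<ge> 1"
    and z1: "dist z1 a \<ge> 1" "dist z1 b \<ge> 1" "dist z1 l < 1"
    and z2: "dist z2 a \<ge> 1" "dist z2 b \<ge> 1" "dist z2 r < 1"
    and far: "dist a b \<ge> 1" "dist a l \<ge> 1" "dist a r \<ge> 1" "dist b l \<ge> 1" "dist b r \<ge> 1" "dist l r \<ge> 1"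
    and e1: "dist a e1 < 1" "dist l e1 < 1" "dist b e1 \<ge> 1" "dist r e1 \<ge> 1"
    and e2: "dist b e2 < 1" "dist r e2 < 1" "dist a e2 \<ge> 1" "dist l e2 \<ge> 1"
    and e3: "dist a e3 < 1" "dist r e3 < 1" "dist b e3 \<ge> 1" "dist l e3 \<ge> 1"
    and e4: "dist b e4 < 1" "dist l e4 < 1" "dist a e4 \<ge> 1" "dist r e4 \<ge> 1"
    and \<delta>: "dist p z1 \<le> \<delta>" "dist p z2 \<le> \<delta>" "\<delta> \<le> 1 / 6"
  shows "4 * (1 - \<delta>\<^sup>2) \<le> (dist a b)\<^sup>2"
proof -
  have distinct: "distinct [a, b, l, r]" using far by auto
  have near: "5 / 6 \<le> dist p y" "dist p y \<le> 7 / 6" if "y \<in> {a, b, l, r}" for y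
    using that p z1 z2 \<delta> dist_triangle[of z1 a p] dist_triangle[of z1 b p]
      dist_triangle[of p l z1] dist_triangle[of p r z2] by (auto simp: dist_commute)
  \<comment> \<open>Since \<delta> \<le> 1/6, the four centres are at distance between 5/6 and 7/6
    from p and at least 1 from each other; a point of the hull would be within sqrt(13/36) < 5/6 of
    p.\<close>
  have not_hull: "x \<notin> convex hull S" if "x \<in> {a, b, l, r}" "S \<subseteq> {a, b, l, r} - {x}" for x S
  proof
    assume x: "x \<in> convex hull S"
    have "(dist p x)\<^sup>2 \<le> (7 / 6)\<^sup>2 - 1"
    proof (rule dist_square_le_if_in_convex_hull[OF _ x])
      fix y assume "y \<in> S"
      then have "dist x y \<ge> 1" using that far by (auto simp: dist_commute)
      then have "(dist x y)\<^sup>2 \<ge> 1" by simp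
      moreover have "(dist p y)\<^sup>2 \<le> (7 / 6)\<^sup>2" using near(2)[of y] \<open>y \<in> S\<close> that by (intro power_mono) auto
      ultimately show "(dist p y)\<^sup>2 - (dist x y)\<^sup>2 \<le> (7 / 6)\<^sup>2 - 1" by linarith
    qed
    moreover have "(5 / 6)\<^sup>2 \<le> (dist p x)\<^sup>2" using near(1)[OF that(1)] by (intro power_mono) auto
    ultimately show False by (simp add: power2_eq_square)
  qed
  obtain X where X: "X \<in> closed_segment a b" "X \<in> closed_segment l r"
  proof (rule Radon_four_points[OF distinct])
    show "a \<notin> convex hull {b, l, r}" "b \<notin> convex hull {a, l, r}" "l \<notin> convex hull {a, b, r}" "r \<notin> convex hull {a, b, l}"
      by (rule not_hull; use distinct in auto)+
    show "convex hull {a, l} \<inter> convex hull {b, r} = {}"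
      by (rule bisector_separates_hulls[of _ e1 e2]) (use e1 e2 in auto)
    show "convex hull {a, r} \<inter> convex hull {b, l} = {}"
      by (rule bisector_separates_hulls[of _ e3 e4]) (use e3 e4 in auto)
  qed
  \<comment> \<open>The same argument seen from the midpoint q, with 5/4 = 1/12 + 1/6 + 1 and 11/12
    = 1 - 1/12.\<close>
  have not_tri: "x \<notin> convex hull {midpoint p z, l, r}"
    if x: "x = a \<or> x = b" and z: "z = z1 \<or> z = z2" for x z
  proof
    define q where "q = midpoint p z"
    assume "x \<in> convex hull {midpoint p z, l, r}"
    then have hull: "x \<in> convex hull {q, l, r}" by (simp add: q_def)
    have qz: "dist q z = dist p z / 2" "dist q p = dist p z / 2" by (simp_all add: q_def dist_midpoint)
    have pz: "dist p z \<le> 1 / 6" using z \<delta> by auto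
    have lr: "dist q y \<le> 5 / 4" if y: "y = l \<or> y = r" for y
    proof -
      obtain w where w: "dist w y < 1" "dist p w \<le> 1 / 6" using y z1(3) z2(3) \<delta> by fastforce
      have "dist q y \<le> dist q p + dist p w + dist w y"
        using dist_triangle[of q y p] dist_triangle[of p y w] by linarith
      then show ?thesis using w qz pz by linarith
    qed
    have xz: "dist z x \<ge> 1" using x z z1 z2 by auto
    then have qx: "11 / 12 \<le> dist q x" using dist_triangle[of z x q] qz pz by (simp add: dist_commute)
    have "(dist q x)\<^sup>2 \<le> (5 / 4)\<^sup>2 - 1"
    proof (rule dist_square_le_if_in_convex_hull[OF _ hull])
      fix y assume "y \<in> {q, l, r}"
      then consider "y = q" | "y = l \<or> y = r" by blast
      then show "(dist q y)\<^sup>2 - (dist x y)\<^sup>2 \<le> (5 / 4)\<^sup>2 - 1"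
      proof cases
        case 1
        then have "(dist q y)\<^sup>2 = 0" by simp
        moreover have "(0 :: real) \<le> (5 / 4)\<^sup>2 - 1" by (simp add: power2_eq_square)
        ultimately show ?thesis using zero_le_power2[of "dist x y"] by linarith
      next
        case 2
        then have "dist x y \<ge> 1" using x far by auto
        then have "(dist x y)\<^sup>2 \<ge> 1" by simp
        moreover have "(dist q y)\<^sup>2 \<le> (5 / 4)\<^sup>2" using lr[OF 2] by (intro power_mono) auto
        ultimately show ?thesis by linarith
      qed
    qed
    moreover have "(11 / 12)\<^sup>2 \<le> (dist q x)\<^sup>2" using qx by (intro power_mono) auto
    ultimately show False by (simp add: power2_eq_square)
  qed
  define g where "g x = cross (b - a) (x - a)" for x
  have a_b: "a \<noteq> b" "b \<noteq> a" using distinct by auto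
  have flip: "cross (a - b) (x - b) = - g x" for x
    by (cases a, cases b, cases x) (simp add: g_def cross_def algebra_simps)
  have halves: "(p - z1) \<bullet> (a - midpoint p z1) > 0" "(p - z1) \<bullet> (b - midpoint p z1) > 0"
      "(p - z1) \<bullet> (l - midpoint p z1) < 0"
      "(p - z2) \<bullet> (a - midpoint p z2) > 0" "(p - z2) \<bullet> (b - midpoint p z2) > 0"
      "(p - z2) \<bullet> (r - midpoint p z2) < 0"
  proof -
    have flipz: "(p - z) \<bullet> (y - midpoint p z) < 0" if "dist z y < dist p y" for z y
      using dist_less_dist_iff_bisector[of z y p] that by (simp add: midpoint_sym[of z p] inner_diff_left)
    show "(p - z1) \<bullet> (l - midpoint p z1) < 0" "(p - z2) \<bullet> (r - midpoint p z2) < 0"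
      using p z1 z2 by (auto intro!: flipz)
  qed (use p z1 z2 dist_less_dist_iff_bisector[of p _] in \<open>auto simp flip: dist_less_dist_iff_bisector\<close>)
  have seg: "X \<in> closed_segment b a" "X \<in> closed_segment r l" using X by (simp_all add: closed_segment_commute)
  have tri': "x \<notin> convex hull {midpoint p z, r, l}" if "x = a \<or> x = b" "z = z1 \<or> z = z2" for x z
    using not_tri[OF that] by (simp add: insert_commute)
  have gl: "g l \<ge> 0 \<Longrightarrow> g (midpoint p z1) \<ge> 0"
    unfolding g_def by (rule side_of_crossing_line[OF X a_b(1) halves(1-3)]) (use not_tri in auto)
  have gr: "g r \<le> 0 \<Longrightarrow> g (midpoint p z2) \<le> 0"
    using side_of_crossing_line[OF seg a_b(2) halves(5,4,6)] tri' flip by auto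
  have gl': "g l \<le> 0 \<Longrightarrow> g (midpoint p z1) \<le> 0"
    using side_of_crossing_line[OF seg(1) X(2) a_b(2) halves(2,1,3)] not_tri flip by auto
  have gr': "g r \<ge> 0 \<Longrightarrow> g (midpoint p z2) \<ge> 0"
    unfolding g_def by (rule side_of_crossing_line[OF X(1) seg(2) a_b(1) halves(4-6)]) (use tri' in auto)
  have mid: "2 * g (midpoint p z) = g p + g z" for z
    by (cases a, cases b, cases p, cases z) (simp add: g_def cross_def midpoint_def field_simps)
  have sides: "(g l \<ge> 0 \<and> g r \<le> 0) \<or> (g l \<le> 0 \<and> g r \<ge> 0)"
  proof -
    obtain \<beta> where \<beta>: "X = a + \<beta> *\<^sub>R (b - a)" using X(1) unfolding closed_segment_def by (auto simp: algebra_simps)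
    obtain \<mu> where \<mu>: "0 \<le> \<mu>" "\<mu> \<le> 1" "X = (1 - \<mu>) *\<^sub>R l + \<mu> *\<^sub>R r"
      using X(2) unfolding closed_segment_def by auto
    have "g X = 0" unfolding \<beta> by (simp add: g_def cross_def algebra_simps)
    moreover have "g X = (1 - \<mu>) * g l + \<mu> * g r"
      unfolding \<mu>(3) by (simp add: g_def cross_def algebra_simps)
    ultimately have eq: "(1 - \<mu>) * g l + \<mu> * g r = 0" by simp
    show ?thesis
    proof (cases "\<mu> = 0 \<or> \<mu> = 1")
      case True
      then have "g l = 0 \<or> g r = 0" using eq by auto
      then show ?thesis by linarith
    next
      case False
      then have "0 < \<mu>" "0 < 1 - \<mu>" using \<mu> by auto
      then show ?thesis using eq
        by (smt (verit) mult_pos_pos mult_pos_neg)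
    qed
  qed
  \<comment> \<open>g is affine, so its sign at a midpoint is the sign of g p + g z. The two sums
    have weakly opposite signs, which p cannot match on both sides.\<close>
  then have "(g p + g z1 \<ge> 0 \<and> g p + g z2 \<le> 0) \<or> (g p + g z1 \<le> 0 \<and> g p + g z2 \<ge> 0)"
    using gl gr gl' gr' mid[of z1] mid[of z2] by linarith
  then have "(g p \<le> 0 \<and> g z1 \<ge> 0) \<or> (g p \<ge> 0 \<and> g z2 \<le> 0) \<or> (g p \<ge> 0 \<and> g z1 \<le> 0) \<or> (g p \<le> 0 \<and> g z2 \<ge> 0)"
    by linarith
  then have "g p * g z1 \<le> 0 \<or> g p * g z2 \<le> 0"
    by (auto simp: mult_le_0_iff)
  then show ?thesis
  proof
    assume "g p * g z1 \<le> 0"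
    then show ?thesis
      by (intro lens_height[OF p(1,2) z1(1,2) far(1) \<delta>(1)]) (use \<delta> in \<open>auto simp: g_def\<close>)
  next
    assume "g p * g z2 \<le> 0"
    then show ?thesis
      by (intro lens_height[OF p(1,2) z2(1,2) far(1) \<delta>(2)]) (use \<delta> in \<open>auto simp: g_def\<close>)
  qed
qed

lemma lens_diameter:
  fixes a b p x :: "'a :: real_inner"
  assumes "dist p a < 1" "dist p b < 1" "dist x a < 1" "dist x b < 1"
    and "4 * (1 - \<delta>\<^sup>2) \<le> (dist a b)\<^sup>2" "0 \<le> \<delta>"
  shows "dist p x < 2 * \<delta>"
proof -
  have "dist y (midpoint a b) < \<delta>" if "dist y a < 1" "dist y b < 1" for y
  proof (rule power2_less_imp_less)
    show "(dist y (midpoint a b))\<^sup>2 < \<delta>\<^sup>2" using lens_radius[OF that] assms(5) by argo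
  qed fact
  then show ?thesis using assms dist_triangle2[of p x "midpoint a b"] by (smt (verit))
qed

text \<open>Each lens bounds the component of x - p along its line of centres by O(\<delta>^2). The
  two lines are transversal because the centres of one lens are at distance at least 1 from those of
  the other, so the two components control x - p.\<close>

lemma two_lenses:
  fixes a b c d p x :: "real \<times> real"
  assumes p: "dist p a < 1" "dist p b < 1" "dist p c < 1" "dist p d < 1"
    and x: "dist x a < 1" "dist x b < 1" "dist x c < 1" "dist x d < 1"
    and far: "dist a c \<ge> 1" "dist a d \<ge> 1" "dist b c \<ge> 1" "dist b d \<ge> 1"
    and ab: "4 * (1 - \<delta>\<^sup>2) \<le> (dist a b)\<^sup>2" and cd: "4 * (1 - \<delta>\<^sup>2) \<le> (dist c d)\<^sup>2"
    and \<delta>: "0 \<le> \<delta>" "\<delta> \<le> 1 / 6"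
  shows "dist p x \<le> 3 * \<delta>\<^sup>2"
proof -
  define w where "w = x - p"
  define P where "P = b - a"
  define Q where "Q = d - c"
  have \<delta>2: "\<delta>\<^sup>2 \<le> 1 / 36" using power_mono[OF \<delta>(2,1), of 2] by (simp add: power2_eq_square)
  have along: "\<bar>(x - p) \<bullet> (b - a)\<bar> \<le> 2 * \<delta>\<^sup>2"
    if "dist p a < 1" "dist p b < 1" "dist x a < 1" "dist x b < 1" "4 * (1 - \<delta>\<^sup>2) \<le> (dist a b)\<^sup>2" for a b
  proof -
    have "\<bar>(x - midpoint a b) \<bullet> (b - a)\<bar> \<le> \<delta>\<^sup>2"
      using lens_bounds[OF that(3,4)] that(5) zero_le_power2[of "dist x (midpoint a b)"] by argo
    moreover have "\<bar>(p - midpoint a b) \<bullet> (b - a)\<bar> \<le> \<delta>\<^sup>2"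
      using lens_bounds[OF that(1,2)] that(5) zero_le_power2[of "dist p (midpoint a b)"] by argo
    moreover have "(x - p) \<bullet> (b - a) = (x - midpoint a b) \<bullet> (b - a) - (p - midpoint a b) \<bullet> (b - a)"
      by (simp add: inner_diff_left)
    ultimately show ?thesis by linarith
  qed
  have wP: "\<bar>w \<bullet> P\<bar> \<le> 2 * \<delta>\<^sup>2" and wQ: "\<bar>w \<bullet> Q\<bar> \<le> 2 * \<delta>\<^sup>2"
    using along[of a b] along[of c d] p x ab cd by (simp_all add: w_def P_def Q_def)
  have sq1: "(dist u v)\<^sup>2 < 1" if "dist u v < 1" for u v :: "real \<times> real"
    using that by (simp add: abs_square_less_1)
  have sq2: "(dist u v)\<^sup>2 \<ge> 1" if "dist u v \<ge> 1" for u v :: "real \<times> real" using that by simp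
  have center: "norm (a + b - 2 *\<^sub>R p) \<le> 2 * \<delta>"
    if "dist p a < 1" "dist p b < 1" "4 * (1 - \<delta>\<^sup>2) \<le> (dist a b)\<^sup>2" for a b
  proof -
    have "dist p (midpoint a b) \<le> \<delta>"
    proof (rule power2_le_imp_le)
      show "(dist p (midpoint a b))\<^sup>2 \<le> \<delta>\<^sup>2" using lens_radius[OF that(1,2)] that(3) by argo
    qed fact
    moreover have "a + b - 2 *\<^sub>R p = 2 *\<^sub>R (midpoint a b - p)" by (simp add: midpoint_def algebra_simps)
    ultimately show ?thesis by (simp add: dist_norm norm_minus_commute)
  qed
  \<comment> \<open>An identity expresses the inner product by squared distances: four are below 1,
    two at least 1, and the offsets of the midpoints from p cost 4 \<delta>^2. Exchanging c and d
    later gives the bound from below.\<close>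
  have PQ_le: "(b - a) \<bullet> (d - c) \<le> 2 + 4 * \<delta>\<^sup>2"
    if p: "dist p a < 1" "dist p b < 1" "dist p c < 1" "dist p d < 1"
      and far: "dist a c \<ge> 1" "dist b d \<ge> 1"
      and ab: "4 * (1 - \<delta>\<^sup>2) \<le> (dist a b)\<^sup>2" and cd: "4 * (1 - \<delta>\<^sup>2) \<le> (dist c d)\<^sup>2" for a b c d
  proof -
    have id: "2 * ((b - a) \<bullet> (d - c)) = 2 * ((dist p a)\<^sup>2 + (dist p b)\<^sup>2 + (dist p c)\<^sup>2 + (dist p d)\<^sup>2)
      - 2 * ((a + b - 2 *\<^sub>R p) \<bullet> (c + d - 2 *\<^sub>R p)) - 2 * (dist a c)\<^sup>2 - 2 * (dist b d)\<^sup>2"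
      by (simp add: dist_norm power2_norm_eq_inner inner_diff_left inner_diff_right inner_add_left
          inner_add_right inner_commute algebra_simps)
    have "\<bar>(a + b - 2 *\<^sub>R p) \<bullet> (c + d - 2 *\<^sub>R p)\<bar> \<le> norm (a + b - 2 *\<^sub>R p) * norm (c + d - 2 *\<^sub>R p)"
      by (rule Cauchy_Schwarz_ineq2)
    also have "\<dots> \<le> (2 * \<delta>) * (2 * \<delta>)"
      by (intro mult_mono center p ab cd) (use \<delta> in auto)
    finally have "\<bar>(a + b - 2 *\<^sub>R p) \<bullet> (c + d - 2 *\<^sub>R p)\<bar> \<le> 4 * \<delta>\<^sup>2" by (simp add: power2_eq_square)
    then have "- ((a + b - 2 *\<^sub>R p) \<bullet> (c + d - 2 *\<^sub>R p)) \<le> 4 * \<delta>\<^sup>2" by (simp only: abs_le_iff)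
    then show ?thesis using id sq1[OF p(1)] sq1[OF p(2)] sq1[OF p(3)] sq1[OF p(4)] sq2[OF far(1)] sq2[OF far(2)]
      by argo
  qed
  have "P \<bullet> Q \<le> 2 + 4 * \<delta>\<^sup>2" unfolding P_def Q_def by (rule PQ_le) (use p far ab cd in auto)
  moreover have "P \<bullet> (- Q) \<le> 2 + 4 * \<delta>\<^sup>2"
    using PQ_le[of a b d c] p far ab cd by (simp add: P_def Q_def dist_commute)
  ultimately have "\<bar>P \<bullet> Q\<bar> \<le> 19 / 9" using \<delta>2 by (simp add: abs_le_iff)
  then have PQ: "(P \<bullet> Q)\<^sup>2 \<le> (19 / 9)\<^sup>2" by (metis abs_ge_zero power2_abs power_mono)
  have nP: "(norm P)\<^sup>2 = (dist a b)\<^sup>2" "(norm Q)\<^sup>2 = (dist c d)\<^sup>2"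
    by (simp_all add: P_def Q_def dist_norm norm_minus_commute)
  have P4: "35 / 9 \<le> (norm P)\<^sup>2" "35 / 9 \<le> (norm Q)\<^sup>2" using ab cd \<delta>2 unfolding nP by simp_all
  have P2: "norm P \<le> 2" "norm Q \<le> 2"
    using dist_triangle2[of a b p] dist_triangle2[of c d p] p
    by (simp_all add: P_def Q_def dist_norm norm_minus_commute)
  \<comment> \<open>Gram determinant identity in the plane. The determinant is at least (35/9)^2 -
    (19/9)^2 > 9 and the right side at most (8 \<delta>^2)^2, so the norm of w is at most 8/3
    \<delta>^2.\<close>
  have gram: "(norm w)\<^sup>2 * ((norm P)\<^sup>2 * (norm Q)\<^sup>2 - (P \<bullet> Q)\<^sup>2) = (norm ((w \<bullet> P) *\<^sub>R Q - (w \<bullet> Q) *\<^sub>R P))\<^sup>2"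
  proof -
    obtain w1 w2 p1 p2 q1 q2 where "w = (w1, w2)" "P = (p1, p2)" "Q = (q1, q2)" by (cases w, cases P, cases Q)
    then show ?thesis by (simp add: power2_norm_eq_inner) (simp add: algebra_simps power2_eq_square)
  qed
  have "norm ((w \<bullet> P) *\<^sub>R Q - (w \<bullet> Q) *\<^sub>R P) \<le> \<bar>w \<bullet> P\<bar> * norm Q + \<bar>w \<bullet> Q\<bar> * norm P"
    by (rule order_trans[OF norm_triangle_ineq4]) simp
  also have "\<dots> \<le> (2 * \<delta>\<^sup>2) * 2 + (2 * \<delta>\<^sup>2) * 2"
    by (intro add_mono mult_mono wP wQ P2) auto
  finally have "(norm ((w \<bullet> P) *\<^sub>R Q - (w \<bullet> Q) *\<^sub>R P))\<^sup>2 \<le> (8 * \<delta>\<^sup>2)\<^sup>2" by (intro power_mono) auto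
  moreover have "(norm w)\<^sup>2 * 9 \<le> (norm w)\<^sup>2 * ((norm P)\<^sup>2 * (norm Q)\<^sup>2 - (P \<bullet> Q)\<^sup>2)"
  proof (rule mult_left_mono)
    have "(35 / 9) * (35 / 9) \<le> (norm P)\<^sup>2 * (norm Q)\<^sup>2" by (intro mult_mono P4) auto
    then show "9 \<le> (norm P)\<^sup>2 * (norm Q)\<^sup>2 - (P \<bullet> Q)\<^sup>2" using PQ by (simp add: power2_eq_square)
  qed simp
  ultimately have "9 * (norm w)\<^sup>2 \<le> 64 * (\<delta>\<^sup>2)\<^sup>2" using gram by (simp add: power_mult_distrib)
  moreover have "(3 * \<delta>\<^sup>2)\<^sup>2 = 9 * (\<delta>\<^sup>2)\<^sup>2" by (simp add: power_mult_distrib)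
  ultimately have "(norm w)\<^sup>2 \<le> (3 * \<delta>\<^sup>2)\<^sup>2" using zero_le_power2[of "\<delta>\<^sup>2"] by linarith
  then have "norm w \<le> 3 * \<delta>\<^sup>2" by (rule power2_le_imp_le) simp
  then show ?thesis by (simp add: w_def dist_norm norm_minus_commute)
qed

section \<open>The gadget\<close>

text \<open>\<open>LA k\<close>, \<open>LB k\<close> and \<open>LC k\<close>, \<open>LD k\<close> are the centres of the vertical and the horizontal lens of
  step \<open>k\<close> around \<open>Ctr\<close>. The points \<open>ZL k\<close>, \<open>ZR k\<close>, \<open>ZT k\<close>, \<open>ZB k\<close> lie inside these lenses but outside
  the lenses of step \<open>k + 1\<close>; the disks \<open>Lf\<close>, \<open>Rt\<close>, \<open>Tp\<close>, \<open>Bt\<close> tell on which side of \<open>Ctr\<close> they are.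
  The bisectors of opposite corners \<open>NW\<close>, \<open>SE\<close> and \<open>NE\<close>, \<open>SW\<close> fix the cyclic order of the centres.\<close>

datatype role = Ctr | Lf | Rt | Tp | Bt | NW | NE | SW | SE
  | LA nat | LB nat | LC nat | LD nat | ZL nat | ZR nat | ZT nat | ZB nat

fun level :: "role \<Rightarrow> nat" where
  "level (LA k) = k" | "level (LB k) = k" | "level (LC k) = k" | "level (LD k) = k"
| "level (ZL k) = k" | "level (ZR k) = k" | "level (ZT k) = k" | "level (ZB k) = k"
| "level _ = 0"

text \<open>Lf, Rt, Tp, Bt are at distance exactly 1 from Ctr: adjacency is strict, so they miss Ctr
  but meet points moved slightly towards them. The lens of LA k and LB k reaches \<eta> k from Ctr
  along its line of centres.\<close>

fun pos :: "(nat \<Rightarrow> real) \<Rightarrow> role \<Rightarrow> real \<times> real" where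
  "pos \<eta> Ctr = (0, 0)"
| "pos \<eta> Lf = (- 1, 0)" | "pos \<eta> Rt = (1, 0)" | "pos \<eta> Tp = (0, 1)" | "pos \<eta> Bt = (0, - 1)"
| "pos \<eta> NW = (- (1 / 2), 1 / 2)" | "pos \<eta> NE = (1 / 2, 1 / 2)"
| "pos \<eta> SW = (- (1 / 2), - (1 / 2))" | "pos \<eta> SE = (1 / 2, - (1 / 2))"
| "pos \<eta> (LA k) = (0, 1 - \<eta> k)" | "pos \<eta> (LB k) = (0, \<eta> k - 1)"
| "pos \<eta> (LC k) = (\<eta> k - 1, 0)" | "pos \<eta> (LD k) = (1 - \<eta> k, 0)"
| "pos \<eta> (ZL k) = (- \<eta> k / 2, 0)" | "pos \<eta> (ZR k) = (\<eta> k / 2, 0)"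
| "pos \<eta> (ZT k) = (0, \<eta> k / 2)" | "pos \<eta> (ZB k) = (0, - \<eta> k / 2)"

definition adj :: "(nat \<Rightarrow> real) \<Rightarrow> role \<Rightarrow> role \<Rightarrow> bool" where
  "adj \<eta> u v \<longleftrightarrow> dist (pos \<eta> u) (pos \<eta> v) < 1"

lemma adj_iff:
  "adj \<eta> u v \<longleftrightarrow> (fst (pos \<eta> u) - fst (pos \<eta> v))\<^sup>2 + (snd (pos \<eta> u) - snd (pos \<eta> v))\<^sup>2 < 1"
  by (cases "pos \<eta> u"; cases "pos \<eta> v") (simp add: adj_def dist_Pair_Pair dist_real_def)

text \<open>The recursion is chosen so that (\<eta> k / 2)^2 = 2 * \<eta> (Suc k): ZL k and ZR k
  then have squared distance 1 + (\<eta> (Suc k))^2 from LA (Suc k) and LB (Suc k), just outside the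
  next lens, and likewise for ZT k and ZB k.\<close>

locale gadget =
  fixes \<eta> :: "nat \<Rightarrow> real"
  assumes eta_pos: "0 < \<eta> k" and eta_le: "\<eta> k \<le> 1 / 8" and eta_Suc: "\<eta> (Suc k) = (\<eta> k)\<^sup>2 / 8"
begin

lemma eta_sq: "\<eta> k * \<eta> k \<le> \<eta> k / 8" "0 \<le> \<eta> k * \<eta> k"
  using mult_left_mono[OF eta_le[of k], of "\<eta> k"] eta_pos[of k] by auto

lemma adj_centre:
  "adj \<eta> Ctr (LA k)" "adj \<eta> Ctr (LB k)" "adj \<eta> Ctr (LC k)" "adj \<eta> Ctr (LD k)"
  "\<not> adj \<eta> Ctr Lf" "\<not> adj \<eta> Ctr Rt" "\<not> adj \<eta> Ctr Tp" "\<not> adj \<eta> Ctr Bt"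
  by (simp_all add: adj_iff power2_eq_square algebra_simps)
    ((insert eta_sq[of k] eta_pos[of k] eta_le[of k], (linarith | argo))+)

lemma not_adj_outer:
  "\<not> adj \<eta> (LA k) (LB k)" "\<not> adj \<eta> (LA k) Lf" "\<not> adj \<eta> (LA k) Rt" "\<not> adj \<eta> (LB k) Lf" "\<not> adj \<eta> (LB k) Rt"
  "\<not> adj \<eta> (LC k) (LD k)" "\<not> adj \<eta> (LC k) Tp" "\<not> adj \<eta> (LC k) Bt" "\<not> adj \<eta> (LD k) Tp" "\<not> adj \<eta> (LD k) Bt"
  "\<not> adj \<eta> (LA k) (LC k)" "\<not> adj \<eta> (LA k) (LD k)" "\<not> adj \<eta> (LB k) (LC k)" "\<not> adj \<eta> (LB k) (LD k)"
  "\<not> adj \<eta> Lf Rt" "\<not> adj \<eta> Tp Bt"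
  by (simp_all add: adj_iff power2_eq_square algebra_simps)
    ((insert eta_sq[of k] eta_pos[of k] eta_le[of k], (linarith | argo))+)

lemma adj_corner:
  "adj \<eta> (LA k) NW" "adj \<eta> Lf NW" "adj \<eta> (LC k) NW" "adj \<eta> Tp NW"
  "\<not> adj \<eta> (LB k) NW" "\<not> adj \<eta> Rt NW" "\<not> adj \<eta> (LD k) NW" "\<not> adj \<eta> Bt NW"
  "adj \<eta> (LA k) NE" "adj \<eta> Rt NE" "adj \<eta> (LD k) NE" "adj \<eta> Tp NE"
  "\<not> adj \<eta> (LB k) NE" "\<not> adj \<eta> Lf NE" "\<not> adj \<eta> (LC k) NE" "\<not> adj \<eta> Bt NE"
  "adj \<eta> (LB k) SW" "adj \<eta> Lf SW" "adj \<eta> (LC k) SW" "adj \<eta> Bt SW"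
  "\<not> adj \<eta> (LA k) SW" "\<not> adj \<eta> Rt SW" "\<not> adj \<eta> (LD k) SW" "\<not> adj \<eta> Tp SW"
  "adj \<eta> (LB k) SE" "adj \<eta> Rt SE" "adj \<eta> (LD k) SE" "adj \<eta> Bt SE"
  "\<not> adj \<eta> (LA k) SE" "\<not> adj \<eta> Lf SE" "\<not> adj \<eta> (LC k) SE" "\<not> adj \<eta> Tp SE"
  by (simp_all add: adj_iff power2_eq_square algebra_simps)
    ((insert eta_sq[of k] eta_pos[of k] eta_le[of k], (linarith | argo))+)

lemma adj_inner:
  "adj \<eta> (ZL k) (LA k)" "adj \<eta> (ZL k) (LB k)" "adj \<eta> (ZL k) (LC k)" "adj \<eta> (ZL k) (LD k)"
  "adj \<eta> (ZR k) (LA k)" "adj \<eta> (ZR k) (LB k)" "adj \<eta> (ZR k) (LC k)" "adj \<eta> (ZR k) (LD k)"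
  "adj \<eta> (ZT k) (LA k)" "adj \<eta> (ZT k) (LB k)" "adj \<eta> (ZT k) (LC k)" "adj \<eta> (ZT k) (LD k)"
  "adj \<eta> (ZB k) (LA k)" "adj \<eta> (ZB k) (LB k)" "adj \<eta> (ZB k) (LC k)" "adj \<eta> (ZB k) (LD k)"
  "adj \<eta> (ZL k) Lf" "adj \<eta> (ZR k) Rt" "adj \<eta> (ZT k) Tp" "adj \<eta> (ZB k) Bt"
  by (simp_all add: adj_iff power2_eq_square algebra_simps)
    ((insert eta_sq[of k] eta_pos[of k] eta_le[of k], (linarith | argo))+)

lemma not_adj_next:
  "\<not> adj \<eta> (ZL k) (LA (Suc k))" "\<not> adj \<eta> (ZL k) (LB (Suc k))"
  "\<not> adj \<eta> (ZR k) (LA (Suc k))" "\<not> adj \<eta> (ZR k) (LB (Suc k))"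
  "\<not> adj \<eta> (ZT k) (LC (Suc k))" "\<not> adj \<eta> (ZT k) (LD (Suc k))"
  "\<not> adj \<eta> (ZB k) (LC (Suc k))" "\<not> adj \<eta> (ZB k) (LD (Suc k))"
  by (simp_all add: adj_iff power2_eq_square algebra_simps)
    ((insert eta_sq(2)[of "Suc k"] eta_Suc[of k, unfolded power2_eq_square], (linarith | argo))+)

text \<open>The solution of \<delta> -> 3 \<delta>^2 from \<open>two_lenses\<close> with initial
  value 1/6 = 2 * (1/12), the diameter of a lens of parameter 1/12.\<close>

definition shrink :: "nat \<Rightarrow> real" where
  "shrink k = 1 / 3 * (1 / 2) ^ 2 ^ k"

lemma shrink_Suc: "3 * (shrink k)\<^sup>2 = shrink (Suc k)"
proof -
  have "(1 / 2 :: real) ^ 2 ^ Suc k = ((1 / 2) ^ 2 ^ k)\<^sup>2" by (simp only: power_Suc2 power_mult)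
  then show ?thesis unfolding shrink_def power2_eq_square by simp
qed

lemma shrink_bounds: "0 \<le> shrink k" "shrink k \<le> 1 / 6"
proof -
  have "(1 / 2 :: real) ^ 2 ^ k \<le> (1 / 2) ^ 1" by (rule power_decreasing) auto
  then show "shrink k \<le> 1 / 6" by (simp add: shrink_def)
qed (simp add: shrink_def)

text \<open>c is an arbitrary configuration with the adjacencies of the gadget. The Z points of step
  k lie outside the lenses of step k + 1 on both sides and make them thin; these lenses in turn
  contain the Z points of step k + 1. \<open>init\<close> starts the induction.\<close>

lemma forces_shrinking:
  fixes c :: "role \<Rightarrow> real \<times> real"
  assumes agree: "\<And>u v. level u \<le> K \<Longrightarrow> level v \<le> K \<Longrightarrow> u \<noteq> v \<Longrightarrow> dist (c u) (c v) < 1 \<longleftrightarrow> adj \<eta> u v"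
    and init: "4 * (1 - (1 / 12)\<^sup>2) \<le> (dist (c (LA 0)) (c (LB 0)))\<^sup>2"
    and "k \<le> K"
  shows "z \<in> {ZL k, ZR k, ZT k, ZB k} \<Longrightarrow> dist (c Ctr) (c z) \<le> shrink k"
  using \<open>k \<le> K\<close>
proof (induction k arbitrary: z)
  case 0
  have near: "dist (c u) (c v) < 1" if "level u \<le> K" "level v \<le> K" "u \<noteq> v" "adj \<eta> u v" for u v
    using agree that by blast
  have "dist (c Ctr) (c z) < 2 * (1 / 12)"
    using 0 by (intro lens_diameter[OF _ _ _ _ init]) (auto intro!: near simp: adj_centre adj_inner)
  then show ?case by (simp add: shrink_def)
next
  case (Suc k)
  have near: "dist (c u) (c v) < 1" if "level u \<le> K" "level v \<le> K" "u \<noteq> v" "adj \<eta> u v" for u v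
    using agree that by blast
  have far: "1 \<le> dist (c u) (c v)" if "level u \<le> K" "level v \<le> K" "u \<noteq> v" "\<not> adj \<eta> u v" for u v
    using agree[OF that(1-3)] that(4) by simp
  note facts = adj_centre not_adj_outer adj_corner adj_inner not_adj_next
  have k: "Suc k \<le> K" "k \<le> K" using Suc.prems(2) by auto
  have IH: "dist (c Ctr) (c (ZL k)) \<le> shrink k" "dist (c Ctr) (c (ZR k)) \<le> shrink k"
    "dist (c Ctr) (c (ZT k)) \<le> shrink k" "dist (c Ctr) (c (ZB k)) \<le> shrink k"
    using Suc.IH k by auto
  \<comment> \<open>Each corner meets one lens centre and one side disk. For the horizontal lens
    below, NE and SW exchange their roles.\<close>
  have AB: "4 * (1 - (shrink k)\<^sup>2) \<le> (dist (c (LA (Suc k))) (c (LB (Suc k))))\<^sup>2"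
    by (rule lens_thin[of "c Ctr" _ _ "c Lf" "c Rt" "c (ZL k)" "c (ZR k)" "c NW" "c SE" "c NE" "c SW"])
      (use k IH shrink_bounds in \<open>auto intro!: near far simp: facts\<close>)
  have CD: "4 * (1 - (shrink k)\<^sup>2) \<le> (dist (c (LC (Suc k))) (c (LD (Suc k))))\<^sup>2"
    by (rule lens_thin[of "c Ctr" _ _ "c Tp" "c Bt" "c (ZT k)" "c (ZB k)" "c NW" "c SE" "c SW" "c NE"])
      (use k IH shrink_bounds in \<open>auto intro!: near far simp: facts\<close>)
  have "dist (c Ctr) (c z) \<le> 3 * (shrink k)\<^sup>2"
    by (rule two_lenses[OF _ _ _ _ _ _ _ _ _ _ _ _ AB CD shrink_bounds])
      (use k Suc.prems(1) in \<open>auto intro!: near far simp: facts\<close>)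
  then show ?case by (simp add: shrink_Suc)
qed

end

section \<open>Pigeonhole arguments for the first lens\<close>

lemma three_in_fibre:
  fixes A :: "nat set"
  assumes "finite A" "finite B" "f ` A \<subseteq> B" "2 * card B < card A"
  shows "\<exists>i\<in>A. \<exists>j\<in>A. \<exists>k\<in>A. i < j \<and> j < k \<and> f i = f j \<and> f j = f k"
proof -
  define F where "F b = {a \<in> A. f a = b}" for b
  have "\<exists>b\<in>B. card (F b) > 2"
  proof (rule ccontr)
    assume "\<not> ?thesis"
    then have "(\<Sum>b\<in>B. card (F b)) \<le> (\<Sum>b\<in>B. 2)" by (intro sum_mono) auto
    moreover have "card A \<le> (\<Sum>b\<in>B. card (F b))"
    proof -
      have "A = (\<Union>b\<in>B. F b)" using assms(3) by (auto simp: F_def)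
      then show ?thesis using card_UN_le[OF assms(2), of F] by simp
    qed
    ultimately show False using assms(4) by simp
  qed
  then obtain b where b: "card (F b) > 2" by blast
  have fin: "finite (F b)" using assms(1) by (simp add: F_def)
  have ne: "F b \<noteq> {}" using b by auto
  \<comment> \<open>The order of the triple matters for the copies, so the middle index is any one
    strictly between minimum and maximum.\<close>
  have "card (F b - {Min (F b), Max (F b)}) > 0"
    using b card_Diff_subset[of "{Min (F b), Max (F b)}" "F b"] diff_card_le_card_Diff[of "{Min (F b), Max (F b)}" "F b"]
      card_insert_le_m1[of 2 "{Max (F b)}" "Min (F b)"] by fastforce
  then obtain j where j: "j \<in> F b" "j \<noteq> Min (F b)" "j \<noteq> Max (F b)"
    by (metis Diff_iff card_gt_0_iff ex_in_conv insertCI)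
  have "Min (F b) < j" "j < Max (F b)"
    using j Min_le[OF fin j(1)] Max_ge[OF fin j(1)] by auto
  moreover have "Min (F b) \<in> F b" "Max (F b) \<in> F b" using fin ne by auto
  ultimately show ?thesis using j(1) unfolding F_def by (metis (mono_tags, lifting) mem_Collect_eq)
qed

text \<open>Cells of side 1/20 have diagonal below 1/12. The indices -20 to 20 give 41^2 = 1681
  cells, and 3363 = 2 * 1681 + 1.\<close>

lemma three_close_points:
  fixes q :: "nat \<Rightarrow> real \<times> real"
  assumes "\<And>j. j < N \<Longrightarrow> dist (q 0) (q j) < 1" "3363 \<le> N"
  shows "\<exists>i j k. i < j \<and> j < k \<and> k < N \<and> dist (q j) (q i) \<le> 1 / 12 \<and> dist (q j) (q k) \<le> 1 / 12"
proof -
  define f where "f j = (\<lfloor>20 * (fst (q j) - fst (q 0))\<rfloor>, \<lfloor>20 * (snd (q j) - snd (q 0))\<rfloor>)" for j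
  have "f ` {..<N} \<subseteq> {-20..20} \<times> {-20..20}"
  proof
    fix y assume "y \<in> f ` {..<N}"
    then obtain j where j: "j < N" "y = f j" by auto
    have "\<bar>fst (q j) - fst (q 0)\<bar> < 1" "\<bar>snd (q j) - snd (q 0)\<bar> < 1"
      using dist_fst_le[of "q j" "q 0"] dist_snd_le[of "q j" "q 0"] assms(1)[OF j(1)]
      by (auto simp: dist_real_def dist_commute)
    then show "y \<in> {-20..20} \<times> {-20..20}" unfolding j(2) f_def
      by (auto simp: abs_less_iff le_floor_iff floor_le_iff)
  qed
  then obtain i j k where ijk: "k < N" "i < j" "j < k" "f i = f j" "f j = f k"
    using three_in_fibre[of "{..<N}" "{-20..20} \<times> {-20..20}" f] assms(2)
    by (auto simp: card_cartesian_product)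
  have close: "dist (q u) (q v) \<le> 1 / 12" if "f u = f v" for u v
  proof -
    have "\<bar>x - y\<bar> \<le> 1 / 20" if "\<lfloor>20 * (x - z)\<rfloor> = \<lfloor>20 * (y - z)\<rfloor>" for x y z :: real
    proof -
      have "20 * (x - z) - 20 * (y - z) < 1" "20 * (y - z) - 20 * (x - z) < 1"
        using floor_correct[of "20 * (x - z)"] floor_correct[of "20 * (y - z)"] that by linarith+
      then have "x - y \<le> 1 / 20" "- (x - y) \<le> 1 / 20" by (simp_all add: algebra_simps)
      then show ?thesis by (simp only: abs_le_iff)
    qed
    then have "\<bar>fst (q u) - fst (q v)\<bar> \<le> 1 / 20" "\<bar>snd (q u) - snd (q v)\<bar> \<le> 1 / 20"
      using that by (auto simp: f_def)
    then have "(fst (q u) - fst (q v))\<^sup>2 \<le> (1 / 20)\<^sup>2" "(snd (q u) - snd (q v))\<^sup>2 \<le> (1 / 20)\<^sup>2"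
      by (metis abs_ge_zero power2_abs power_mono)+
    then have "(fst (q u) - fst (q v))\<^sup>2 + (snd (q u) - snd (q v))\<^sup>2 \<le> (1 / 12)\<^sup>2"
      by (simp add: power2_eq_square)
    then have "sqrt ((fst (q u) - fst (q v))\<^sup>2 + (snd (q u) - snd (q v))\<^sup>2) \<le> 1 / 12"
      by (intro real_le_lsqrt) auto
    then show ?thesis by (simp add: dist_prod_def dist_real_def)
  qed
  then show ?thesis using ijk by metis
qed

section \<open>The lower bound\<close>

fun eta :: "real \<Rightarrow> nat \<Rightarrow> real" where
  "eta e 0 = e"
| "eta e (Suc k) = (eta e k)\<^sup>2 / 8"

lemma gadget_eta:
  assumes "0 < e" "e \<le> 1 / 8"
  shows "gadget (eta e)"
proof
  fix k
  have "0 < eta e k \<and> eta e k \<le> 1 / 8"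
  proof (induction k)
    case (Suc k)
    then have "(eta e k)\<^sup>2 \<le> 1\<^sup>2" by (intro power_mono) auto
    then show ?case using Suc by simp
  qed (use assms in auto)
  then show "0 < eta e k" "eta e k \<le> 1 / 8" by auto
qed simp

definition roles :: "nat \<Rightarrow> role set" where
  "roles K = {u. level u \<le> K}"

lemma finite_roles: "finite (roles K)" and card_roles: "card (roles K) \<le> 8 * K + 17"
proof -
  let ?xs = "[Ctr, Lf, Rt, Tp, Bt, NW, NE, SW, SE] @ map LA [0..<Suc K] @ map LB [0..<Suc K] @ map LC [0..<Suc K]
    @ map LD [0..<Suc K] @ map ZL [0..<Suc K] @ map ZR [0..<Suc K] @ map ZT [0..<Suc K] @ map ZB [0..<Suc K]"
  have "u \<in> set ?xs" if "level u \<le> K" for u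
    using that by (cases u) (auto simp del: upt_Suc)
  then have sub: "roles K \<subseteq> set ?xs" unfolding roles_def by blast
  then show "finite (roles K)" by (rule finite_subset) simp
  have "card (roles K) \<le> card (set ?xs)" by (rule card_mono[OF _ sub]) simp
  also have "\<dots> \<le> length ?xs" by (rule card_length)
  finally show "card (roles K) \<le> 8 * K + 17" by simp
qed

text \<open>Translated copies of the gadget along a line: three of \<open>2 * 41\<^sup>2 + 1\<close> points in a unit disk
  are within 1/12 of each other, so in some copy the lens of step 0 is already small.\<close>

definition copies :: nat where "copies = 3363"

definition spacing :: real where "spacing = 1 / real copies"

text \<open>The initial value e = spacing^2 / 2 satisfies spacing^2 + (1 - e)^2 \<ge> 1, so the
  centre of any other copy lies outside both disks of the first lens. As copies * spacing = 1, the
  centres of all copies remain mutually adjacent.\<close>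

definition place :: "nat \<times> role \<Rightarrow> plane" where
  "place x = pos (eta (spacing\<^sup>2 / 2)) (snd x) + (real (fst x) * spacing, 0)"

lemma spacing: "0 < spacing" "spacing \<le> 1" "real copies * spacing = 1"
  by (simp_all add: spacing_def copies_def)

lemma spacing_sq: "0 < spacing\<^sup>2 / 2" "spacing\<^sup>2 / 2 \<le> 1 / 8"
  by (simp_all add: spacing_def copies_def power2_eq_square)

interpretation G: gadget "eta (spacing\<^sup>2 / 2)"
  by (rule gadget_eta[OF spacing_sq])

lemma dist_place_same: "dist (place (j, u)) (place (j, v)) < 1 \<longleftrightarrow> adj (eta (spacing\<^sup>2 / 2)) u v"
  by (simp add: place_def adj_def)

lemma dist_place_less_1:
  "dist (place x) (place y) < 1 \<longleftrightarrow> (fst (place x) - fst (place y))\<^sup>2 + (snd (place x) - snd (place y))\<^sup>2 < 1"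
  by (simp add: dist_prod_def dist_real_def)

text \<open>Seen from one copy, the Ctr of an earlier copy acts as a ZL, and that of a later copy as
  a ZR, of a step preceding step 0.\<close>

lemma dist_place_Ctr:
  assumes "i < j" "j < copies"
  shows "dist (place (i, Ctr)) (place (j, Ctr)) < 1"
    "dist (place (i, Ctr)) (place (j, Lf)) < 1" "dist (place (j, Ctr)) (place (i, Rt)) < 1"
    "1 \<le> dist (place (i, Ctr)) (place (j, LA 0))" "1 \<le> dist (place (i, Ctr)) (place (j, LB 0))"
    "1 \<le> dist (place (j, Ctr)) (place (i, LA 0))" "1 \<le> dist (place (j, Ctr)) (place (i, LB 0))"
proof -
  define t where "t = real j * spacing - real i * spacing"
  have t: "t = real (j - i) * spacing" using assms(1) by (simp add: t_def of_nat_diff left_diff_distrib)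
  have "1 \<le> real (j - i)" using assms(1) by linarith
  then have t_ge: "spacing \<le> t" unfolding t using mult_right_mono[of 1 "real (j - i)" spacing] spacing(1) by simp
  have "real (j - i) < real copies" using assms by linarith
  then have t_lt: "t < 1" unfolding t using spacing mult_strict_right_mono[of "real (j - i)" "real copies" spacing] by simp
  have t_pos: "0 < t" using t_ge spacing(1) by linarith
  have sq: "spacing\<^sup>2 \<le> t\<^sup>2" using t_ge spacing(1) by (intro power_mono) auto
  have sq1: "t\<^sup>2 < 1" using t_lt t_pos by (simp add: abs_square_less_1)
  have one: "(1 - t)\<^sup>2 < 1" using t_lt t_pos by (simp add: abs_square_less_1)
  define e where "e = spacing\<^sup>2 / 2"
  have "(1 - e)\<^sup>2 = 1 - spacing\<^sup>2 + e\<^sup>2" by (simp add: power2_diff e_def)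
  then have out: "1 \<le> t\<^sup>2 + (1 - e)\<^sup>2" using sq zero_le_power2[of e] by linarith
  have tm: "(real i * spacing - real j * spacing)\<^sup>2 = t\<^sup>2" "(real j * spacing - real i * spacing)\<^sup>2 = t\<^sup>2"
    by (simp_all add: t_def power2_commute)
  show "dist (place (i, Ctr)) (place (j, Ctr)) < 1"
    unfolding dist_place_less_1 using sq1 tm by (simp add: place_def)
  have "real i * spacing - (real j * spacing - 1) = 1 - t" "real j * spacing - (1 + real i * spacing) = t - 1"
    by (simp_all add: t_def)
  then have "(real i * spacing - (real j * spacing - 1))\<^sup>2 < 1" "(real j * spacing - (1 + real i * spacing))\<^sup>2 < 1"
    using one by (simp_all only: power2_commute[of t 1])
  then show "dist (place (i, Ctr)) (place (j, Lf)) < 1" "dist (place (j, Ctr)) (place (i, Rt)) < 1"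
    unfolding dist_place_less_1 by (simp_all add: place_def)
  have em: "(e - 1)\<^sup>2 = (1 - e)\<^sup>2" by (simp add: power2_commute)
  show "1 \<le> dist (place (i, Ctr)) (place (j, LA 0))" "1 \<le> dist (place (i, Ctr)) (place (j, LB 0))"
    "1 \<le> dist (place (j, Ctr)) (place (i, LA 0))" "1 \<le> dist (place (j, Ctr)) (place (i, LB 0))"
    unfolding not_less[symmetric] dist_place_less_1 using out tm em
    by (simp_all add: place_def e_def[symmetric] del: minus_diff_eq)
qed

text \<open>The middle one of three close copies satisfies \<open>init\<close>, with its two
  neighbours as the points z1 and z2 of \<open>lens_thin\<close>. Which copy it is depends on c, so
  every copy carries all levels up to K.\<close>

lemma copies_force_shrinking:
  fixes c :: "nat \<times> role \<Rightarrow> plane"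
  assumes agree: "\<And>x y. x \<in> {..<copies} \<times> roles K \<Longrightarrow> y \<in> {..<copies} \<times> roles K \<Longrightarrow> x \<noteq> y \<Longrightarrow>
    dist (c x) (c y) < 1 \<longleftrightarrow> dist (place x) (place y) < 1"
  shows "\<exists>j<copies. dist (c (j, Ctr)) (c (j, ZL K)) \<le> G.shrink K"
proof -
  have roles: "u \<in> roles K" if "level u = 0" for u using that by (simp add: roles_def)
  have near: "dist (c (i, u)) (c (j, v)) < 1"
    if "i < copies" "j < copies" "level u = 0" "level v = 0" "(i, u) \<noteq> (j, v)" "dist (place (i, u)) (place (j, v)) < 1" for i j u v
    using agree[of "(i, u)" "(j, v)"] that roles by simp
  have far: "1 \<le> dist (c (i, u)) (c (j, v))"
    if "i < copies" "j < copies" "level u = 0" "level v = 0" "(i, u) \<noteq> (j, v)" "1 \<le> dist (place (i, u)) (place (j, v))" for i j u v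
    using agree[of "(i, u)" "(j, v)"] that roles by simp
  have "dist (c (0, Ctr)) (c (j, Ctr)) < 1" if "j < copies" for j
    using that near[of 0 j Ctr Ctr] dist_place_Ctr(1)[of 0 j] by (cases "j = 0") (auto simp: copies_def)
  then obtain i j k where ijk: "i < j" "j < k" "k < copies"
    and close: "dist (c (j, Ctr)) (c (i, Ctr)) \<le> 1 / 12" "dist (c (j, Ctr)) (c (k, Ctr)) \<le> 1 / 12"
    using three_close_points[of copies "\<lambda>j. c (j, Ctr)"] by (auto simp: copies_def)
  have agree_j: "dist (c (j, u)) (c (j, v)) < 1 \<longleftrightarrow> adj (eta (spacing\<^sup>2 / 2)) u v"
    if "level u \<le> K" "level v \<le> K" "u \<noteq> v" for u v
    using agree[of "(j, u)" "(j, v)"] that ijk by (simp add: roles_def dist_place_same)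
  note adj = G.adj_centre G.not_adj_outer G.adj_corner
  have "4 * (1 - (1 / 12)\<^sup>2) \<le> (dist (c (j, LA 0)) (c (j, LB 0)))\<^sup>2"
  proof (rule lens_thin[of "c (j, Ctr)" _ _ "c (j, Lf)" "c (j, Rt)" "c (i, Ctr)" "c (k, Ctr)"
      "c (j, NW)" "c (j, SE)" "c (j, NE)" "c (j, SW)"])
    show "1 \<le> dist (c (i, Ctr)) (c (j, LA 0))" "1 \<le> dist (c (i, Ctr)) (c (j, LB 0))"
      using ijk by (auto intro!: far dist_place_Ctr(4,5))
    show "1 \<le> dist (c (k, Ctr)) (c (j, LA 0))" "1 \<le> dist (c (k, Ctr)) (c (j, LB 0))"
      using ijk by (auto intro!: far dist_place_Ctr(6,7))
    show "dist (c (i, Ctr)) (c (j, Lf)) < 1" using ijk by (auto intro!: near dist_place_Ctr(2))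
    show "dist (c (k, Ctr)) (c (j, Rt)) < 1" using ijk by (auto intro!: near dist_place_Ctr(3))
  qed (use close in \<open>simp_all add: agree_j adj not_less[symmetric]\<close>)
  from G.forces_shrinking[where K = K and k = K and c = "\<lambda>u. c (j, u)" and z = "ZL K", OF agree_j this]
  show ?thesis using ijk by (intro exI[of _ j]) simp
qed

section \<open>From integer centres to the grid size\<close>

lemma integer_dist_ge_1:
  fixes a b :: plane
  assumes "a \<in> \<int> \<times> \<int>" "b \<in> \<int> \<times> \<int>" "a \<noteq> b"
  shows "1 \<le> dist a b"
proof -
  have int: "1 \<le> \<bar>x - y\<bar>" if "x \<in> \<int>" "y \<in> \<int>" "x \<noteq> y" for x y :: real
    using that by (metis Ints_diff Ints_nonzero_abs_ge1 right_minus_eq)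
  have "fst a \<noteq> fst b \<or> snd a \<noteq> snd b" using assms(3) by (simp add: prod_eq_iff)
  then show ?thesis
    using int[of "fst a" "fst b"] int[of "snd a" "snd b"] assms(1,2) dist_fst_le[of a b] dist_snd_le[of a b]
    by (auto simp: mem_Times_iff dist_real_def)
qed

text \<open>A box containing a disk has at least its width. Finiteness of V provides some box, so
  that the LEAST in \<open>grid_size\<close> is attained.\<close>

lemma radius_le_grid_size:
  assumes "finite V" "v \<in> V" "\<And>v. v \<in> V \<Longrightarrow> A v = ball (c v :: plane) r"
  shows "r \<le> real (grid_size (A ` V))"
proof -
  define S where "S = (\<Sum>v\<in>V. \<bar>fst (c v)\<bar> + \<bar>snd (c v)\<bar>) + \<bar>r\<bar>"
  obtain k0 :: nat where k0: "S \<le> real k0" using real_arch_simple by blast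
  have "A v \<subseteq> {- real k0 .. real k0} \<times> {- real k0 .. real k0}" if v: "v \<in> V" for v
  proof
    fix y assume "y \<in> A v"
    then have "dist (c v) y < r" using assms(3)[OF v] by simp
    then have "\<bar>fst (c v) - fst y\<bar> < r" "\<bar>snd (c v) - snd y\<bar> < r"
      using dist_fst_le[of "c v" y] dist_snd_le[of "c v" y] by (auto simp: dist_real_def)
    moreover have "\<bar>fst (c v)\<bar> + \<bar>snd (c v)\<bar> \<le> (\<Sum>v\<in>V. \<bar>fst (c v)\<bar> + \<bar>snd (c v)\<bar>)"
      by (rule member_le_sum[OF v]) (use assms(1) in auto)
    ultimately have "\<bar>fst y\<bar> \<le> real k0" "\<bar>snd y\<bar> \<le> real k0" using k0 unfolding S_def by linarith+
    then show "y \<in> {- real k0 .. real k0} \<times> {- real k0 .. real k0}" by (cases y) (auto simp: abs_le_iff)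
  qed
  then have "\<exists>k. \<forall>D\<in>A ` V. D \<subseteq> {- real k .. real k} \<times> {- real k .. real k}" by blast
  from LeastI_ex[OF this]
  have box: "A v \<subseteq> {- real (grid_size (A ` V)) .. real (grid_size (A ` V))} \<times> {- real (grid_size (A ` V)) .. real (grid_size (A ` V))}"
    using assms(2) unfolding grid_size_def by blast
  show ?thesis
  proof (rule dense_le)
    fix t assume "t < r"
    show "t \<le> real (grid_size (A ` V))"
    proof (cases "t < 0")
      case False
      have "c v + (t, 0) \<in> A v" "c v - (t, 0) \<in> A v"
        using False \<open>t < r\<close> assms(2,3) by (simp_all add: dist_norm norm_Pair)
      then have "fst (c v + (t, 0)) \<le> real (grid_size (A ` V))" "- real (grid_size (A ` V)) \<le> fst (c v - (t, 0))"
        using subsetD[OF box, of "c v + (t, 0)"] subsetD[OF box, of "c v - (t, 0)"] by (simp_all add: mem_Times_iff)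
      then show ?thesis by simp
    qed simp
  qed
qed

lemma f_UDG_ge_double_exponential:
  assumes n: "copies * (8 * K + 17) \<le> n"
  shows "2 ^ 2 ^ K \<le> real (f_UDG n)"
proof -
  define V where "V = {..<copies} \<times> roles K"
  have finV: "finite V" by (simp add: V_def finite_roles)
  have "card V \<le> card {..<n}"
    using le_trans[OF mult_le_mono2[OF card_roles[of K], of copies] n]
    by (simp only: V_def card_cartesian_product card_lessThan)
  then obtain \<iota> where \<iota>: "\<iota> ` V \<subseteq> {..<n}" "inj_on \<iota> V"
    using card_le_inj[OF finV finite_lessThan[of n]] by blast
  \<comment> \<open>Surplus vertices are placed on the Ctr of copy 0; the comparison
    \<open>agree\<close> below concerns V alone.\<close>
  define \<psi> where "\<psi> i = (if i \<in> \<iota> ` V then inv_into V \<iota> i else (0, Ctr))" for i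
  have \<psi>\<iota>: "\<psi> (\<iota> x) = x" if "x \<in> V" for x using that \<iota>(2) by (simp add: \<psi>_def)
  have inV: "(0, Ctr) \<in> V" by (simp add: V_def roles_def copies_def)
  have "n \<ge> 1" using n by (simp add: copies_def)
  define A where "A i = ball (place (\<psi> i)) (1 / 2)" for i :: nat
  define G where "G = intersection_graph {..<n} A"
  have fstG: "fst G = {..<n}" by (simp add: G_def intersection_graph_def)
  have real: "realizes A G" by (simp add: G_def realizes_def intersection_graph_def)
  then have "unit_disk_graph G"
    unfolding unit_disk_graph_def using fstG
    by (intro conjI exI[of _ A] exI[of _ "\<lambda>i. place (\<psi> i)"] exI[of _ "1 / 2"]) (auto simp: A_def)
  then have GU: "G \<in> UDG n" using fstG by (simp add: UDG_def)
  have rep: "threshold_rep G (\<lambda>i. place (\<psi> i)) 1"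
    using realizes_balls_iff[of "1 / 2" G A "\<lambda>i. place (\<psi> i)"] real by (simp add: A_def)
  \<comment> \<open>From \<open>bounded_margin\<close> only the existence of an integer realization
    is taken; it makes the LEAST in \<open>f_graph\<close> attained.\<close>
  obtain B where B: "integer_realization B G" "f_graph G = grid_size (B ` fst G)"
    using bounded_margin[OF GU \<open>n \<ge> 1\<close>] f_graph_attained by blast
  from integer_realization_threshold_rep[OF B(1)]
  obtain c r where r: "r > 0" and cB: "\<forall>v\<in>fst G. c v \<in> \<int> \<times> \<int> \<and> B v = ball (c v) r"
    and Brep: "threshold_rep G c (2 * r)"
    by (elim exE conjE)
  have c_int: "c v \<in> \<int> \<times> \<int>" and Bc: "B v = ball (c v) r" if "v \<in> fst G" for v
    using cB that by blast+
  \<comment> \<open>Rescaling by the diameter turns the threshold into 1, as in the gadget.\<close>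
  define c' where "c' x = inverse (2 * r) *\<^sub>R c (\<iota> x)" for x
  have dist_c': "dist (c' x) (c' y) = dist (c (\<iota> x)) (c (\<iota> y)) / (2 * r)" for x y
  proof -
    have "dist (c' x) (c' y) = norm (inverse (2 * r) *\<^sub>R (c (\<iota> x) - c (\<iota> y)))"
      by (simp only: c'_def dist_norm scaleR_diff_right)
    also have "\<dots> = \<bar>inverse (2 * r)\<bar> * dist (c (\<iota> x)) (c (\<iota> y))"
      by (simp only: norm_scaleR dist_norm)
    finally show ?thesis using r by (simp only: divide_inverse abs_of_pos positive_imp_inverse_positive
      zero_less_mult_iff zero_less_numeral mult.commute simp_thms)
  qed
  have agree: "dist (c' x) (c' y) < 1 \<longleftrightarrow> dist (place x) (place y) < 1"
    if "x \<in> {..<copies} \<times> roles K" "y \<in> {..<copies} \<times> roles K" "x \<noteq> y" for x y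
  proof -
    have xy: "x \<in> V" "y \<in> V" using that by (simp_all add: V_def)
    have mem: "\<iota> x \<in> fst G" "\<iota> y \<in> fst G" using xy \<iota>(1) fstG by auto
    have ne: "\<iota> x \<noteq> \<iota> y" using xy that(3) \<iota>(2) by (auto dest: inj_onD)
    have "dist (c' x) (c' y) < 1 \<longleftrightarrow> dist (c (\<iota> x)) (c (\<iota> y)) < 2 * r"
      using r by (simp add: dist_c')
    also have "\<dots> \<longleftrightarrow> {\<iota> x, \<iota> y} \<in> snd G" using Brep mem ne unfolding threshold_rep_def by blast
    also have "\<dots> \<longleftrightarrow> dist (place (\<psi> (\<iota> x))) (place (\<psi> (\<iota> y))) < 1"
      using rep mem ne unfolding threshold_rep_def by blast
    finally show ?thesis using \<psi>\<iota> xy by simp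
  qed
  obtain j where j: "j < copies" "dist (c' (j, Ctr)) (c' (j, ZL K)) \<le> G.shrink K"
    using copies_force_shrinking[of K c', OF agree] by blast
  have mem: "(j, Ctr) \<in> V" "(j, ZL K) \<in> V" "(j, Lf) \<in> V" using j(1) by (simp_all add: V_def roles_def)
  \<comment> \<open>Lf tells Ctr and ZL K apart, so their integer centres are distinct and at
    distance at least 1.\<close>
  have "\<not> dist (c' (j, Ctr)) (c' (j, Lf)) < 1" "dist (c' (j, ZL K)) (c' (j, Lf)) < 1"
    using agree[of "(j, Ctr)" "(j, Lf)"] agree[of "(j, ZL K)" "(j, Lf)"] mem[unfolded V_def]
      G.adj_centre G.adj_inner by (simp_all add: dist_place_same)
  then have "c (\<iota> (j, Ctr)) \<noteq> c (\<iota> (j, ZL K))" by (auto simp: c'_def)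
  then have "1 \<le> dist (c (\<iota> (j, Ctr))) (c (\<iota> (j, ZL K)))"
    using mem \<iota>(1) fstG by (intro integer_dist_ge_1 c_int) auto
  then have "1 / (2 * r) \<le> G.shrink K" using j(2) r unfolding dist_c'
    by (meson divide_right_mono less_imp_le mult_pos_pos order_trans zero_less_numeral)
  then have "1 \<le> G.shrink K * (2 * r)" using r by (simp add: divide_le_eq)
  then have "3 * 2 ^ 2 ^ K \<le> 2 * r"
    by (simp add: G.shrink_def power_divide field_simps)
  moreover have "r \<le> real (grid_size (B ` fst G))"
    using \<open>n \<ge> 1\<close> Bc fstG by (intro radius_le_grid_size[of _ 0]) auto
  moreover have "f_graph G \<le> f_UDG n"
    unfolding f_UDG_def using finite_UDG GU by (intro Max_ge) auto
  ultimately have "3 * 2 ^ 2 ^ K \<le> 2 * real (f_UDG n)" using B(2) by linarith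
  moreover have "(0 :: real) \<le> 2 ^ 2 ^ K" by simp
  ultimately show ?thesis by linarith
qed

theorem theorem1p2:
  "\<exists>c\<^sub>1 c\<^sub>2 :: real. \<exists>n\<^sub>0 :: nat. c\<^sub>1 > 0 \<and> c\<^sub>2 > 0 \<and>
     (\<forall>n \<ge> n\<^sub>0. 2 powr (2 powr (c\<^sub>1 * real n)) \<le> real (f_UDG n) \<and>
               real (f_UDG n) \<le> 2 powr (2 powr (c\<^sub>2 * real n)))"
proof (intro exI conjI allI impI)
  show "(0 :: real) < 1 / (32 * copies)" "(0 :: real) < 16" by (simp_all add: copies_def)
  fix n :: nat assume n: "34 * copies \<le> n"
  then have "1 \<le> n" by (simp add: copies_def)
  then show "real (f_UDG n) \<le> 2 powr (2 powr (16 * real n))" by (rule f_UDG_upper)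
  \<comment> \<open>Half of n pays for the 8 * K part, and n \<ge> 34 * copies for the 17. As K
    \<ge> 1, rounding down loses at most a factor 2, hence 32 in the constant.\<close>
  define K where "K = n div (16 * copies)"
  have c: "0 < 16 * copies" by (simp add: copies_def)
  have "16 * copies * K \<le> n" unfolding K_def by simp
  then have "copies * (8 * K + 17) \<le> n" using n by (simp add: distrib_left)
  then have lower: "2 ^ 2 ^ K \<le> real (f_UDG n)" by (rule f_UDG_ge_double_exponential)
  have "n < 16 * copies * Suc K" unfolding K_def using dividend_less_times_div[OF c, of n] by simp
  then have "n \<le> 32 * copies * K"
  proof -
    have "1 \<le> K" unfolding K_def using n c by (simp add: div_greater_zero_iff Suc_le_eq)
    then have "16 * copies * Suc K \<le> 32 * copies * K" by simp
    then show ?thesis using \<open>n < 16 * copies * Suc K\<close> by linarith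
  qed
  then have "real n \<le> 32 * real copies * real K" by (metis of_nat_le_iff of_nat_mult of_nat_numeral)
  then have "1 / (32 * real copies) * real n \<le> real K" using c by (simp add: divide_le_eq mult.commute)
  then have "2 powr (2 powr (1 / (32 * real copies) * real n)) \<le> (2 :: real) powr (2 powr real K)"
    by (intro powr_mono) auto
  also have "\<dots> = 2 ^ 2 ^ K" by (simp add: powr_realpow[symmetric])
  also have "\<dots> \<le> real (f_UDG n)" by (rule lower)
  finally show "2 powr (2 powr (1 / real (32 * copies) * real n)) \<le> real (f_UDG n)"
    by (simp only: of_nat_mult of_nat_numeral)
qed

end
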